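(* Let $k\ge 1$ be such that $\lambda_k<\lambda_{k+1}$, let $\lambda_k<\alpha<\lambda_{k+1}$, and let $\beta=\beta(\alpha)$. Let $f:\mathbb{R}\to\mathbb{R}$ be bounded and continuous, let $h\in L^2(\Omega)$, and put $F(t)=\int_0^tf(\tau)\,d\tau$. Assume the generalized Landesman–Lazer condition: whenever $\{u_j\}\subset X_0$ satisfies $\|u_j\|_{L^2}\to\infty$ and $u_j/\|u_j\|_{L^2}$ converges in $L^2(\Omega)$ to some nontrivial Fučík eigenfunction $v$ associated with $(\alpha,\beta)$, then $$\lim_{j\to\infty}\int_\Omega\big(F(u_j)+hu_j\big)\,dx=-\infty.$$ Then the problem $$-\mathcal{L}_K u=\alpha u^+-\beta u^-+f(u)+h\ \text{ in }\Omega,\qquad u=0\ \text{ on }\mathbb{R}^n\setminus\Omega,$$ has at least one weak solution $u\in X_0$.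
   Context: Setting: $s\in(0,1)$, $n>2s$, $\Omega\subset\mathbb{R}^n$ is a bounded domain with Lipschitz boundary, and $u^\pm=\max\{\pm u,0\}$. The kernel $K:\mathbb{R}^n\setminus\{0\}\to(0,\infty)$ satisfies: $mK\in L^1(\mathbb{R}^n)$ with $m(x)=\min\{|x|^2,1\}$; there is $\lambda>0$ with $K(x)\ge\lambda|x|^{-(n+2s)}$; and $K(x)=K(-x)$. The operator is $\mathcal{L}_Ku(x)=\frac12\int_{\mathbb{R}^n}(u(x+y)+u(x-y)-2u(x))K(y)\,dy$. Spaces: $Q=\mathbb{R}^{2n}\setminus((\mathbb{R}^n\setminus\Omega)\times(\mathbb{R}^n\setminus\Omega))$. $X$ is the set of measurable $u:\mathbb{R}^n\to\mathbb{R}$ with $u|_\Omega\in L^2(\Omega)$ and $(u(x)-u(y))\sqrt{K(x-y)}\in L^2(Q)$. $X_0=\{u\in X: u=0\text{ a.e. in }\mathbb{R}^n\setminus\Omega\}$ is a Hilbert space with norm $\|u\|=\left(\int_Q|u(x)-u(y)|^2K(x-y)\,dx\,dy\right)^{1/2}$. $\|\cdot\|_{L^2}$ is the norm of $L^2(\Omega)$. Weak solution: $u\in X_0$ is a weak solution of $-\mathcal{L}_Ku=g$ in $\Omega$, $u=0$ on $\mathbb{R}^n\setminus\Omega$ (where $g$ may depend on $u$), if $\int_Q(u(x)-u(y))(v(x)-v(y))K(x-y)\,dx\,dy=\int_\Omega g\,v\,dx$ for all $v\in X_0$. A nontrivial Fučík eigenfunction associated with $(\alpha,\beta)$ is a nonzero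 weak solution of $-\mathcal{L}_Kv=\alpha v^+-\beta v^-$ in $\Omega$, $v=0$ on $\mathbb{R}^n\setminus\Omega$. Eigenvalues: $0<\lambda_1<\lambda_2\le\lambda_3\le\cdots$ are the eigenvalues (counted with multiplicity) of $-\mathcal{L}_Ku=\lambda u$ in $\Omega$, $u=0$ on $\mathbb{R}^n\setminus\Omega$ (in the weak sense above), with eigenfunctions $\phi_1,\phi_2,\dots$ forming an orthonormal basis of $L^2(\Omega)$ and an orthogonal basis of $X_0$. $X_1=\mathrm{span}\{\phi_1,\dots,\phi_k\}$ and $X_2=X_1^\perp$ in $X_0$. Definition of $\beta(\alpha)$: let $J_{\alpha,\beta}(u)=\frac12\left(\|u\|^2-\alpha\int_\Omega|u^+|^2-\beta\int_\Omega|u^-|^2\right)$ on $X_0$ and, for $\lambda_k<\alpha<\lambda_{k+1}$, $\beta\ge\alpha$, let $$m(\alpha,\beta)=\min_{v\in X_2,\ \|v\|_{L^2}=1}\ \max_{u\in X_1}J_{\alpha,\beta}(u+v).$$ When there is $\beta\ge\alpha$ with $m(\alpha,\beta)=0$, it is unique and greater than $\lambda_{k+1}$, and it is denoted $\beta(\alpha)$. The hypothesis $\beta=\beta(\alpha)$ is understood to include the existence of $\beta(\alpha)$. *)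

theory Defs
  imports "HOL-Analysis.Analysis"
begin

section \<open>Domains and kernels\<close>

text \<open>Near each of its boundary points the set lies strictly on one side of the graph of a Lipschitz
  function over a hyperplane; \<open>e\<close> is the direction of the graph.\<close>

definition lipschitz_boundary :: "(real ^ 'n) set \<Rightarrow> bool" where
  "lipschitz_boundary \<Omega> \<longleftrightarrow>
     (\<forall>p\<in>frontier \<Omega>. \<exists>e g L r. norm e = 1 \<and> r > 0 \<and> lipschitz_on L {y. y \<bullet> e = 0} g \<and>
        (\<forall>x\<in>ball p r. x \<in> \<Omega> \<longleftrightarrow> g (x - (x \<bullet> e) *\<^sub>R e) < x \<bullet> e))"

definition bounded_lipschitz_domain :: "(real ^ 'n) set \<Rightarrow> bool" where
  "bounded_lipschitz_domain \<Omega> \<longleftrightarrow>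
     open \<Omega> \<and> connected \<Omega> \<and> \<Omega> \<noteq> {} \<and> bounded \<Omega> \<and> lipschitz_boundary \<Omega>"

text \<open>The value of the kernel at the origin is irrelevant.\<close>

definition admissible_kernel :: "real \<Rightarrow> (real ^ 'n \<Rightarrow> real) \<Rightarrow> bool" where
  "admissible_kernel s K \<longleftrightarrow>
     (\<forall>x. x \<noteq> 0 \<longrightarrow> K x > 0) \<and>
     integrable lebesgue (\<lambda>x. min ((norm x)\<^sup>2) 1 * K x) \<and>
     (\<exists>c>0. \<forall>x. x \<noteq> 0 \<longrightarrow> K x \<ge> c * norm x powr (- (real CARD('n) + 2 * s))) \<and>
     (\<forall>x. x \<noteq> 0 \<longrightarrow> K (- x) = K x)"


section \<open>Function spaces\<close>

text \<open>Elements of the spaces are functions, not classes modulo equality almost everywhere.\<close>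

definition L2_on :: "'a::euclidean_space set \<Rightarrow> ('a \<Rightarrow> real) \<Rightarrow> bool" where
  "L2_on A f \<longleftrightarrow> set_borel_measurable lebesgue A f \<and> set_integrable lebesgue A (\<lambda>x. (f x)\<^sup>2)"

definition L2_inner :: "'a::euclidean_space set \<Rightarrow> ('a \<Rightarrow> real) \<Rightarrow> ('a \<Rightarrow> real) \<Rightarrow> real" where
  "L2_inner A f g = (LINT x:A|lebesgue. f x * g x)"

definition L2_norm :: "'a::euclidean_space set \<Rightarrow> ('a \<Rightarrow> real) \<Rightarrow> real" where
  "L2_norm A f = sqrt (LINT x:A|lebesgue. (f x)\<^sup>2)"

definition Q_set :: "(real ^ 'n) set \<Rightarrow> ((real ^ 'n) \<times> (real ^ 'n)) set" where
  "Q_set \<Omega> = UNIV - (- \<Omega>) \<times> (- \<Omega>)"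

definition space_X :: "(real ^ 'n \<Rightarrow> real) \<Rightarrow> (real ^ 'n) set \<Rightarrow> (real ^ 'n \<Rightarrow> real) set" where
  "space_X K \<Omega> =
     {u. u \<in> borel_measurable lebesgue \<and> L2_on \<Omega> u \<and>
         L2_on (Q_set \<Omega>) (\<lambda>(x, y). (u x - u y) * sqrt (K (x - y)))}"

definition space_X0 :: "(real ^ 'n \<Rightarrow> real) \<Rightarrow> (real ^ 'n) set \<Rightarrow> (real ^ 'n \<Rightarrow> real) set" where
  "space_X0 K \<Omega> = {u \<in> space_X K \<Omega>. AE x in lebesgue. x \<notin> \<Omega> \<longrightarrow> u x = 0}"

definition X0_inner ::
  "(real ^ 'n \<Rightarrow> real) \<Rightarrow> (real ^ 'n) set \<Rightarrow> (real ^ 'n \<Rightarrow> real) \<Rightarrow> (real ^ 'n \<Rightarrow> real) \<Rightarrow> real" where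
  "X0_inner K \<Omega> u v =
     (LINT p:Q_set \<Omega>|lebesgue. case p of (x, y) \<Rightarrow> (u x - u y) * (v x - v y) * K (x - y))"

definition X0_norm :: "(real ^ 'n \<Rightarrow> real) \<Rightarrow> (real ^ 'n) set \<Rightarrow> (real ^ 'n \<Rightarrow> real) \<Rightarrow> real" where
  "X0_norm K \<Omega> u =
     sqrt (LINT p:Q_set \<Omega>|lebesgue. case p of (x, y) \<Rightarrow> \<bar>u x - u y\<bar>\<^sup>2 * K (x - y))"


section \<open>Weak solutions, eigenfunctions and Fucik eigenfunctions\<close>

text \<open>\<open>g\<close> is the right-hand side as a function of the space variable; for a nonlinear problem it is
  built from \<open>u\<close>.\<close>

definition weak_solution ::
  "(real ^ 'n \<Rightarrow> real) \<Rightarrow> (real ^ 'n) set \<Rightarrow> (real ^ 'n \<Rightarrow> real) \<Rightarrow> (real ^ 'n \<Rightarrow> real) \<Rightarrow> bool" where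
  "weak_solution K \<Omega> g u \<longleftrightarrow>
     u \<in> space_X0 K \<Omega> \<and>
     (\<forall>v\<in>space_X0 K \<Omega>. X0_inner K \<Omega> u v = (LINT x:\<Omega>|lebesgue. g x * v x))"

definition nontrivial_fucik_eigenfunction ::
  "(real ^ 'n \<Rightarrow> real) \<Rightarrow> (real ^ 'n) set \<Rightarrow> real \<Rightarrow> real \<Rightarrow> (real ^ 'n \<Rightarrow> real) \<Rightarrow> bool" where
  "nontrivial_fucik_eigenfunction K \<Omega> \<alpha> \<beta> v \<longleftrightarrow>
     weak_solution K \<Omega> (\<lambda>x. \<alpha> * max (v x) 0 - \<beta> * max (- v x) 0) v \<and>
     \<not> (AE x in lebesgue. v x = 0)"

text \<open>A numbering, starting at 1, of the eigenvalues with eigenfunctions that form an orthonormal basis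
  of \<open>L\<^sup>2(\<Omega>)\<close> and an orthogonal basis of \<open>X\<^sub>0\<close> (pairwise orthogonal with dense span). As
  eigenfunctions for different eigenvalues are orthogonal, the basis property makes every eigenvalue
  occur in the list, as often as its multiplicity.\<close>

definition eigensystem ::
  "(real ^ 'n \<Rightarrow> real) \<Rightarrow> (real ^ 'n) set \<Rightarrow> (nat \<Rightarrow> real) \<Rightarrow> (nat \<Rightarrow> real ^ 'n \<Rightarrow> real) \<Rightarrow> bool" where
  "eigensystem K \<Omega> ev \<phi> \<longleftrightarrow>
     0 < ev 1 \<and> ev 1 < ev 2 \<and> (\<forall>i\<ge>1. \<forall>j\<ge>i. ev i \<le> ev j) \<and>
     (\<forall>j\<ge>1. weak_solution K \<Omega> (\<lambda>x. ev j * \<phi> j x) (\<phi> j)) \<and>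
     (\<forall>i\<ge>1. \<forall>j\<ge>1. L2_inner \<Omega> (\<phi> i) (\<phi> j) = (if i = j then 1 else 0)) \<and>
     (\<forall>w. L2_on \<Omega> w \<longrightarrow>
        (\<forall>\<epsilon>>0. \<exists>N c. L2_norm \<Omega> (\<lambda>x. w x - (\<Sum>j=1..N. c j * \<phi> j x)) < \<epsilon>)) \<and>
     (\<forall>i\<ge>1. \<forall>j\<ge>1. i \<noteq> j \<longrightarrow> X0_inner K \<Omega> (\<phi> i) (\<phi> j) = 0) \<and>
     (\<forall>w\<in>space_X0 K \<Omega>.
        \<forall>\<epsilon>>0. \<exists>N c. X0_norm K \<Omega> (\<lambda>x. w x - (\<Sum>j=1..N. c j * \<phi> j x)) < \<epsilon>)"


section \<open>The functional and the Fucik curve\<close>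

definition J_functional ::
  "(real ^ 'n \<Rightarrow> real) \<Rightarrow> (real ^ 'n) set \<Rightarrow> real \<Rightarrow> real \<Rightarrow> (real ^ 'n \<Rightarrow> real) \<Rightarrow> real" where
  "J_functional K \<Omega> \<alpha> \<beta> u =
     1 / 2 * ((X0_norm K \<Omega> u)\<^sup>2 - \<alpha> * (LINT x:\<Omega>|lebesgue. \<bar>max (u x) 0\<bar>\<^sup>2)
                             - \<beta> * (LINT x:\<Omega>|lebesgue. \<bar>max (- u x) 0\<bar>\<^sup>2))"

definition space_X1 :: "(nat \<Rightarrow> real ^ 'n \<Rightarrow> real) \<Rightarrow> nat \<Rightarrow> (real ^ 'n \<Rightarrow> real) set" where
  "space_X1 \<phi> k = {u. \<exists>c. u = (\<lambda>x. \<Sum>j=1..k. c j * \<phi> j x)}"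

definition space_X2 ::
  "(real ^ 'n \<Rightarrow> real) \<Rightarrow> (real ^ 'n) set \<Rightarrow> (nat \<Rightarrow> real ^ 'n \<Rightarrow> real) \<Rightarrow> nat \<Rightarrow> (real ^ 'n \<Rightarrow> real) set"
  where
  "space_X2 K \<Omega> \<phi> k = {v \<in> space_X0 K \<Omega>. \<forall>u\<in>space_X1 \<phi> k. X0_inner K \<Omega> u v = 0}"

definition is_maximum :: "'a set \<Rightarrow> ('a \<Rightarrow> real) \<Rightarrow> real \<Rightarrow> bool" where
  "is_maximum S F M \<longleftrightarrow> (\<exists>u\<in>S. F u = M) \<and> (\<forall>u\<in>S. F u \<le> M)"

definition is_minimum :: "'a set \<Rightarrow> ('a \<Rightarrow> real) \<Rightarrow> real \<Rightarrow> bool" where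
  "is_minimum S F M \<longleftrightarrow> (\<exists>u\<in>S. F u = M) \<and> (\<forall>u\<in>S. M \<le> F u)"

text \<open>The relation \<open>m(\<alpha>,\<beta>) = \<mu>\<close>; the minimum and the maxima are attained, and \<open>M v\<close> is the
  inner maximum.\<close>

definition is_minimax_value ::
  "(real ^ 'n \<Rightarrow> real) \<Rightarrow> (real ^ 'n) set \<Rightarrow> (nat \<Rightarrow> real ^ 'n \<Rightarrow> real) \<Rightarrow> nat \<Rightarrow> real \<Rightarrow> real \<Rightarrow> real \<Rightarrow> bool"
  where
  "is_minimax_value K \<Omega> \<phi> k \<alpha> \<beta> \<mu> \<longleftrightarrow>
     (\<exists>M. (\<forall>v\<in>{v \<in> space_X2 K \<Omega> \<phi> k. L2_norm \<Omega> v = 1}.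
              is_maximum (space_X1 \<phi> k) (\<lambda>u. J_functional K \<Omega> \<alpha> \<beta> (\<lambda>x. u x + v x)) (M v)) \<and>
          is_minimum {v \<in> space_X2 K \<Omega> \<phi> k. L2_norm \<Omega> v = 1} M \<mu>)"

text \<open>The relation \<open>\<beta> = \<beta>(\<alpha>)\<close>, which includes the existence of \<open>\<beta>(\<alpha>)\<close>.\<close>

definition is_beta_of ::
  "(real ^ 'n \<Rightarrow> real) \<Rightarrow> (real ^ 'n) set \<Rightarrow> (nat \<Rightarrow> real ^ 'n \<Rightarrow> real) \<Rightarrow> nat \<Rightarrow> real \<Rightarrow> real \<Rightarrow> bool" where
  "is_beta_of K \<Omega> \<phi> k \<alpha> \<beta> \<longleftrightarrow> \<beta> \<ge> \<alpha> \<and> is_minimax_value K \<Omega> \<phi> k \<alpha> \<beta> 0"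

end

(* The problem is variational: its solutions are the critical points of Phi = J - pert, where J is the
   quadratic-type functional of the Fucik problem and pert w is the integral of F(w) + h w.  Along X_1 the
   functional J is strongly concave, and m(alpha,beta) = 0 says by homogeneity that every affine space
   w + X_1 contains a point where J >= 0.  Hence J w + C |dJ(w) restricted to X_1|^2 >= 0 on the whole
   space; a w with J w <= 0 and dJ(w) = 0 on X_1 minimises the left-hand side and is therefore a critical
   point of J, that is a solution of the Fucik problem.  Normalising an unbounded sequence and using this
   inequality, the Landesman-Lazer condition shows that Phi has bounded sublevel sets as long as dJ
   restricted to X_1 stays bounded.  So on X_1 the functional Phi tends to minus infinity, while it is
   bounded below on the set where dJ vanishes on X_1, and this set links with the large spheres of X_1.
   In each Galerkin space, iterated Euler steps along the negative gradient would unlink them if there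
   were no almost critical point below the maximum of Phi on X_1.  These points are bounded, and a limit
   of them is a solution.  Compactness of X_0 in L^2 comes from the eigenvalues being unbounded, which is
   seen on indicators of small balls. *)

theory Submission
  imports Defs "HOL-Homology.Brouwer_Degree" "HOL-Complex_Analysis.Great_Picard"
begin

section \<open>Square integrable functions\<close>

text \<open>The obstacle is that the perturbation grows linearly while J degenerates along the Fucik
  eigenfunctions, and that the set where \<open>dJ\<close> vanishes on X_1 need not be a linear
  subspace. The inequality with the squared gradient comes from maximising the second order bound
  \<open>J_upper\<close> over X_1: there J is concave with a modulus given by \<alpha> -
  \<open>ev k\<close>, whence the constant \<kappa>. It holds at the original scale, not only after
  normalisation, and this is what meets the Landesman-Lazer limit. It also tolerates
  \<open>dJ\<close> being merely bounded on X_1; since f and h change each component of the gradient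
  by at most \<open>H\<close>, almost critical points of \<Phi> fall under the same estimate. As f
  is only continuous, the gradient of \<Phi> need not be locally Lipschitz, so discrete steps stand
  in for a flow. The Galerkin spaces supply the bound of the energy by \<open>ev N\<close> times the
  squared L2 norm that a uniform step size needs. The topological input is the non-contractibility
  of the sphere in X_1; it yields a zero of k components of \<open>dJ\<close> however many further
  dimensions the steps move in.\<close>

definition sqint :: "'a measure \<Rightarrow> ('a \<Rightarrow> real) \<Rightarrow> bool" where
  "sqint M f \<longleftrightarrow> f \<in> borel_measurable M \<and> integrable M (\<lambda>x. (f x)\<^sup>2)"

text \<open>Kept for an arbitrary measure since two L2 spaces occur: functions on \<Omega>, and the
  weighted differences \<open>D u\<close> on \<open>Q_set \<Omega>\<close>. Elements stay functions,
  so vanishing norm only gives equality almost everywhere.\<close>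

definition l2norm :: "'a measure \<Rightarrow> ('a \<Rightarrow> real) \<Rightarrow> real" where
  "l2norm M f = sqrt (\<integral>x. (f x)\<^sup>2 \<partial>M)"

lemma sqint_integrable_square: "sqint M f \<Longrightarrow> integrable M (\<lambda>x. (f x)\<^sup>2)"
  by (simp add: sqint_def)

lemma sqint_integrable_mult:
  assumes "sqint M f" "sqint M g"
  shows "integrable M (\<lambda>x. f x * g x)"
proof (rule Bochner_Integration.integrable_bound)
  show "integrable M (\<lambda>x. (f x)\<^sup>2 + (g x)\<^sup>2)"
    using assms by (auto simp: sqint_def)
  show "(\<lambda>x. f x * g x) \<in> borel_measurable M"
    using assms by (auto simp: sqint_def)
  have "\<bar>f x * g x\<bar> \<le> (f x)\<^sup>2 + (g x)\<^sup>2" for x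
  proof -
    have "2 * \<bar>f x\<bar> * \<bar>g x\<bar> \<le> \<bar>f x\<bar>\<^sup>2 + \<bar>g x\<bar>\<^sup>2" by (rule sum_squares_bound)
    moreover have "0 \<le> \<bar>f x\<bar> * \<bar>g x\<bar>" by simp
    ultimately show ?thesis unfolding abs_mult power2_abs by linarith
  qed
  then show "AE x in M. norm (f x * g x) \<le> norm ((f x)\<^sup>2 + (g x)\<^sup>2)"
    by auto
qed

lemma sqint_zero [simp]: "sqint M (\<lambda>x. 0)"
  by (simp add: sqint_def)

lemma sqint_add:
  assumes "sqint M f" "sqint M g"
  shows "sqint M (\<lambda>x. f x + g x)"
proof -
  have "integrable M (\<lambda>x. (f x)\<^sup>2 + (g x)\<^sup>2 + 2 * (f x * g x))"
    using assms sqint_integrable_mult[OF assms] by (auto simp: sqint_def)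
  then show ?thesis
    using assms by (auto simp: sqint_def power2_sum mult.assoc)
qed

lemma sqint_cmult: "sqint M f \<Longrightarrow> sqint M (\<lambda>x. c * f x)"
  by (auto simp: sqint_def power_mult_distrib)

lemma sqint_minus: "sqint M f \<Longrightarrow> sqint M (\<lambda>x. - f x)"
  by (auto simp: sqint_def)

lemma sqint_diff: "sqint M f \<Longrightarrow> sqint M g \<Longrightarrow> sqint M (\<lambda>x. f x - g x)"
  using sqint_add[of M f "\<lambda>x. - g x"] by (simp add: sqint_minus)

lemma sqint_sum: "(\<And>i. i \<in> I \<Longrightarrow> sqint M (f i)) \<Longrightarrow> sqint M (\<lambda>x. \<Sum>i\<in>I. f i x)"
  by (induction I rule: infinite_finite_induct) (auto intro: sqint_add)

lemma sqint_bound: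
  assumes "sqint M g" "f \<in> borel_measurable M" "AE x in M. \<bar>f x\<bar> \<le> \<bar>g x\<bar>"
  shows "sqint M f"
proof -
  have "integrable M (\<lambda>x. (f x)\<^sup>2)"
    by (rule Bochner_Integration.integrable_bound[of _ "\<lambda>x. (g x)\<^sup>2"])
      (use assms in \<open>auto simp: sqint_def abs_le_square_iff\<close>)
  then show ?thesis using assms by (simp add: sqint_def)
qed

lemma l2norm_nonneg [simp]: "0 \<le> l2norm M f"
  by (simp add: l2norm_def)

lemma l2norm_power2: "(l2norm M f)\<^sup>2 = (\<integral>x. (f x)\<^sup>2 \<partial>M)"
  by (simp add: l2norm_def)

text \<open>The integral of the square of f + t g is nonnegative for every t, so this quadratic
  polynomial in t has nonpositive discriminant.\<close>

lemma sqint_Cauchy_Schwarz: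
  assumes f: "sqint M f" and g: "sqint M g"
  shows "\<bar>\<integral>x. f x * g x \<partial>M\<bar> \<le> l2norm M f * l2norm M g"
proof -
  define a b c where "a = (\<integral>x. (f x)\<^sup>2 \<partial>M)" and "b = (\<integral>x. f x * g x \<partial>M)" and "c = (\<integral>x. (g x)\<^sup>2 \<partial>M)"
  have nn: "a \<ge> 0" "c \<ge> 0" by (simp_all add: a_def c_def)
  have *: "0 \<le> a + 2 * t * b + t\<^sup>2 * c" for t
  proof -
    have "0 \<le> (\<integral>x. (f x + t * g x)\<^sup>2 \<partial>M)" by simp
    also have "\<dots> = (\<integral>x. (f x)\<^sup>2 + 2 * t * (f x * g x) + t\<^sup>2 * (g x)\<^sup>2 \<partial>M)"
      by (rule Bochner_Integration.integral_cong) (auto simp: power2_eq_square algebra_simps)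
    also have "\<dots> = a + 2 * t * b + t\<^sup>2 * c"
      using sqint_integrable_mult[OF f g] f g by (simp add: a_def b_def c_def sqint_def)
    finally show ?thesis .
  qed
  have "b\<^sup>2 \<le> a * c"
  proof (cases "c = 0")
    case True
    have "b = 0"
    proof (rule ccontr)
      assume "b \<noteq> 0"
      \<comment> \<open>For \<open>c = 0\<close> the polynomial is affine and takes the value -1 at
        this t.\<close>
      with *[of "- (a + 1) / (2 * b)"] True show False by (simp add: field_simps)
    qed
    then show ?thesis using nn by simp
  next
    case False
    with nn have "c > 0" by simp
    with *[of "- b / c"] show ?thesis by (simp add: field_simps power2_eq_square)
  qed
  then have "sqrt (b\<^sup>2) \<le> sqrt (a * c)" by (rule real_sqrt_le_mono)
  then show ?thesis by (simp add: l2norm_def a_def b_def c_def real_sqrt_mult)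
qed

lemma l2norm_cmult: "l2norm M (\<lambda>x. c * f x) = \<bar>c\<bar> * l2norm M f"
  by (simp add: l2norm_def power_mult_distrib real_sqrt_mult)

lemma l2norm_minus_commute: "l2norm M (\<lambda>x. f x - g x) = l2norm M (\<lambda>x. g x - f x)"
  by (simp add: l2norm_def power2_commute)

lemma l2norm_triangle:
  assumes f: "sqint M f" and g: "sqint M g"
  shows "l2norm M (\<lambda>x. f x + g x) \<le> l2norm M f + l2norm M g"
proof -
  have "(l2norm M (\<lambda>x. f x + g x))\<^sup>2 = (\<integral>x. (f x)\<^sup>2 + 2 * (f x * g x) + (g x)\<^sup>2 \<partial>M)"
    unfolding l2norm_power2
    by (rule Bochner_Integration.integral_cong) (auto simp: power2_eq_square algebra_simps)
  also have "\<dots> = (l2norm M f)\<^sup>2 + 2 * (\<integral>x. f x * g x \<partial>M) + (l2norm M g)\<^sup>2"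
    using sqint_integrable_mult[OF f g] f g by (simp add: l2norm_power2 sqint_def)
  also have "\<dots> \<le> (l2norm M f + l2norm M g)\<^sup>2"
    using sqint_Cauchy_Schwarz[OF f g] by (simp add: power2_sum)
  finally show ?thesis
    by (rule power2_le_imp_le) simp
qed

lemma l2norm_triangle_diff:
  assumes "sqint M f" "sqint M g" "sqint M h"
  shows "l2norm M (\<lambda>x. f x - h x) \<le> l2norm M (\<lambda>x. f x - g x) + l2norm M (\<lambda>x. g x - h x)"
  using l2norm_triangle[of M "\<lambda>x. f x - g x" "\<lambda>x. g x - h x"] assms by (simp add: sqint_diff)

lemma l2norm_diff_ineq:
  assumes "sqint M f" "sqint M g"
  shows "\<bar>l2norm M f - l2norm M g\<bar> \<le> l2norm M (\<lambda>x. f x - g x)"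
  using l2norm_triangle[of M "\<lambda>x. f x - g x" g] l2norm_triangle[of M "\<lambda>x. g x - f x" f] assms
    l2norm_minus_commute[of M f g]
  by (auto simp: sqint_diff)

lemma l2norm_mono:
  assumes "sqint M f" "sqint M g" "\<And>x. x \<in> space M \<Longrightarrow> \<bar>f x\<bar> \<le> \<bar>g x\<bar>"
  shows "l2norm M f \<le> l2norm M g"
  unfolding l2norm_def
  by (intro real_sqrt_le_mono integral_mono) (use assms in \<open>auto simp: sqint_def abs_le_square_iff\<close>)

text \<open>Lower semicontinuity of the squared norm under convergence almost everywhere. That the
  limit is square integrable is part of the conclusion, which later makes limits members of
  X_0.\<close>

lemma sqint_Fatou:
  assumes f: "\<And>n. sqint M (f n)" and g: "g \<in> borel_measurable M"
    and lim: "AE x in M. (\<lambda>n. f n x) \<longlonglongrightarrow> g x"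
    and le: "\<forall>\<^sub>F n in sequentially. (\<integral>x. (f n x)\<^sup>2 \<partial>M) \<le> C"
  shows "sqint M g \<and> (\<integral>x. (g x)\<^sup>2 \<partial>M) \<le> C"
proof -
  have C: "0 \<le> C"
  proof -
    obtain n where "(\<integral>x. (f n x)\<^sup>2 \<partial>M) \<le> C" using eventually_happens[OF le] by auto
    moreover have "0 \<le> (\<integral>x. (f n x)\<^sup>2 \<partial>M)" by simp
    ultimately show ?thesis by linarith
  qed
  have "(\<integral>\<^sup>+x. ennreal ((g x)\<^sup>2) \<partial>M) = (\<integral>\<^sup>+x. liminf (\<lambda>n. ennreal ((f n x)\<^sup>2)) \<partial>M)"
  proof (rule nn_integral_cong_AE)
    show "AE x in M. ennreal ((g x)\<^sup>2) = liminf (\<lambda>n. ennreal ((f n x)\<^sup>2))"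
      using lim
    proof eventually_elim
      case (elim x)
      have "(\<lambda>n. ennreal ((f n x)\<^sup>2)) \<longlonglongrightarrow> ennreal ((g x)\<^sup>2)"
        by (intro tendsto_ennrealI tendsto_power elim)
      from lim_imp_Liminf[OF _ this] show ?case by simp
    qed
  qed
  also have "\<dots> \<le> liminf (\<lambda>n. \<integral>\<^sup>+x. ennreal ((f n x)\<^sup>2) \<partial>M)"
    by (rule nn_integral_liminf) (use f in \<open>auto simp: sqint_def\<close>)
  also have "\<dots> \<le> ennreal C"
  proof (rule Liminf_le)
    show "\<forall>\<^sub>F n in sequentially. (\<integral>\<^sup>+x. ennreal ((f n x)\<^sup>2) \<partial>M) \<le> ennreal C"
      using le by eventually_elim
        (subst nn_integral_eq_integral, use f in \<open>auto simp: sqint_def intro: ennreal_leI\<close>)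
  qed simp
  finally have *: "(\<integral>\<^sup>+x. ennreal ((g x)\<^sup>2) \<partial>M) \<le> ennreal C" .
  then have int: "integrable M (\<lambda>x. (g x)\<^sup>2)"
    using g by (intro integrableI_nonneg) (auto intro: le_less_trans)
  moreover have "(\<integral>x. (g x)\<^sup>2 \<partial>M) \<le> C"
    using * nn_integral_eq_integral[OF int] C by auto
  ultimately show ?thesis using g by (simp add: sqint_def)
qed

section \<open>Completeness of L2 and convergence almost everywhere of subsequences\<close>

text \<open>Riesz-Fischer. Along a subsequence whose consecutive gaps are below
  \<open>(1/2) ^ n\<close>, the increments are summable in L1 because the measure is finite, hence
  absolutely summable at almost every point. Fatou's lemma applied to \<open>f m - f (r l)\<close>
  in l then gives L2 convergence of the full sequence.\<close>

lemma sqint_AE_subseq_limit: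
  assumes fin: "finite_measure M" and f: "\<And>n. sqint M (f n)"
    and Cauchy: "\<And>e. 0 < e \<Longrightarrow> \<exists>N. \<forall>m\<ge>N. \<forall>n\<ge>N. l2norm M (\<lambda>x. f m x - f n x) < e"
  obtains g r where "sqint M g" "strict_mono (r :: nat \<Rightarrow> nat)"
    "AE x in M. (\<lambda>n. f (r n) x) \<longlonglongrightarrow> g x" "(\<lambda>n. l2norm M (\<lambda>x. f n x - g x)) \<longlonglongrightarrow> 0"
proof -
  interpret finite_measure M by (rule fin)
  have [measurable]: "f n \<in> borel_measurable M" for n using f by (simp add: sqint_def)
  have "\<exists>N. \<forall>n. \<forall>m\<ge>N n. \<forall>k\<ge>N n. l2norm M (\<lambda>x. f m x - f k x) < (1/2) ^ n"
    using Cauchy by (intro choice) simp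
  then obtain N where N: "\<And>n m k. m \<ge> N n \<Longrightarrow> k \<ge> N n \<Longrightarrow> l2norm M (\<lambda>x. f m x - f k x) < (1/2) ^ n"
    by blast
  \<comment> \<open>Adding n and all thresholds up to n makes r strictly increasing and at least
    \<open>N n\<close>.\<close>
  define r where "r n = n + (\<Sum>i\<le>n. N i)" for n
  have r: "strict_mono r" by (rule strict_monoI_Suc) (simp add: r_def)
  have rN: "r m \<ge> N n" if "m \<ge> n" for m n
    using member_le_sum[of n "{..m}" N] that by (simp add: r_def)
  define d where "d n x = \<bar>f (r (Suc n)) x - f (r n) x\<bar>" for n x
  have sd: "sqint M (\<lambda>x. f (r (Suc n)) x - f (r n) x)" for n
    by (intro sqint_diff f)
  have one: "sqint M (\<lambda>x. 1)" by (simp add: sqint_def)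
  have dsq: "sqint M (d n)" for n
    using sd[of n] unfolding sqint_def d_def[abs_def] by (auto intro: borel_measurable_abs)
  have dint: "integrable M (d n)" for n
    using sqint_integrable_mult[OF dsq one] by simp
  have dle: "(\<integral>x. d n x \<partial>M) \<le> (1/2) ^ n * l2norm M (\<lambda>x. 1)" for n
  proof -
    have "(\<integral>x. d n x \<partial>M) \<le> l2norm M (d n) * l2norm M (\<lambda>x. 1)"
      using sqint_Cauchy_Schwarz[OF dsq one, of n] by simp
    also have "l2norm M (d n) = l2norm M (\<lambda>x. f (r (Suc n)) x - f (r n) x)"
      by (simp add: l2norm_def d_def)
    also have "\<dots> \<le> (1/2) ^ n"
      using N[of n "r (Suc n)" "r n"] rN by (simp add: less_imp_le)
    finally show ?thesis by (simp add: mult_right_mono)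
  qed
  have "(\<integral>\<^sup>+x. suminf (\<lambda>n. ennreal (d n x)) \<partial>M) = suminf (\<lambda>n. \<integral>\<^sup>+x. ennreal (d n x) \<partial>M)"
    by (rule nn_integral_suminf) (simp add: d_def)
  also have "\<dots> = suminf (\<lambda>n. ennreal (\<integral>x. d n x \<partial>M))"
    by (intro suminf_cong nn_integral_eq_integral dint) (simp add: d_def)
  also have "\<dots> \<le> suminf (\<lambda>n. ennreal ((1/2) ^ n * l2norm M (\<lambda>x. 1)))"
    by (intro suminf_le ennreal_leI dle) auto
  also have "\<dots> < \<infinity>"
  proof -
    have "summable (\<lambda>n. (1/2::real) ^ n * l2norm M (\<lambda>x. 1))"
      by (intro summable_mult2 summable_geometric) simp
    then show ?thesis
      by (subst suminf_ennreal2) (auto simp: less_top)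
  qed
  finally have "AE x in M. suminf (\<lambda>n. ennreal (d n x)) \<noteq> \<infinity>"
    by (intro nn_integral_PInf_AE) (auto simp: d_def less_top)
  then have conv: "AE x in M. convergent (\<lambda>n. f (r n) x)"
  proof eventually_elim
    case (elim x)
    then have "summable (\<lambda>n. d n x)"
      by (intro summable_suminf_not_top) (auto simp: d_def)
    then have "summable (\<lambda>n. f (r (Suc n)) x - f (r n) x)"
      unfolding d_def by (rule summable_rabs_cancel)
    then have "convergent (\<lambda>n. \<Sum>i<n. f (r (Suc i)) x - f (r i) x)"
      by (simp add: summable_iff_convergent)
    then have "convergent (\<lambda>n. (\<Sum>i<n. f (r (Suc i)) x - f (r i) x) + f (r 0) x)"
      by (intro convergent_add convergent_const)
    also have "(\<lambda>n. (\<Sum>i<n. f (r (Suc i)) x - f (r i) x) + f (r 0) x) = (\<lambda>n. f (r n) x)"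
      using sum_lessThan_telescope[of "\<lambda>i. f (r i) x"] by (simp add: fun_eq_iff)
    finally show ?case .
  qed
  \<comment> \<open>Where the subsequence diverges \<open>lim\<close> is an unspecified value; this
    happens on a null set only and does not hurt measurability.\<close>
  define g where "g x = lim (\<lambda>n. f (r n) x)" for x
  have [measurable]: "g \<in> borel_measurable M"
    unfolding g_def by (intro borel_measurable_lim_metric) simp
  have lim: "AE x in M. (\<lambda>n. f (r n) x) \<longlonglongrightarrow> g x"
    using conv by eventually_elim (simp add: g_def convergent_LIMSEQ_iff)
  have key: "sqint M (\<lambda>x. f m x - g x) \<and> (\<integral>x. (f m x - g x)\<^sup>2 \<partial>M) \<le> ((1/2)^n)\<^sup>2"
    if "m \<ge> N n" for m n
  proof (rule sqint_Fatou[where f = "\<lambda>l x. f m x - f (r l) x"])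
    show "sqint M (\<lambda>x. f m x - f (r l) x)" for l by (intro sqint_diff f)
    show "AE x in M. (\<lambda>l. f m x - f (r l) x) \<longlonglongrightarrow> f m x - g x"
      using lim by eventually_elim (intro tendsto_intros)
    show "\<forall>\<^sub>F l in sequentially. (\<integral>x. (f m x - f (r l) x)\<^sup>2 \<partial>M) \<le> ((1/2)^n)\<^sup>2"
    proof (rule eventually_sequentiallyI)
      fix l assume "n \<le> l"
      have "l2norm M (\<lambda>x. f m x - f (r l) x) \<le> (1/2)^n"
        using N[OF that rN[OF \<open>n \<le> l\<close>]] by simp
      then have "(l2norm M (\<lambda>x. f m x - f (r l) x))\<^sup>2 \<le> ((1/2)^n)\<^sup>2"
        by (intro power_mono) auto
      then show "(\<integral>x. (f m x - f (r l) x)\<^sup>2 \<partial>M) \<le> ((1/2)^n)\<^sup>2" by (simp only: l2norm_power2)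
    qed
  qed measurable
  have g: "sqint M g"
    using sqint_diff[OF f[of "N 0"], of "\<lambda>x. f (N 0) x - g x"] key[of 0 "N 0"] by simp
  have "(\<lambda>n. l2norm M (\<lambda>x. f n x - g x)) \<longlonglongrightarrow> 0"
  proof (rule LIMSEQ_I)
    fix e :: real assume "e > 0"
    obtain n where n: "(1/2::real)^n < e"
      using real_arch_pow_inv[of e "1/2"] \<open>e > 0\<close> by auto
    have "norm (l2norm M (\<lambda>x. f m x - g x) - 0) < e" if "m \<ge> N n" for m
    proof -
      have "(l2norm M (\<lambda>x. f m x - g x))\<^sup>2 \<le> ((1/2)^n)\<^sup>2"
        using key[OF that] by (simp add: l2norm_power2)
      then have "l2norm M (\<lambda>x. f m x - g x) \<le> (1/2)^n" by (rule power2_le_imp_le) simp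
      then show ?thesis using n by simp
    qed
    then show "\<exists>no. \<forall>n\<ge>no. norm (l2norm M (\<lambda>x. f n x - g x) - 0) < e" by blast
  qed
  with g r lim show ?thesis by (rule that)
qed

lemma sqint_cong:
  assumes "sqint M f" "\<And>x. x \<in> space M \<Longrightarrow> g x = f x"
  shows "sqint M g"
  using assms unfolding sqint_def
  by (metis (mono_tags, lifting) Bochner_Integration.integrable_cong measurable_cong)

text \<open>Completeness yields some limit g' almost everywhere of a subsequence; g and g' are both
  L2 limits, hence agree almost everywhere.\<close>

lemma sqint_subseq_AE:
  assumes fin: "finite_measure M" and f: "\<And>n. sqint M (f n)" and g: "sqint M g"
    and lim: "(\<lambda>n. l2norm M (\<lambda>x. f n x - g x)) \<longlonglongrightarrow> 0"
  obtains r where "strict_mono (r :: nat \<Rightarrow> nat)" "AE x in M. (\<lambda>n. f (r n) x) \<longlonglongrightarrow> g x"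
proof -
  have "\<exists>N. \<forall>m\<ge>N. \<forall>n\<ge>N. l2norm M (\<lambda>x. f m x - f n x) < e" if "0 < e" for e
  proof -
    obtain N where N: "\<And>n. n \<ge> N \<Longrightarrow> l2norm M (\<lambda>x. f n x - g x) < e / 2"
      using LIMSEQ_D[OF lim, of "e / 2"] \<open>0 < e\<close> by auto
    have "l2norm M (\<lambda>x. f m x - f n x) < e" if "m \<ge> N" "n \<ge> N" for m n
      using l2norm_triangle_diff[OF f g f, of m n] N[of m] N[of n] that
      by (simp add: l2norm_minus_commute[of M g])
    then show ?thesis by blast
  qed
  with sqint_AE_subseq_limit[where f = f, OF fin f] obtain g' r where g': "sqint M g'"
    and r: "strict_mono r" "AE x in M. (\<lambda>n. f (r n) x) \<longlonglongrightarrow> g' x"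
    and lim': "(\<lambda>n. l2norm M (\<lambda>x. f n x - g' x)) \<longlonglongrightarrow> 0" by blast
  have "(\<lambda>n. l2norm M (\<lambda>x. f n x - g x) + l2norm M (\<lambda>x. f n x - g' x)) \<longlonglongrightarrow> 0"
    using tendsto_add[OF lim lim'] by simp
  then have "l2norm M (\<lambda>x. g x - g' x) \<le> 0"
    by (rule LIMSEQ_le_const)
      (use l2norm_triangle_diff[OF g f g'] l2norm_minus_commute[of M g] in auto)
  then have "(\<integral>x. (g x - g' x)\<^sup>2 \<partial>M) = 0"
    using l2norm_power2[of M "\<lambda>x. g x - g' x"] l2norm_nonneg[of M "\<lambda>x. g x - g' x"] by simp
  then have "AE x in M. (g x - g' x)\<^sup>2 = 0"
    using sqint_diff[OF g g'] by (subst (asm) integral_nonneg_eq_0_iff_AE) (auto simp: sqint_def)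
  with r(2) have "AE x in M. (\<lambda>n. f (r n) x) \<longlonglongrightarrow> g x"
    by eventually_elim auto
  with r(1) show ?thesis by (rule that)
qed

lemma sqint_imp_integrable:
  assumes "finite_measure M" "sqint M w"
  shows "integrable M w"
proof -
  interpret finite_measure M by fact
  have "sqint M (\<lambda>x. 1)" by (simp add: sqint_def)
  from sqint_integrable_mult[OF assms(2) this] show ?thesis by simp
qed

section \<open>A zero of an outward pointing field\<close>

text \<open>Vectors are functions on the naturals supported in \<open>{1..k}\<close>: the
  coefficient format of combinations of eigenfunctions, and up to a shift by one that of
  \<open>nsphere\<close>.\<close>

definition ball_upto :: "nat \<Rightarrow> real \<Rightarrow> (nat \<Rightarrow> real) set" where
  "ball_upto k r = {x. (\<forall>i. i \<notin> {1..k} \<longrightarrow> x i = 0) \<and> (\<Sum>i=1..k. (x i)\<^sup>2) \<le> r\<^sup>2}"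

text \<open>Otherwise \<open>H\<close>, normalised, would contract the sphere.\<close>

lemma outward_field_has_zero:
  fixes H :: "(nat \<Rightarrow> real) \<Rightarrow> nat \<Rightarrow> real"
  assumes k: "k \<ge> 1" and r: "r > 0"
    and cont: "\<And>i. i \<in> {1..k} \<Longrightarrow> continuous_on (ball_upto k r) (\<lambda>x. H x i)"
    and outward: "\<And>x. x \<in> ball_upto k r \<Longrightarrow> (\<Sum>i=1..k. (x i)\<^sup>2) = r\<^sup>2 \<Longrightarrow> 0 < (\<Sum>i=1..k. H x i * x i)"
  shows "\<exists>x\<in>ball_upto k r. \<forall>i\<in>{1..k}. H x i = 0"
proof (rule ccontr)
  assume "\<not> ?thesis"
  then have nz: "\<exists>i\<in>{1..k}. H x i \<noteq> 0" if "x \<in> ball_upto k r" for x using that by blast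
  obtain n where n: "k = Suc n" using k by (cases k) auto
  have sum_shift: "(\<Sum>i=1..k. f i) = (\<Sum>i\<le>n. f (Suc i))" for f :: "nat \<Rightarrow> real"
    unfolding n using sum.atLeast1_atMost_eq[of f "Suc n"] by (simp only: One_nat_def lessThan_Suc_atMost)
  \<comment> \<open>Places a point of the unit sphere, with coordinates 0 to n, at radius c in the
    coordinates 1 to k.\<close>
  define e :: "real \<Rightarrow> (nat \<Rightarrow> real) \<Rightarrow> nat \<Rightarrow> real"
    where "e c y i = (if i = 0 then 0 else c * y (i - 1))" for c y i
  let ?S = "topspace (nsphere n)"
  have S: "?S = {y. (\<Sum>i\<le>n. (y i)\<^sup>2) = 1 \<and> (\<forall>i>n. y i = 0)}"
    by (simp add: nsphere)
  have e_mem: "e c y \<in> ball_upto k r" and e_norm: "(\<Sum>i=1..k. (e c y i)\<^sup>2) = c\<^sup>2"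
    if "y \<in> ?S" "0 \<le> c" "c \<le> r" for c y
  proof -
    have "(\<Sum>i=1..k. (e c y i)\<^sup>2) = c\<^sup>2 * (\<Sum>i\<le>n. (y i)\<^sup>2)"
      unfolding sum_shift by (simp add: e_def power_mult_distrib sum_distrib_left)
    with that show *: "(\<Sum>i=1..k. (e c y i)\<^sup>2) = c\<^sup>2" by (simp add: S)
    have "e c y i = 0" if "i \<notin> {1..k}" for i
      using that \<open>y \<in> ?S\<close> n by (auto simp: e_def S)
    with * that show "e c y \<in> ball_upto k r"
      by (auto simp: ball_upto_def intro: power_mono)
  qed
  \<comment> \<open>A homotopy of nowhere vanishing fields: for t up to 1/2 the segment from the
    identity to H on the sphere of radius r, afterwards H on spheres shrinking to the centre, so
    that \<open>W (1, y)\<close> does not depend on y.\<close>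
  define W :: "real \<times> (nat \<Rightarrow> real) \<Rightarrow> nat \<Rightarrow> real"
    where "W p i = (if i \<le> n then
        (1 - min 1 (2 * fst p)) * snd p i + min 1 (2 * fst p) * H (e (r * min 1 (2 - 2 * fst p)) (snd p)) (Suc i) else 0)"
    for p i
  let ?nsq = "\<lambda>p. \<Sum>i\<le>n. (W p i)\<^sup>2"
  let ?X = "prod_topology (subtopology euclideanreal {0..1}) (nsphere n)"
  have Xeq: "?X = top_of_set ({0..1} \<times> ?S)"
  proof -
    have "nsphere n = top_of_set ?S"
      unfolding S nsphere by (simp add: euclidean_product_topology)
    moreover have "prod_topology (top_of_set {0..1}) (top_of_set ?S) = top_of_set ({0..1::real} \<times> ?S)"
      by (rule prod_topology_subtopology_eu)
    ultimately show ?thesis by argo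
  qed
  have contW: "continuous_on ({0..1} \<times> ?S) (\<lambda>p. W p i)" for i
  proof (cases "i \<le> n")
    case True
    have cy: "continuous_on A (\<lambda>p. (snd p :: nat \<Rightarrow> real) j)" for A :: "(real \<times> (nat \<Rightarrow> real)) set" and j
      by (rule continuous_on_compose2[of UNIV "\<lambda>y. y j"]) (auto intro: continuous_on_snd continuous_on_id)
    have ce: "continuous_on ({0..1} \<times> ?S) (\<lambda>p. e (r * min 1 (2 - 2 * fst p)) (snd p))"
    proof (rule continuous_on_coordinatewise_then_product)
      fix j
      show "continuous_on ({0..1} \<times> ?S) (\<lambda>p. e (r * min 1 (2 - 2 * fst p)) (snd p) j)"
        by (cases "j = 0") (auto simp: e_def intro!: continuous_intros cy)
    qed
    have "continuous_on ({0..1} \<times> ?S) (\<lambda>p. H (e (r * min 1 (2 - 2 * fst p)) (snd p)) (Suc i))"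
    proof (rule continuous_on_compose2[OF cont ce])
      show "Suc i \<in> {1..k}" using True n by simp
      show "(\<lambda>p. e (r * min 1 (2 - 2 * fst p)) (snd p)) ` ({0..1} \<times> ?S) \<subseteq> ball_upto k r"
        using r by (auto intro!: e_mem simp: min_def)
    qed
    with True show ?thesis
      unfolding W_def by (auto intro!: continuous_intros cy)
  next
    case False
    then show ?thesis by (simp add: W_def)
  qed
  have pos: "0 < ?nsq p" if p: "p \<in> {0..1} \<times> ?S" for p
  proof -
    obtain t y where ty: "p = (t, y)" "0 \<le> t" "t \<le> 1" "y \<in> ?S" using p by auto
    have "\<exists>i\<le>n. W p i \<noteq> 0"
    proof (cases "t < 1/2")
      case True
      have e: "e r y \<in> ball_upto k r" "(\<Sum>i=1..k. (e r y i)\<^sup>2) = r\<^sup>2"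
        using e_mem[of y r] e_norm[of y r] ty r by auto
      have W: "W p i = (1 - 2 * t) * y i + 2 * t * H (e r y) (Suc i)" if "i \<le> n" for i
        using that True ty by (simp add: W_def min_def)
      \<comment> \<open>On the segment no zero can occur, because the product with the outward
        radius stays positive.\<close>
      have "(\<Sum>i\<le>n. W p i * (r * y i)) = (\<Sum>i\<le>n. (1 - 2 * t) * r * (y i)\<^sup>2 + 2 * t * (H (e r y) (Suc i) * (r * y i)))"
        by (intro sum.cong) (auto simp: W algebra_simps power2_eq_square)
      also have "\<dots> = (1 - 2 * t) * r * (\<Sum>i\<le>n. (y i)\<^sup>2) + 2 * t * (\<Sum>i\<le>n. H (e r y) (Suc i) * (r * y i))"
        by (simp add: sum.distrib sum_distrib_left)
      also have "(\<Sum>i\<le>n. H (e r y) (Suc i) * (r * y i)) = (\<Sum>i=1..k. H (e r y) i * e r y i)"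
        unfolding sum_shift by (simp add: e_def)
      also have "(1 - 2 * t) * r * (\<Sum>i\<le>n. (y i)\<^sup>2) + 2 * t * (\<Sum>i=1..k. H (e r y) i * e r y i) > 0"
        using True ty r outward[OF e] by (intro add_pos_nonneg) (auto simp: S)
      finally show ?thesis by (metis (mono_tags, lifting) atMost_iff less_irrefl mult_zero_left sum.neutral)
    next
      case False
      then have "min 1 (2 * t) = 1" "min 1 (2 - 2 * t) = 2 - 2 * t" by auto
      then have W: "W p i = H (e (r * (2 - 2 * t)) y) (Suc i)" if "i \<le> n" for i
        using that ty by (simp add: W_def)
      have "e (r * (2 - 2 * t)) y \<in> ball_upto k r"
        using False ty r by (intro e_mem) auto
      from nz[OF this] obtain i where i: "i \<in> {1..k}" "H (e (r * (2 - 2 * t)) y) i \<noteq> 0" by blast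
      then have "i - 1 \<le> n" "Suc (i - 1) = i" using n by auto
      with i W[of "i - 1"] show ?thesis by (intro exI[of _ "i - 1"]) simp
    qed
    then obtain i where "i \<le> n" "W p i \<noteq> 0" by blast
    then show ?thesis by (intro sum_pos2[of _ i]) auto
  qed
  define h where "h p i = W p i / sqrt (?nsq p)" for p i
  have hS: "h p \<in> ?S" if "p \<in> {0..1} \<times> ?S" for p
  proof -
    have "(\<Sum>i\<le>n. (h p i)\<^sup>2) = ?nsq p / ?nsq p"
      using pos[OF that] by (simp add: h_def power_divide flip: sum_divide_distrib)
    moreover have "h p i = 0" if "i > n" for i using that by (simp add: h_def W_def)
    ultimately show ?thesis using pos[OF that] by (simp add: S)
  qed
  have conth: "continuous_map ?X (nsphere n) h"
  proof -
    have "continuous_on ({0..1} \<times> ?S) (\<lambda>p. h p i)" for i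
      unfolding h_def using pos by (intro continuous_intros contW) force
    then have "continuous_on ({0..1} \<times> ?S) h" by (rule continuous_on_coordinatewise_then_product)
    then have "continuous_map ?X euclidean h" by (simp add: Xeq)
    then show ?thesis
      unfolding nsphere euclidean_product_topology continuous_map_in_subtopology
      using hS by (auto simp: S Xeq image_subset_iff)
  qed
  have h0: "h (0, y) = y" if "y \<in> ?S" for y
    using that by (auto simp: h_def W_def S fun_eq_iff)
  have h1: "h (1, y) = h (1, y')" for y y'
  proof -
    have e: "e 0 y = e 0 y'" by (auto simp: e_def)
    have "W (1, y) i = W (1, y') i" for i by (simp add: W_def e)
    then show ?thesis by (simp add: h_def fun_eq_iff)
  qed
  have "homotopic_with (\<lambda>x. True) (nsphere n) (nsphere n) (\<lambda>y. h (0, y)) (\<lambda>y. h (1, y))"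
    unfolding homotopic_with_def using conth by blast
  then have "homotopic_with (\<lambda>x. True) (nsphere n) (nsphere n) id (\<lambda>y. h (1, undefined))"
    by (rule homotopic_with_eq) (use h0 h1 in auto)
  then have "contractible_space (nsphere n)"
    unfolding contractible_space_def by blast
  then show False using non_contractible_space_nsphere by blast
qed

text \<open>The product topology on coefficient sequences is metrizable, so sequences suffice, and
  their convergence is coordinatewise; this is the form in which L2 limits of linear combinations
  are available.\<close>

lemma continuous_on_coordinates:
  fixes G :: "(nat \<Rightarrow> real) \<Rightarrow> real"
  assumes "\<And>u c. (\<And>i. (\<lambda>n. u n i) \<longlonglongrightarrow> c i) \<Longrightarrow> (\<lambda>n. G (u n)) \<longlonglongrightarrow> G c"
  shows "continuous_on UNIV G"
proof (rule continuous_on_sequentiallyI)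
  fix u :: "nat \<Rightarrow> nat \<Rightarrow> real" and c
  assume u: "u \<longlonglongrightarrow> c"
  have "(\<lambda>n. u n i) \<longlonglongrightarrow> c i" for i
  proof -
    have "isCont (\<lambda>x :: nat \<Rightarrow> real. x i) c"
      by (rule continuous_on_interior[of UNIV]) auto
    then show ?thesis using u by (rule isCont_tendsto_compose)
  qed
  then show "(\<lambda>n. G (u n)) \<longlonglongrightarrow> G c" by (rule assms)
qed

section \<open>The energy space\<close>

lemma L2_on_iff_sqint:
  assumes "A \<in> sets lebesgue"
  shows "L2_on A f \<longleftrightarrow> sqint (lebesgue_on A) f"
  unfolding L2_on_def sqint_def set_borel_measurable_def set_integrable_def
  using assms by (simp add: borel_measurable_restrict_space_iff integrable_restrict_space)

lemma set_lebesgue_integral_eq_restrict: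
  fixes f :: "'a::euclidean_space \<Rightarrow> real"
  shows "A \<in> sets lebesgue \<Longrightarrow> (LINT x:A|lebesgue. f x) = (\<integral>x. f x \<partial>lebesgue_on A)"
  by (simp add: set_lebesgue_integral_def integral_restrict_space)

text \<open>If N is null, so are the cylinders over N in both factors. The passage through
  \<open>lborel\<close> is made because there the measure on pairs is literally the product
  measure.\<close>

lemma AE_lebesgue_fst_snd:
  fixes P :: "'a::euclidean_space \<Rightarrow> bool"
  assumes "AE x in lebesgue. P x"
  shows "AE p in (lebesgue :: ('a \<times> 'a) measure). P (fst p) \<and> P (snd p)"
proof -
  have "AE x in lborel. P x" using assms by (simp add: AE_completion_iff)
  then obtain N where N: "{x. \<not> P x} \<subseteq> N" "emeasure lborel N = 0" "N \<in> sets (lborel :: 'a measure)"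
    by (auto elim: AE_E)
  have "N \<times> UNIV \<in> null_sets (lborel \<Otimes>\<^sub>M (lborel :: 'a measure))"
    using N by (auto simp: null_sets_def lborel.emeasure_pair_measure_Times)
  moreover have "UNIV \<times> N \<in> null_sets ((lborel :: 'a measure) \<Otimes>\<^sub>M lborel)"
    using N by (auto simp: null_sets_def lborel.emeasure_pair_measure_Times)
  ultimately have "N \<times> UNIV \<union> UNIV \<times> N \<in> null_sets (lborel :: ('a \<times> 'a) measure)"
    by (simp add: lborel_prod null_sets.Un)
  then have "AE p in (lborel :: ('a \<times> 'a) measure). P (fst p) \<and> P (snd p)"
    by (rule AE_I') (use N in auto)
  then show ?thesis by (simp add: AE_completion_iff)
qed

lemma measure_lebesgue_Times:
  fixes A B :: "'a::euclidean_space set"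
  assumes "A \<in> sets borel" "B \<in> sets borel"
  shows "measure lebesgue (A \<times> B) = measure lebesgue A * measure lebesgue B"
proof -
  have "A \<times> B \<in> sets (borel :: ('a \<times> 'a) measure)"
    using assms by (simp add: borel_prod[symmetric])
  moreover have "emeasure (lborel :: ('a \<times> 'a) measure) (A \<times> B) = emeasure lborel A * emeasure lborel B"
    using assms by (simp add: lborel_prod[symmetric] lborel.emeasure_pair_measure_Times)
  ultimately show ?thesis
    using assms by (simp add: measure_def enn2real_mult)
qed

locale energy_space =
  fixes s :: real and K :: "real ^ 'n \<Rightarrow> real" and \<Omega> :: "(real ^ 'n) set"
  assumes s_pos: "0 < s" and \<Omega>_open: "open \<Omega>" and \<Omega>_bounded: "bounded \<Omega>" and \<Omega>_nonempty: "\<Omega> \<noteq> {}"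
    and K_adm: "admissible_kernel s K"
begin

abbreviation M where "M \<equiv> lebesgue_on \<Omega>"
abbreviation MQ where "MQ \<equiv> lebesgue_on (Q_set \<Omega>)"
abbreviation V where "V \<equiv> space_X0 K \<Omega>"
abbreviation E where "E \<equiv> X0_inner K \<Omega>"
abbreviation ip where "ip \<equiv> L2_inner \<Omega>"
abbreviation nrm where "nrm \<equiv> l2norm M"

text \<open>The square root turns the energy product E into an L2 inner product over Q, so that
  Cauchy-Schwarz and Fatou for \<open>sqint\<close> apply to it.\<close>

definition D :: "(real ^ 'n \<Rightarrow> real) \<Rightarrow> (real ^ 'n) \<times> (real ^ 'n) \<Rightarrow> real" where
  "D u = (\<lambda>(x, y). (u x - u y) * sqrt (K (x - y)))"

lemma \<Omega>_sets [measurable, simp]: "\<Omega> \<in> sets lebesgue"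
  using \<Omega>_open by (simp add: borel_open)

lemma Q_sets [measurable, simp]: "Q_set \<Omega> \<in> sets lebesgue"
proof -
  have "closed ((- \<Omega>) \<times> (- \<Omega>))" using \<Omega>_open by (intro closed_Times) auto
  then have "open (Q_set \<Omega>)" by (simp add: Q_set_def open_Diff)
  then show ?thesis by (simp add: borel_open)
qed

lemma emeasure_\<Omega>: "emeasure lebesgue \<Omega> < \<infinity>"
  using bounded_set_imp_lmeasurable[OF \<Omega>_bounded \<Omega>_sets] by (simp add: fmeasurable_def)

sublocale finite_measure M
  by (rule finite_measureI) (use emeasure_\<Omega> in \<open>simp add: emeasure_restrict_space\<close>)

lemma ip_eq: "ip f g = (\<integral>x. f x * g x \<partial>M)"
  by (simp add: L2_inner_def set_lebesgue_integral_eq_restrict)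

lemma L2_norm_eq: "L2_norm \<Omega> f = nrm f"
  by (simp add: L2_norm_def l2norm_def set_lebesgue_integral_eq_restrict)

text \<open>The kernel is known to be nonnegative off the diagonal only; on the diagonal both sides
  vanish because of the differences.\<close>

lemma D_mult: "D u p * D v p = (case p of (x, y) \<Rightarrow> (u x - u y) * (v x - v y) * K (x - y))"
proof (cases p)
  case (Pair x y)
  have "x = y \<or> 0 < K (x - y)"
    using K_adm by (cases "x = y") (auto simp: admissible_kernel_def)
  then show ?thesis
    by (auto simp: D_def Pair)
qed

lemma E_eq: "E u v = (\<integral>p. D u p * D v p \<partial>MQ)"
  by (simp add: X0_inner_def set_lebesgue_integral_eq_restrict D_mult)

lemma E_self_eq: "E u u = (\<integral>p. (D u p)\<^sup>2 \<partial>MQ)"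
  by (simp add: E_eq power2_eq_square)

lemma E_nonneg: "0 \<le> E u u"
  by (simp add: E_self_eq)

lemma X0_norm_eq: "X0_norm K \<Omega> u = l2norm MQ (D u)"
  unfolding X0_norm_def l2norm_def set_lebesgue_integral_eq_restrict[OF Q_sets]
  by (intro arg_cong[where f = sqrt] Bochner_Integration.integral_cong)
    (auto simp: D_mult power2_eq_square split: prod.splits simp flip: abs_mult)

lemma X0_norm_power2: "(X0_norm K \<Omega> u)\<^sup>2 = E u u"
  by (simp add: X0_norm_eq l2norm_power2 E_self_eq)

lemma V_iff:
  "u \<in> V \<longleftrightarrow> u \<in> borel_measurable lebesgue \<and> sqint M u \<and> sqint MQ (D u) \<and>
     (AE x in lebesgue. x \<notin> \<Omega> \<longrightarrow> u x = 0)"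
  by (simp add: space_X0_def space_X_def L2_on_iff_sqint D_def)

lemma V_sqint: "u \<in> V \<Longrightarrow> sqint M u" and V_sqint_D: "u \<in> V \<Longrightarrow> sqint MQ (D u)"
  by (simp_all add: V_iff)

lemma D_add: "D (\<lambda>x. u x + v x) = (\<lambda>p. D u p + D v p)"
  by (auto simp: D_def algebra_simps)

lemma D_cmult: "D (\<lambda>x. c * u x) = (\<lambda>p. c * D u p)"
  by (auto simp: D_def algebra_simps)

lemma D_zero: "D (\<lambda>x. 0) = (\<lambda>p. 0)"
  by (auto simp: D_def)

lemma V_zero: "(\<lambda>x. 0) \<in> V"
  by (simp add: V_iff D_zero)

lemma V_add: "u \<in> V \<Longrightarrow> v \<in> V \<Longrightarrow> (\<lambda>x. u x + v x) \<in> V"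
  by (auto simp: V_iff D_add sqint_add)

lemma V_cmult: "u \<in> V \<Longrightarrow> (\<lambda>x. c * u x) \<in> V"
  by (auto simp: V_iff D_cmult sqint_cmult)

lemma V_diff: "u \<in> V \<Longrightarrow> v \<in> V \<Longrightarrow> (\<lambda>x. u x - v x) \<in> V"
  using V_add[of u "\<lambda>x. -1 * v x"] V_cmult[of v "-1"] by simp

lemma V_sum: "(\<And>i. i \<in> I \<Longrightarrow> u i \<in> V) \<Longrightarrow> (\<lambda>x. \<Sum>i\<in>I. u i x) \<in> V"
  by (induction I rule: infinite_finite_induct) (auto intro: V_add V_zero)

lemma E_sym: "E u v = E v u"
  by (simp add: E_eq mult.commute)

lemma E_add_left: "u \<in> V \<Longrightarrow> v \<in> V \<Longrightarrow> w \<in> V \<Longrightarrow> E (\<lambda>x. u x + v x) w = E u w + E v w"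
  by (simp add: E_eq D_add distrib_right sqint_integrable_mult V_sqint_D)

lemma E_cmult_left: "E (\<lambda>x. c * u x) w = c * E u w"
  by (simp add: E_eq D_cmult mult.assoc)

lemma E_add_right: "u \<in> V \<Longrightarrow> v \<in> V \<Longrightarrow> w \<in> V \<Longrightarrow> E w (\<lambda>x. u x + v x) = E w u + E w v"
  by (simp add: E_sym[of w] E_add_left)

lemma E_cmult_right: "E w (\<lambda>x. c * u x) = c * E w u"
  by (simp add: E_sym[of w] E_cmult_left)

lemma E_diff_left: "u \<in> V \<Longrightarrow> v \<in> V \<Longrightarrow> w \<in> V \<Longrightarrow> E (\<lambda>x. u x - v x) w = E u w - E v w"
  using E_add_left[of u "\<lambda>x. -1 * v x" w] E_cmult_left[of "-1" v w] V_cmult[of v "-1"] by simp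

lemma E_diff_right: "u \<in> V \<Longrightarrow> v \<in> V \<Longrightarrow> w \<in> V \<Longrightarrow> E w (\<lambda>x. u x - v x) = E w u - E w v"
  by (simp add: E_sym[of w] E_diff_left)

lemma E_sum_right:
  "(\<And>i. i \<in> I \<Longrightarrow> u i \<in> V) \<Longrightarrow> w \<in> V \<Longrightarrow> E w (\<lambda>x. \<Sum>i\<in>I. c i * u i x) = (\<Sum>i\<in>I. c i * E w (u i))"
  by (induction I rule: infinite_finite_induct)
    (auto simp: E_add_right V_sum V_cmult E_cmult_right, simp_all add: E_eq D_zero)

lemma E_Cauchy_Schwarz: "u \<in> V \<Longrightarrow> v \<in> V \<Longrightarrow> \<bar>E u v\<bar> \<le> X0_norm K \<Omega> u * X0_norm K \<Omega> v"
  unfolding E_eq X0_norm_eq by (intro sqint_Cauchy_Schwarz V_sqint_D)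

lemma E_diff_le:
  assumes "u \<in> V" "v \<in> V"
  shows "E (\<lambda>x. u x - v x) (\<lambda>x. u x - v x) \<le> 2 * E u u + 2 * E v v"
proof -
  have "E (\<lambda>x. u x - v x) (\<lambda>x. u x - v x) = E u u + E v v - 2 * E u v"
    using assms by (simp add: E_diff_left E_diff_right V_diff E_sym[of v u])
  moreover have "0 \<le> E u u + E v v + 2 * E u v"
    using assms E_nonneg[of "\<lambda>x. u x + v x"] by (simp add: E_add_left E_add_right V_add E_sym[of v u])
  ultimately show ?thesis by simp
qed

lemma ip_sym: "ip f g = ip g f"
  by (simp add: ip_eq mult.commute)

lemma ip_add_left: "sqint M f \<Longrightarrow> sqint M g \<Longrightarrow> sqint M h \<Longrightarrow> ip (\<lambda>x. f x + g x) h = ip f h + ip g h"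
  by (simp add: ip_eq distrib_right sqint_integrable_mult)

lemma ip_diff_left: "sqint M f \<Longrightarrow> sqint M g \<Longrightarrow> sqint M h \<Longrightarrow> ip (\<lambda>x. f x - g x) h = ip f h - ip g h"
  by (simp add: ip_eq left_diff_distrib sqint_integrable_mult)

lemma ip_cmult_left: "ip (\<lambda>x. c * f x) h = c * ip f h"
  by (simp add: ip_eq mult.assoc)

lemma ip_add_right: "sqint M f \<Longrightarrow> sqint M g \<Longrightarrow> sqint M h \<Longrightarrow> ip h (\<lambda>x. f x + g x) = ip h f + ip h g"
  by (simp add: ip_sym[of h] ip_add_left)

lemma ip_diff_right: "sqint M f \<Longrightarrow> sqint M g \<Longrightarrow> sqint M h \<Longrightarrow> ip h (\<lambda>x. f x - g x) = ip h f - ip h g"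
  by (simp add: ip_sym[of h] ip_diff_left)

lemma ip_cmult_right: "ip h (\<lambda>x. c * f x) = c * ip h f"
  by (simp add: ip_sym[of h] ip_cmult_left)

lemma ip_sum_right:
  "(\<And>i. i \<in> I \<Longrightarrow> sqint M (f i)) \<Longrightarrow> sqint M h \<Longrightarrow> ip h (\<lambda>x. \<Sum>i\<in>I. c i * f i x) = (\<Sum>i\<in>I. c i * ip h (f i))"
  by (induction I rule: infinite_finite_induct)
    (auto simp: ip_add_right sqint_sum sqint_cmult ip_cmult_right, simp_all add: ip_eq)

lemma ip_self: "ip f f = (nrm f)\<^sup>2"
  unfolding ip_eq l2norm_power2 by (simp add: power2_eq_square)

lemma ip_Cauchy_Schwarz: "sqint M f \<Longrightarrow> sqint M g \<Longrightarrow> \<bar>ip f g\<bar> \<le> nrm f * nrm g"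
  unfolding ip_eq by (rule sqint_Cauchy_Schwarz)

section \<open>Closedness and lower semicontinuity of the energy\<close>

text \<open>The limit g is known on \<Omega> only and is extended by zero; as the \<open>w n\<close>
  vanish almost everywhere outside, they converge almost everywhere on the whole space, and then
  \<open>D (w n)\<close> converges almost everywhere on pairs. Fatou's lemma does the rest.\<close>

lemma sqint_D_limit:
  assumes w: "\<And>n. w n \<in> V" and lim: "AE x in M. (\<lambda>n. w n x) \<longlonglongrightarrow> g x"
    and le: "\<forall>\<^sub>F n in sequentially. E (w n) (w n) \<le> C"
  shows "sqint MQ (D (\<lambda>x. indicat_real \<Omega> x * g x)) \<and>
    (\<integral>p. (D (\<lambda>x. indicat_real \<Omega> x * g x) p)\<^sup>2 \<partial>MQ) \<le> C"
proof -
  let ?u = "\<lambda>x. indicat_real \<Omega> x * g x"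
  have "AE x in lebesgue. \<forall>n. x \<notin> \<Omega> \<longrightarrow> w n x = 0"
    unfolding AE_all_countable using w by (simp add: V_iff)
  moreover have "AE x in lebesgue. x \<in> \<Omega> \<longrightarrow> (\<lambda>n. w n x) \<longlonglongrightarrow> g x"
    using lim by (simp add: AE_restrict_space_iff)
  ultimately have "AE x in lebesgue. (\<lambda>n. w n x) \<longlonglongrightarrow> ?u x"
    by eventually_elim (auto split: split_indicator)
  from AE_lebesgue_fst_snd[OF this]
  have lim_leb: "AE p in lebesgue. (\<lambda>n. D (w n) p) \<longlonglongrightarrow> D ?u p"
    by eventually_elim (auto simp: D_def split: prod.splits intro!: tendsto_intros)
  \<comment> \<open>Measurability of \<open>D\<close> of the limit is taken from G, which agrees
    with it almost everywhere on Q; this avoids the measurability of \<open>K (x - y)\<close> as a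
    function of pairs.\<close>
  define G where "G p = lim (\<lambda>n. D (w n) p)" for p
  have [measurable]: "D (w n) \<in> borel_measurable MQ" for n using V_sqint_D[OF w] by (simp add: sqint_def)
  have "G \<in> borel_measurable MQ"
    unfolding G_def by (intro borel_measurable_lim_metric) simp
  then have "(\<lambda>p. indicat_real (Q_set \<Omega>) p *\<^sub>R G p) \<in> borel_measurable lebesgue"
    by (simp add: borel_measurable_restrict_space_iff)
  moreover have "AE p in lebesgue. indicat_real (Q_set \<Omega>) p *\<^sub>R G p = indicat_real (Q_set \<Omega>) p *\<^sub>R D ?u p"
    using lim_leb by eventually_elim (auto simp: G_def limI)
  ultimately have "(\<lambda>p. indicat_real (Q_set \<Omega>) p *\<^sub>R D ?u p) \<in> borel_measurable lebesgue"
    by (rule borel_measurable_AE)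
  then have meas: "D ?u \<in> borel_measurable MQ"
    by (simp add: borel_measurable_restrict_space_iff)
  have lim_Q: "AE p in MQ. (\<lambda>n. D (w n) p) \<longlonglongrightarrow> D ?u p"
    using lim_leb by (auto simp: AE_restrict_space_iff elim: eventually_mono)
  show ?thesis
    by (rule sqint_Fatou[OF V_sqint_D[OF w] meas lim_Q]) (use le in \<open>simp add: E_self_eq\<close>)
qed

lemma V_limit:
  assumes w: "\<And>n. w n \<in> V" and lim: "AE x in M. (\<lambda>n. w n x) \<longlonglongrightarrow> g x" and g: "sqint M g"
    and le: "\<exists>C. \<forall>\<^sub>F n in sequentially. E (w n) (w n) \<le> C"
  shows "(\<lambda>x. indicat_real \<Omega> x * g x) \<in> V"
proof -
  let ?u = "\<lambda>x. indicat_real \<Omega> x * g x"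
  have "?u \<in> borel_measurable lebesgue"
    using g by (simp add: sqint_def borel_measurable_restrict_space_iff)
  moreover have "sqint M ?u"
    by (rule sqint_cong[OF g]) simp
  ultimately show ?thesis
    using le sqint_D_limit[OF w lim] by (auto simp: V_iff)
qed

text \<open>A ball of radius r interacts with a neighbouring ball of the same size at distance of
  order r: by the lower bound on K the energy of its indicator is at least a constant times
  \<open>r powr (- 2 * s)\<close> times its volume. Small r beats any \<Lambda>. The second
  alternative covers indicators of infinite energy, whose Bochner integral would be 0.\<close>

lemma indicator_energy_unbounded:
  obtains p r where "0 < r" "ball p r \<subseteq> \<Omega>"
    "\<Lambda> * measure lebesgue (ball p r) < (\<integral>z. (D (indicat_real (ball p r)) z)\<^sup>2 \<partial>MQ)
     \<or> \<not> sqint MQ (D (indicat_real (ball p r)))"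
proof -
  let ?n = "real CARD('n)"
  obtain p R where R: "R > 0" "ball p R \<subseteq> \<Omega>"
    using \<Omega>_nonempty \<Omega>_open by (metis all_not_in_conv openE)
  obtain c where c: "c > 0" "\<And>x. x \<noteq> 0 \<Longrightarrow> K x \<ge> c * norm x powr (- (?n + 2 * s))"
    using K_adm by (auto simp: admissible_kernel_def)
  define \<omega> where "\<omega> = measure lebesgue (ball (0 :: real ^ 'n) 1)"
  have \<omega>: "\<omega> > 0" unfolding \<omega>_def using content_ball_pos[of 1 "0 :: real ^ 'n"] by simp
  \<comment> \<open>The constant in that lower bound; 4 enters since points of the two balls are at
    most \<open>4 * r\<close> apart.\<close>
  define a where "a = c * 4 powr (- (?n + 2 * s)) * \<omega>"
  have a: "a > 0" using c \<omega> by (simp add: a_def)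
  \<comment> \<open>The target value of \<open>r powr (- 2 * s)\<close>: the first entry forces
    \<open>r \<le> R\<close>, the second makes \<open>t * a\<close> exceed \<Lambda>.\<close>
  define t where "t = max (R powr (- 2 * s)) ((\<bar>\<Lambda>\<bar> + 1) / a)"
  have t: "t > 0" "t \<ge> R powr (- 2 * s)" "t * a > \<Lambda>"
  proof -
    show "t > 0" using R by (auto simp: t_def less_max_iff_disj)
    have "\<Lambda> < (\<bar>\<Lambda>\<bar> + 1) / a * a" using a by simp
    also have "\<dots> \<le> t * a" using a by (intro mult_right_mono) (auto simp: t_def)
    finally show "t * a > \<Lambda>" .
  qed (simp add: t_def)
  define r where "r = t powr (- 1 / (2 * s))"
  have r: "r > 0" "r powr (- 2 * s) = t"
    using t s_pos by (auto simp: r_def powr_powr)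
  have "r \<le> (R powr (- 2 * s)) powr (- 1 / (2 * s))"
    unfolding r_def using t R s_pos by (intro powr_mono2') auto
  also have "\<dots> = R" using R s_pos by (simp add: powr_powr)
  finally have "r \<le> R" .
  then have sub: "ball p r \<subseteq> \<Omega>" using R by auto
  have content: "measure lebesgue (ball x r) = r ^ CARD('n) * \<omega>" for x :: "real ^ 'n"
    using content_ball_conv_unit_ball[of r x] r by (simp add: \<omega>_def)
  obtain e :: "real ^ 'n" where e: "norm e = 1"
    by (metis norm_axis_1)
  \<comment> \<open>Centre of a ball disjoint from \<open>ball p r\<close>. That ball may leave
    \<Omega>; the pairs still lie in Q, whose points need only one component in \<Omega>.\<close>
  define q where "q = p + (2 * r) *\<^sub>R e"
  have pq: "dist p q = 2 * r" using r by (simp add: q_def dist_norm e)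
  define A where "A = ball p r \<times> ball q r"
  have A_sets: "A \<in> sets lebesgue"
  proof -
    have "open A" unfolding A_def by (intro open_Times) auto
    then show ?thesis by (simp add: borel_open)
  qed
  have A_Q: "A \<subseteq> Q_set \<Omega>"
    using sub by (auto simp: A_def Q_set_def)
  define b where "b = c * (4 * r) powr (- (?n + 2 * s))"
  have b: "b > 0" using c r by (simp add: b_def)
  have lower: "b \<le> (D (indicat_real (ball p r)) z)\<^sup>2" if "z \<in> A" for z
  proof -
    obtain x y where xy_def: "z = (x, y)" by (cases z)
    with that have z: "z = (x, y)" "dist p x < r" "dist q y < r" by (auto simp: A_def)
    have y: "y \<notin> ball p r"
      using dist_triangle[of p q y] z pq by (auto simp: dist_commute)
    then have xy: "x \<noteq> y" using z by auto
    have "dist x y \<le> 4 * r"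
      using dist_triangle[of x y p] dist_triangle[of p y q] dist_commute[of x p] z pq by linarith
    then have "norm (x - y) \<le> 4 * r" by (simp add: dist_norm)
    then have "c * (4 * r) powr (- (?n + 2 * s)) \<le> c * norm (x - y) powr (- (?n + 2 * s))"
      using c xy s_pos by (intro mult_left_mono powr_mono2') auto
    also have "\<dots> \<le> K (x - y)" using c xy by simp
    finally have "b \<le> K (x - y)" by (simp add: b_def)
    moreover have "(D (indicat_real (ball p r)) z)\<^sup>2 = K (x - y)"
      using calculation b y z by (simp add: D_def)
    ultimately show ?thesis by simp
  qed
  have "\<Lambda> * measure lebesgue (ball p r) < (\<integral>z. (D (indicat_real (ball p r)) z)\<^sup>2 \<partial>MQ)"
    if sq: "sqint MQ (D (indicat_real (ball p r)))"
  proof -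
    have "\<Lambda> * measure lebesgue (ball p r) < t * a * (r ^ CARD('n) * \<omega>)"
      using t r \<omega> by (simp add: content mult_strict_right_mono)
    also have "\<dots> = b * measure lebesgue A"
    proof -
      have "measure lebesgue A = (r ^ CARD('n) * \<omega>) * (r ^ CARD('n) * \<omega>)"
        unfolding A_def by (subst measure_lebesgue_Times) (auto simp: content)
      moreover have "b * r ^ CARD('n) = c * 4 powr (- (?n + 2 * s)) * t"
      proof -
        have "r powr (- (?n + 2 * s)) * r powr ?n = t"
          using r by (simp flip: powr_add)
        then show ?thesis using r by (simp add: b_def powr_mult powr_realpow)
      qed
      ultimately show ?thesis by (simp add: a_def algebra_simps)
    qed
    also have "\<dots> \<le> (\<integral>z. (D (indicat_real (ball p r)) z)\<^sup>2 \<partial>MQ)"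
    proof -
      have fin: "emeasure lebesgue A < \<infinity>"
        using bounded_set_imp_lmeasurable[of A] A_sets by (auto simp: A_def bounded_Times fmeasurable_def)
      have meas: "measure MQ A = measure lebesgue A"
        using A_Q A_sets by (intro measure_restrict_space) auto
      have AQ: "A \<in> sets MQ" using A_Q A_sets by (simp add: sets_restrict_space_iff)
      have "emeasure MQ A < \<infinity>" using fin A_Q by (simp add: emeasure_restrict_space)
      with AQ have int: "integrable MQ (indicat_real A)" by (rule integrable_real_indicator)
      have "b * measure lebesgue A = (\<integral>z. b * indicat_real A z \<partial>MQ)"
        using AQ A_Q by (simp add: meas Int_absorb2)
      also have "\<dots> \<le> (\<integral>z. (D (indicat_real (ball p r)) z)\<^sup>2 \<partial>MQ)"
        using int sq lower by (intro integral_mono) (auto simp: sqint_def split: split_indicator)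
      finally show ?thesis .
    qed
    finally show ?thesis .
  qed
  then show ?thesis using that[OF r(1) sub] by blast
qed

end

section \<open>Eigenfunction expansions and compactness\<close>

locale eigen_space = energy_space s K \<Omega>
  for s :: real and K :: "real ^ 'n \<Rightarrow> real" and \<Omega> :: "(real ^ 'n) set" +
  fixes ev :: "nat \<Rightarrow> real" and \<phi> :: "nat \<Rightarrow> real ^ 'n \<Rightarrow> real"
  assumes eigensys: "eigensystem K \<Omega> ev \<phi>"
begin

lemma ev_mono: "1 \<le> i \<Longrightarrow> i \<le> j \<Longrightarrow> ev i \<le> ev j"
  using eigensys by (simp add: eigensystem_def)

lemma ev1_pos: "0 < ev 1"
  using eigensys by (simp add: eigensystem_def)

lemma ev_pos: "1 \<le> i \<Longrightarrow> 0 < ev i"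
  using ev_mono[of 1 i] ev1_pos by simp

lemma \<phi>_V: "1 \<le> i \<Longrightarrow> \<phi> i \<in> V"
  using eigensys by (simp add: eigensystem_def weak_solution_def)

lemma \<phi>_sqint: "1 \<le> i \<Longrightarrow> sqint M (\<phi> i)"
  by (intro V_sqint \<phi>_V)

lemma E_\<phi>_left: "1 \<le> i \<Longrightarrow> v \<in> V \<Longrightarrow> E (\<phi> i) v = ev i * ip (\<phi> i) v"
  using eigensys by (simp add: eigensystem_def weak_solution_def set_lebesgue_integral_eq_restrict ip_eq mult.assoc)

lemma E_\<phi>: "1 \<le> i \<Longrightarrow> v \<in> V \<Longrightarrow> E v (\<phi> i) = ev i * ip v (\<phi> i)"
  using E_\<phi>_left[of i v] by (simp add: E_sym ip_sym)

lemma ip_\<phi>: "1 \<le> i \<Longrightarrow> 1 \<le> j \<Longrightarrow> ip (\<phi> i) (\<phi> j) = (if i = j then 1 else 0)"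
  using eigensys by (simp add: eigensystem_def)

lemma nrm_\<phi>: "1 \<le> i \<Longrightarrow> nrm (\<phi> i) = 1"
  using ip_self[of "\<phi> i"] ip_\<phi>[of i i] power2_eq_1_iff[of "nrm (\<phi> i)"] l2norm_nonneg[of M "\<phi> i"] by auto

definition lc :: "nat \<Rightarrow> (nat \<Rightarrow> real) \<Rightarrow> real ^ 'n \<Rightarrow> real" where
  "lc N c = (\<lambda>x. \<Sum>j=1..N. c j * \<phi> j x)"

lemma lc_V: "lc N c \<in> V"
  unfolding lc_def by (intro V_sum V_cmult \<phi>_V) auto

lemma lc_sqint: "sqint M (lc N c)"
  by (intro V_sqint lc_V)

lemma ip_lc: "sqint M w \<Longrightarrow> ip w (lc N c) = (\<Sum>j=1..N. c j * ip w (\<phi> j))"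
  unfolding lc_def by (rule ip_sum_right) (auto intro: \<phi>_sqint)

lemma E_lc: "w \<in> V \<Longrightarrow> E w (lc N c) = (\<Sum>j=1..N. ev j * c j * ip w (\<phi> j))"
proof -
  assume w: "w \<in> V"
  have "E w (lc N c) = (\<Sum>j=1..N. c j * E w (\<phi> j))"
    unfolding lc_def by (rule E_sum_right) (auto intro: \<phi>_V w)
  also have "\<dots> = (\<Sum>j=1..N. ev j * c j * ip w (\<phi> j))"
    by (rule sum.cong) (auto simp: E_\<phi> w)
  finally show ?thesis .
qed

lemma ip_lc_\<phi>: "1 \<le> i \<Longrightarrow> ip (lc N c) (\<phi> i) = (if i \<le> N then c i else 0)"
proof -
  assume i: "1 \<le> i"
  have "ip (lc N c) (\<phi> i) = (\<Sum>j=1..N. c j * ip (\<phi> i) (\<phi> j))"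
    using ip_lc[OF \<phi>_sqint[OF i]] by (simp add: ip_sym)
  also have "\<dots> = (\<Sum>j=1..N. if j = i then c j else 0)"
    by (rule sum.cong) (use i in \<open>auto simp: ip_\<phi>\<close>)
  also have "\<dots> = (if i \<le> N then c i else 0)"
    using i by (simp add: sum.delta)
  finally show ?thesis .
qed

lemma nrm_lc: "(nrm (lc N c))\<^sup>2 = (\<Sum>j=1..N. (c j)\<^sup>2)"
  unfolding ip_self[symmetric] by (subst ip_lc[OF lc_sqint], intro sum.cong) (auto simp: ip_lc_\<phi> power2_eq_square)

lemma E_lc_lc: "E (lc N c) (lc N c) = (\<Sum>j=1..N. ev j * (c j)\<^sup>2)"
  by (subst E_lc[OF lc_V], intro sum.cong) (auto simp: ip_lc_\<phi> power2_eq_square)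

lemma lc_add: "lc N (\<lambda>i. c i + d i) = (\<lambda>x. lc N c x + lc N d x)"
  by (simp add: lc_def sum.distrib distrib_right)

lemma lc_diff: "lc N (\<lambda>i. c i - d i) = (\<lambda>x. lc N c x - lc N d x)"
  by (simp add: lc_def sum_subtractf left_diff_distrib)

lemma lc_cmult: "lc N (\<lambda>i. a * c i) = (\<lambda>x. a * lc N c x)"
  by (simp add: lc_def sum_distrib_left mult.assoc)

abbreviation proj :: "nat \<Rightarrow> (real ^ 'n \<Rightarrow> real) \<Rightarrow> real ^ 'n \<Rightarrow> real" where
  "proj N w \<equiv> lc N (\<lambda>j. ip w (\<phi> j))"

lemma nrm_diff_lc:
  assumes "sqint M w"
  shows "(nrm (\<lambda>x. w x - lc N c x))\<^sup>2 = (nrm w)\<^sup>2 - 2 * (\<Sum>j=1..N. c j * ip w (\<phi> j)) + (\<Sum>j=1..N. (c j)\<^sup>2)"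
proof -
  have "(nrm (\<lambda>x. w x - lc N c x))\<^sup>2 = ip w w - 2 * ip w (lc N c) + ip (lc N c) (lc N c)"
    unfolding ip_self[symmetric]
    by (simp add: assms lc_sqint sqint_diff ip_diff_left ip_diff_right ip_sym[of "lc N c" w])
  then show ?thesis using assms by (simp add: ip_self nrm_lc ip_lc)
qed

lemma nrm_diff_proj:
  "sqint M w \<Longrightarrow> (nrm (\<lambda>x. w x - proj N w x))\<^sup>2 = (nrm w)\<^sup>2 - (\<Sum>j=1..N. (ip w (\<phi> j))\<^sup>2)"
  using nrm_diff_lc[of w N "\<lambda>j. ip w (\<phi> j)"] by (simp add: power2_eq_square)

lemma Bessel: "sqint M w \<Longrightarrow> (\<Sum>j=1..N. (ip w (\<phi> j))\<^sup>2) \<le> (nrm w)\<^sup>2"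
  using nrm_diff_proj[of w N] zero_le_power2[of "nrm (\<lambda>x. w x - proj N w x)"] by linarith

text \<open>The Fourier coefficients give the best approximation among combinations of the first N
  eigenfunctions, so density of the span in L2 forces the remainder to zero.\<close>

lemma Parseval:
  assumes w: "sqint M w"
  shows "(\<lambda>N. \<Sum>j=1..N. (ip w (\<phi> j))\<^sup>2) \<longlonglongrightarrow> (nrm w)\<^sup>2"
proof (rule LIMSEQ_I)
  fix e :: real assume e: "e > 0"
  obtain N c where N: "nrm (\<lambda>x. w x - lc N c x) < sqrt e"
  proof -
    have "\<forall>w. L2_on \<Omega> w \<longrightarrow>
        (\<forall>\<epsilon>>0. \<exists>N c. L2_norm \<Omega> (\<lambda>x. w x - (\<Sum>j=1..N. c j * \<phi> j x)) < \<epsilon>)"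
      using eigensys unfolding eigensystem_def by (elim conjE) assumption
    moreover have "L2_on \<Omega> w" using w by (simp add: L2_on_iff_sqint)
    moreover have "sqrt e > 0" using e by simp
    ultimately have "\<exists>N c. nrm (\<lambda>x. w x - lc N c x) < sqrt e"
      unfolding L2_norm_eq lc_def by blast
    then show ?thesis using that by blast
  qed
  have "(nrm (\<lambda>x. w x - lc N c x))\<^sup>2 < (sqrt e)\<^sup>2"
    using N by (intro power_strict_mono) auto
  then have "(nrm (\<lambda>x. w x - lc N c x))\<^sup>2 < e" using e by simp
  moreover have "(nrm w)\<^sup>2 - (\<Sum>j=1..N. (ip w (\<phi> j))\<^sup>2) \<le> (nrm (\<lambda>x. w x - lc N c x))\<^sup>2"
  proof -
    have "0 \<le> (\<Sum>j=1..N. (c j - ip w (\<phi> j))\<^sup>2)" by (intro sum_nonneg) auto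
    also have "\<dots> = (\<Sum>j=1..N. (c j)\<^sup>2) + (\<Sum>j=1..N. (ip w (\<phi> j))\<^sup>2) - 2 * (\<Sum>j=1..N. c j * ip w (\<phi> j))"
      by (simp add: power2_diff sum.distrib sum_subtractf sum_distrib_left mult.assoc)
    finally show ?thesis by (simp add: nrm_diff_lc[OF w])
  qed
  moreover have "(\<Sum>j=1..N. (ip w (\<phi> j))\<^sup>2) \<le> (\<Sum>j=1..n. (ip w (\<phi> j))\<^sup>2)" if "n \<ge> N" for n
    using that by (intro sum_mono2) auto
  ultimately have "norm ((\<Sum>j=1..n. (ip w (\<phi> j))\<^sup>2) - (nrm w)\<^sup>2) < e" if "n \<ge> N" for n
    using Bessel[OF w, of n] that by (fastforce simp: abs_if)
  then show "\<exists>N. \<forall>n\<ge>N. norm ((\<Sum>j=1..n. (ip w (\<phi> j))\<^sup>2) - (nrm w)\<^sup>2) < e" by blast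
qed

lemma proj_tendsto:
  assumes w: "sqint M w"
  shows "(\<lambda>N. nrm (\<lambda>x. proj N w x - w x)) \<longlonglongrightarrow> 0"
proof -
  have "(\<lambda>N. sqrt ((nrm w)\<^sup>2 - (\<Sum>j=1..N. (ip w (\<phi> j))\<^sup>2))) \<longlonglongrightarrow> sqrt ((nrm w)\<^sup>2 - (nrm w)\<^sup>2)"
    by (intro tendsto_intros Parseval w)
  moreover have "sqrt ((nrm w)\<^sup>2 - (\<Sum>j=1..N. (ip w (\<phi> j))\<^sup>2)) = nrm (\<lambda>x. proj N w x - w x)" for N
    using arg_cong[OF nrm_diff_proj[OF w, of N], of sqrt] by (simp add: l2norm_minus_commute[of M _ w])
  ultimately show ?thesis by simp
qed

text \<open>Expand the nonnegative energy of \<open>w - proj N w\<close>; the eigenvalue equation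
  converts the mixed terms into L2 coefficients.\<close>

lemma Bessel_E:
  assumes w: "w \<in> V"
  shows "(\<Sum>j=1..N. ev j * (ip w (\<phi> j))\<^sup>2) \<le> E w w"
proof -
  have "0 \<le> E (\<lambda>x. w x - proj N w x) (\<lambda>x. w x - proj N w x)" by (rule E_nonneg)
  also have "\<dots> = E w w - 2 * E w (proj N w) + E (proj N w) (proj N w)"
    by (simp add: w lc_V V_diff E_diff_left E_diff_right E_sym[of "lc _ _" w])
  also have "E w (proj N w) = (\<Sum>j=1..N. ev j * (ip w (\<phi> j))\<^sup>2)"
    by (simp add: E_lc[OF w] power2_eq_square mult.assoc)
  finally show ?thesis by (simp add: E_lc_lc)
qed

text \<open>Beyond N every coefficient carries a weight \<open>ev j\<close> of at least
  \<open>ev (Suc N)\<close> in \<open>Bessel_E\<close>. For \<open>N = 0\<close> this is the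
  Poincare inequality, for large N the source of compactness.\<close>

lemma tail_bound:
  assumes w: "w \<in> V"
  shows "ev (Suc N) * ((nrm w)\<^sup>2 - (\<Sum>j=1..N. (ip w (\<phi> j))\<^sup>2)) \<le> E w w"
proof (rule LIMSEQ_le_const2)
  show "(\<lambda>n. ev (Suc N) * ((\<Sum>j=1..n. (ip w (\<phi> j))\<^sup>2) - (\<Sum>j=1..N. (ip w (\<phi> j))\<^sup>2)))
    \<longlonglongrightarrow> ev (Suc N) * ((nrm w)\<^sup>2 - (\<Sum>j=1..N. (ip w (\<phi> j))\<^sup>2))"
    by (intro tendsto_intros Parseval V_sqint w)
  have "ev (Suc N) * ((\<Sum>j=1..n. (ip w (\<phi> j))\<^sup>2) - (\<Sum>j=1..N. (ip w (\<phi> j))\<^sup>2)) \<le> E w w" if "n \<ge> N" for n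
  proof -
    have split: "sum f {1..n} = sum f {1..N} + sum f {Suc N..n}" for f :: "nat \<Rightarrow> real"
      using sum.ub_add_nat[of 1 N f "n - N"] that by simp
    have "ev (Suc N) * (\<Sum>j=Suc N..n. (ip w (\<phi> j))\<^sup>2) \<le> (\<Sum>j=Suc N..n. ev j * (ip w (\<phi> j))\<^sup>2)"
      unfolding sum_distrib_left by (intro sum_mono mult_right_mono ev_mono) auto
    also have "\<dots> \<le> (\<Sum>j=1..n. ev j * (ip w (\<phi> j))\<^sup>2)"
      by (intro sum_mono2) (auto intro!: mult_nonneg_nonneg less_imp_le[OF ev_pos])
    also have "\<dots> \<le> E w w" by (rule Bessel_E[OF w])
    finally show ?thesis unfolding split by simp
  qed
  then show "\<exists>k. \<forall>n\<ge>k. ev (Suc N) * ((\<Sum>j=1..n. (ip w (\<phi> j))\<^sup>2) - (\<Sum>j=1..N. (ip w (\<phi> j))\<^sup>2)) \<le> E w w"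
    by blast
qed

lemma Poincare: "w \<in> V \<Longrightarrow> ev 1 * (nrm w)\<^sup>2 \<le> E w w"
  using tail_bound[of w 0] by simp

lemma Poincare_norm: "w \<in> V \<Longrightarrow> nrm w \<le> X0_norm K \<Omega> w / sqrt (ev 1)"
proof -
  assume w: "w \<in> V"
  have "(nrm w)\<^sup>2 \<le> (X0_norm K \<Omega> w / sqrt (ev 1))\<^sup>2"
    using Poincare[OF w] ev1_pos by (simp add: power_divide X0_norm_power2 field_simps)
  then show ?thesis by (rule power2_le_imp_le) (use ev1_pos in \<open>simp add: X0_norm_eq\<close>)
qed

section \<open>Compactness of the energy space in L2\<close>

text \<open>If \<Lambda> bounded all eigenvalues, the projections of any square integrable w would
  have energy at most \<Lambda> times its squared norm, and by semicontinuity so would w, extended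
  by zero. Indicators of small balls contradict this.\<close>

lemma ev_unbounded: "\<exists>j\<ge>1. \<Lambda> < ev j"
proof (rule ccontr)
  assume "\<not> ?thesis"
  then have le: "ev j \<le> \<Lambda>" if "j \<ge> 1" for j using that by force
  obtain p r where r: "0 < r" and sub: "ball p r \<subseteq> \<Omega>" and contra:
    "\<Lambda> * measure lebesgue (ball p r) < (\<integral>z. (D (indicat_real (ball p r)) z)\<^sup>2 \<partial>MQ)
     \<or> \<not> sqint MQ (D (indicat_real (ball p r)))"
    by (rule indicator_energy_unbounded)
  define w where "w = indicat_real (ball p r)"
  have ball: "ball p r \<in> sets M" using sub by (simp add: sets_restrict_space_iff borel_open)
  moreover have "(\<lambda>x. (w x)\<^sup>2) = w" by (auto simp: w_def indicator_def)
  moreover have "emeasure M (ball p r) < \<infinity>"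
    by (metis emeasure_finite infinity_ennreal_def less_top)
  with ball have "integrable M w" unfolding w_def by (rule integrable_real_indicator)
  ultimately have w: "sqint M w"
    by (simp add: sqint_def borel_measurable_integrable)
  have nrm_w: "(nrm w)\<^sup>2 = measure lebesgue (ball p r)"
  proof -
    have "(nrm w)\<^sup>2 = (\<integral>x. indicat_real (ball p r) x \<partial>M)"
      unfolding l2norm_power2 by (rule Bochner_Integration.integral_cong) (auto simp: w_def indicator_def)
    also have "\<dots> = measure lebesgue (ball p r)"
      using ball sub by (simp add: measure_restrict_space Int_absorb2)
    finally show ?thesis .
  qed
  obtain q where q: "strict_mono q" "AE x in M. (\<lambda>n. proj (q n) w x) \<longlonglongrightarrow> w x"
    using sqint_subseq_AE[where f = "\<lambda>N. proj N w", OF finite_measure_axioms lc_sqint w proj_tendsto[OF w]] by blast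
  have "E (proj N w) (proj N w) \<le> \<Lambda> * (nrm w)\<^sup>2" for N
  proof -
    have "E (proj N w) (proj N w) \<le> (\<Sum>j=1..N. \<Lambda> * (ip w (\<phi> j))\<^sup>2)"
      unfolding E_lc_lc by (intro sum_mono mult_right_mono le) auto
    also have "\<dots> = \<Lambda> * (\<Sum>j=1..N. (ip w (\<phi> j))\<^sup>2)" by (simp add: sum_distrib_left)
    also have "\<dots> \<le> \<Lambda> * (nrm w)\<^sup>2"
      using le[of 1] ev1_pos by (intro mult_left_mono Bessel w) auto
    finally show ?thesis .
  qed
  then have "\<forall>\<^sub>F n in sequentially. E (proj (q n) w) (proj (q n) w) \<le> \<Lambda> * (nrm w)\<^sup>2" by simp
  from sqint_D_limit[OF lc_V q(2) this]
  have "sqint MQ (D (\<lambda>x. indicat_real \<Omega> x * w x)) \<and>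
    (\<integral>p. (D (\<lambda>x. indicat_real \<Omega> x * w x) p)\<^sup>2 \<partial>MQ) \<le> \<Lambda> * (nrm w)\<^sup>2" .
  moreover have "(\<lambda>x. indicat_real \<Omega> x * w x) = w"
    using sub by (auto simp: w_def fun_eq_iff indicator_def)
  ultimately show False using contra unfolding w_def[symmetric] nrm_w[symmetric] by simp
qed

text \<open>A diagonal subsequence makes every eigenfunction coefficient converge; a large
  eigenvalue makes the tails uniformly small, so the subsequence is Cauchy in L2. The last clause
  plays the part of weak lower semicontinuity, for any bound that holds eventually.\<close>

lemma bounded_energy_subseq:
  assumes w: "\<And>n. w n \<in> V" and le: "\<And>n. E (w n) (w n) \<le> C"
  obtains r u where "strict_mono (r :: nat \<Rightarrow> nat)" "u \<in> V" "(\<lambda>n. nrm (\<lambda>x. w (r n) x - u x)) \<longlonglongrightarrow> 0"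
    "\<forall>C'. (\<forall>\<^sub>F n in sequentially. E (w (r n)) (w (r n)) \<le> C') \<longrightarrow> E u u \<le> C'"
proof -
  have C: "C \<ge> 0" using E_nonneg[of "w 0"] le[of 0] by simp
  have bd: "norm (ip (w n) (\<phi> j)) \<le> sqrt (C / ev 1)" if "j \<in> {1..}" for n j
  proof -
    have "\<bar>ip (w n) (\<phi> j)\<bar> \<le> nrm (w n)"
      using ip_Cauchy_Schwarz[OF V_sqint[OF w] \<phi>_sqint, of j n] that by (simp add: nrm_\<phi>)
    also have "(nrm (w n))\<^sup>2 \<le> C / ev 1"
      using Poincare[OF w, of n] le[of n] ev1_pos by (simp add: field_simps)
    then have "nrm (w n) \<le> sqrt (C / ev 1)" by (rule real_le_rsqrt)
    finally show ?thesis by simp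
  qed
  obtain q where q: "strict_mono q" and conv: "\<And>j. j \<in> {1..} \<Longrightarrow> \<exists>l. (\<lambda>n. ip (w (q n)) (\<phi> j)) \<longlonglongrightarrow> l"
    by (rule function_convergent_subsequence[of "{1..}" "\<lambda>n j. ip (w n) (\<phi> j)" "sqrt (C / ev 1)"])
      (use bd in auto)
  have Cauchy: "\<exists>N. \<forall>m\<ge>N. \<forall>n\<ge>N. nrm (\<lambda>x. w (q m) x - w (q n) x) < e" if e: "e > 0" for e
  proof -
    \<comment> \<open>A difference of two members has energy at most \<open>4 * C\<close>, so its
      squared tail beyond L will be at most \<open>e\<^sup>2 / 2\<close>; the head contributes
      \<open>e\<^sup>2 / 4\<close>. The shift to \<open>L = j - 1\<close> fits
      \<open>tail_bound\<close>.\<close>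
    obtain j where j: "j \<ge> 1" "8 * C / e\<^sup>2 + 1 < ev j" using ev_unbounded by blast
    define L where "L = j - 1"
    have L: "8 * C / e\<^sup>2 + 1 < ev (Suc L)" using j by (simp add: L_def)
    have "Cauchy (\<lambda>n. ip (w (q n)) (\<phi> i))" if "i \<in> {1..L}" for i
      using conv[of i] that by (auto intro: LIMSEQ_imp_Cauchy)
    then have "\<exists>N. \<forall>m\<ge>N. \<forall>n\<ge>N. norm (ip (w (q m)) (\<phi> i) - ip (w (q n)) (\<phi> i)) < e / (2 * real (Suc L))"
      if "i \<in> {1..L}" for i
      using that e by (intro CauchyD) auto
    then obtain N where N: "\<And>i m n. i \<in> {1..L} \<Longrightarrow> m \<ge> N i \<Longrightarrow> n \<ge> N i \<Longrightarrow>
        norm (ip (w (q m)) (\<phi> i) - ip (w (q n)) (\<phi> i)) < e / (2 * real (Suc L))"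
      by metis
    define N' where "N' = (\<Sum>i=1..L. N i)"
    have N': "N' \<ge> N i" if "i \<in> {1..L}" for i
      using member_le_sum[of i "{1..L}" N] that by (simp add: N'_def)
    have "nrm (\<lambda>x. w (q m) x - w (q n) x) < e" if mn: "m \<ge> N'" "n \<ge> N'" for m n
    proof -
      define z where "z = (\<lambda>x. w (q m) x - w (q n) x)"
      have z: "z \<in> V" by (simp add: z_def V_diff w)
      have Ez: "E z z \<le> 4 * C" using E_diff_le[OF w w, of "q m" "q n"] le[of "q m"] le[of "q n"] by (simp add: z_def)
      have "(ip z (\<phi> i))\<^sup>2 \<le> (e / (2 * real (Suc L)))\<^sup>2" if i: "i \<in> {1..L}" for i
      proof -
        have "\<bar>ip z (\<phi> i)\<bar> \<le> e / (2 * real (Suc L))"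
          using N[OF i, of m n] N'[OF i] mn i by (simp add: z_def ip_diff_left V_sqint w \<phi>_sqint)
        then show ?thesis using e by (simp add: abs_le_square_iff[symmetric])
      qed
      then have "(\<Sum>i=1..L. (ip z (\<phi> i))\<^sup>2) \<le> real L * (e / (2 * real (Suc L)))\<^sup>2"
        using sum_bounded_above[of "{1..L}" "\<lambda>i. (ip z (\<phi> i))\<^sup>2" "(e / (2 * real (Suc L)))\<^sup>2"] by simp
      also have "\<dots> \<le> real (Suc L) ^ 2 * (e / (2 * real (Suc L)))\<^sup>2"
        by (intro mult_right_mono) (auto simp: power2_eq_square algebra_simps)
      also have "\<dots> = (real (Suc L) * (e / (2 * real (Suc L))))\<^sup>2" by (simp only: power_mult_distrib)
      also have "\<dots> = e\<^sup>2 / 4"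
      proof -
        have eq: "real (Suc L) * (e / (2 * real (Suc L))) = e / 2" by (simp add: field_simps del: of_nat_Suc)
        show ?thesis unfolding eq by (simp add: power_divide)
      qed
      finally have head: "(\<Sum>i=1..L. (ip z (\<phi> i))\<^sup>2) \<le> e\<^sup>2 / 4" .
      have "ev (Suc L) * ((nrm z)\<^sup>2 - (\<Sum>i=1..L. (ip z (\<phi> i))\<^sup>2)) \<le> 4 * C"
        using tail_bound[OF z, of L] Ez by linarith
      also have "4 * C \<le> ev (Suc L) * (e\<^sup>2 / 2)"
      proof -
        have "8 * C / e\<^sup>2 \<le> ev (Suc L)" using L by simp
        then show ?thesis using e by (simp add: field_simps)
      qed
      finally have "(nrm z)\<^sup>2 - (\<Sum>i=1..L. (ip z (\<phi> i))\<^sup>2) \<le> e\<^sup>2 / 2"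
        using ev_pos[of "Suc L"] by simp
      with head have "(nrm z)\<^sup>2 < e\<^sup>2" using e zero_less_power2[of e] by linarith
      then have "nrm z < e" by (rule power2_less_imp_less) (use e in simp)
      then show ?thesis by (simp add: z_def)
    qed
    then show ?thesis by blast
  qed
  obtain g p where g: "sqint M g" and p: "strict_mono p"
    and AE: "AE x in M. (\<lambda>n. w (q (p n)) x) \<longlonglongrightarrow> g x"
    and lim: "(\<lambda>n. nrm (\<lambda>x. w (q n) x - g x)) \<longlonglongrightarrow> 0"
    using sqint_AE_subseq_limit[where f = "\<lambda>n. w (q n)", OF finite_measure_axioms V_sqint[OF w] Cauchy] by blast
  define u where "u = (\<lambda>x. indicat_real \<Omega> x * g x)"
  define r where "r n = q (p n)" for n
  show ?thesis
  proof (rule that[of r u])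
    show "strict_mono r" using strict_mono_o[OF q p] by (simp add: r_def comp_def strict_mono_def)
    show "u \<in> V"
      unfolding u_def by (rule V_limit[OF w AE g]) (use le in \<open>auto intro!: exI[of _ C] always_eventually\<close>)
    have "nrm (\<lambda>x. w (r n) x - u x) = nrm (\<lambda>x. w (r n) x - g x)" for n
      unfolding l2norm_def by (intro arg_cong[where f = sqrt] Bochner_Integration.integral_cong) (auto simp: u_def)
    then show "(\<lambda>n. nrm (\<lambda>x. w (r n) x - u x)) \<longlonglongrightarrow> 0"
      using LIMSEQ_subseq_LIMSEQ[OF lim p] by (simp add: r_def comp_def)
    show "\<forall>C'. (\<forall>\<^sub>F n in sequentially. E (w (r n)) (w (r n)) \<le> C') \<longrightarrow> E u u \<le> C'"
      using sqint_D_limit[OF w AE] by (simp add: u_def E_self_eq r_def)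
  qed
qed

end

section \<open>Bounded nonlinearities\<close>

locale bounded_nonlinearity =
  fixes f F :: "real \<Rightarrow> real" and B :: real
  assumes f_cont: "continuous_on UNIV f" and f_bound: "\<And>t. \<bar>f t\<bar> \<le> B"
    and F_deriv: "\<And>t. (F has_real_derivative f t) (at t)" and F_0: "F 0 = 0"
begin

lemma B_nonneg: "0 \<le> B"
  using f_bound[of 0] by linarith

lemma f_measurable [measurable]: "f \<in> borel_measurable borel"
  using f_cont by (rule borel_measurable_continuous_onI)

lemma F_measurable [measurable]: "F \<in> borel_measurable borel"
  by (rule borel_measurable_continuous_onI) (blast intro: continuous_at_imp_continuous_on DERIV_isCont F_deriv)

text \<open>The mean value theorem, phrased so that all signs of b are covered. The point \<theta>
  is only used pointwise through its distance to a, so no measurable choice of it is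
  required.\<close>

lemma F_increment: "\<exists>\<theta>. \<bar>\<theta> - a\<bar> \<le> \<bar>b\<bar> \<and> F (a + b) - F a = f \<theta> * b"
proof (cases "b = 0")
  case False
  then consider "b > 0" | "b < 0" by linarith
  then show ?thesis
  proof cases
    case 1
    then obtain z where "a < z" "z < a + b" "F (a + b) - F a = (a + b - a) * f z"
      using MVT2[of a "a + b" F f] F_deriv by auto
    then show ?thesis by (intro exI[of _ z]) auto
  next
    case 2
    then obtain z where "a + b < z" "z < a" "F a - F (a + b) = (a - (a + b)) * f z"
      using MVT2[of "a + b" a F f] F_deriv by auto
    then show ?thesis by (intro exI[of _ z]) (auto simp: algebra_simps)
  qed
qed auto

lemma F_abs_le: "\<bar>F t\<bar> \<le> B * \<bar>t\<bar>"
proof -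
  obtain \<theta> where "F t = f \<theta> * t" using F_increment[of 0 t] by (auto simp: F_0)
  then show ?thesis by (simp add: abs_mult mult_right_mono f_bound)
qed

text \<open>Uniform continuity of f is available on bounded intervals only. A large a or a large
  increment is paid for by terms linear in \<open>\<bar>a\<bar>\<close> and
  \<open>\<bar>b - a\<bar>\<close>: then one of the two quotients is at least 1, and
  \<open>2 * B\<close> bounds the difference anyway. Linear terms can be integrated by
  Cauchy-Schwarz.\<close>

lemma f_oscillation:
  assumes "0 < e" "0 < T"
  obtains \<delta> where "\<delta> > 0" "\<And>a b. \<bar>f b - f a\<bar> \<le> e + 2 * B * (\<bar>a\<bar> / T + \<bar>b - a\<bar> / \<delta>)"
proof -
  \<comment> \<open>The margin 1 leaves room for b, as \<delta> will be at most 1.\<close>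
  have "uniformly_continuous_on {-(T+1)..T+1} f"
    by (intro compact_uniformly_continuous continuous_on_subset[OF f_cont]) auto
  then obtain d where d: "d > 0"
    "\<And>x y. x \<in> {-(T+1)..T+1} \<Longrightarrow> y \<in> {-(T+1)..T+1} \<Longrightarrow> dist y x < d \<Longrightarrow> dist (f y) (f x) < e"
    using \<open>0 < e\<close> unfolding uniformly_continuous_on_def by metis
  define \<delta> where "\<delta> = min 1 d"
  have \<delta>: "\<delta> > 0" using d by (simp add: \<delta>_def)
  have "\<bar>f b - f a\<bar> \<le> e + 2 * B * (\<bar>a\<bar> / T + \<bar>b - a\<bar> / \<delta>)" for a b
  proof (cases "\<bar>a\<bar> \<le> T \<and> \<bar>b - a\<bar> < \<delta>")
    case True
    then have "dist (f b) (f a) < e" by (intro d) (auto simp: \<delta>_def dist_real_def)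
    moreover have "0 \<le> 2 * B * (\<bar>a\<bar> / T + \<bar>b - a\<bar> / \<delta>)"
      using \<delta> \<open>0 < T\<close> B_nonneg by simp
    ultimately show ?thesis by (simp add: dist_real_def)
  next
    case False
    then have "1 \<le> \<bar>a\<bar> / T \<or> 1 \<le> \<bar>b - a\<bar> / \<delta>" using \<delta> \<open>0 < T\<close> by (auto simp: field_simps)
    moreover have "0 \<le> \<bar>a\<bar> / T" "0 \<le> \<bar>b - a\<bar> / \<delta>" using \<delta> \<open>0 < T\<close> by auto
    ultimately have "1 \<le> \<bar>a\<bar> / T + \<bar>b - a\<bar> / \<delta>" by linarith
    then have "2 * B * 1 \<le> 2 * B * (\<bar>a\<bar> / T + \<bar>b - a\<bar> / \<delta>)"
      using B_nonneg by (intro mult_left_mono) auto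
    moreover have "\<bar>f b - f a\<bar> \<le> 2 * B" using f_bound[of a] f_bound[of b] by linarith
    ultimately show ?thesis using \<open>0 < e\<close> by linarith
  qed
  with \<delta> show ?thesis by (rule that)
qed

text \<open>Uniform continuity, on bounded sets of L2, of composition with f, tested against \<psi>.
  P and \<theta> are left open so that one estimate serves both the Taylor remainder of F (where
  \<psi> and z are the increment) and differences of f against a fixed function.\<close>

lemma oscillation_integral_bound:
  assumes fin: "finite_measure M" and R: "0 \<le> R" and e: "0 < e"
  obtains \<delta> where "\<delta> > 0"
    "\<And>w z \<psi> P. \<lbrakk>sqint M w; sqint M z; sqint M \<psi>; P \<in> borel_measurable M; l2norm M w \<le> R; l2norm M z \<le> \<delta>;
        \<And>x. \<exists>\<theta>. \<bar>\<theta> - w x\<bar> \<le> \<bar>z x\<bar> \<and> \<bar>P x\<bar> \<le> \<bar>f \<theta> - f (w x)\<bar> * \<bar>\<psi> x\<bar>\<rbrakk>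
       \<Longrightarrow> \<bar>\<integral>x. P x \<partial>M\<bar> \<le> e * l2norm M \<psi>"
proof -
  interpret finite_measure M by (rule fin)
  define c where "c = l2norm M (\<lambda>x. 1)"
  have c: "0 \<le> c" by (simp add: c_def)
  \<comment> \<open>The three terms of \<open>f_oscillation\<close> get a third of e each: e' for
    the constant term, T for the one in w, and \<delta> below for the one in z. The added ones keep
    denominators positive.\<close>
  define e' T where "e' = e / (3 * (c + 1))" and "T = 6 * B * R / e + 1"
  have e': "e' > 0" "e' * c \<le> e / 3" using e c by (auto simp: e'_def field_simps)
  have T: "T > 0" "2 * B / T * R \<le> e / 3"
  proof -
    show "T > 0" using B_nonneg R e by (simp add: T_def add_nonneg_pos)
    moreover have "e * T = 6 * B * R + e" using e by (simp add: T_def field_simps)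
    ultimately show "2 * B / T * R \<le> e / 3" using e by (simp add: field_simps)
  qed
  obtain d where d: "d > 0" "\<And>a b. \<bar>f b - f a\<bar> \<le> e' + 2 * B * (\<bar>a\<bar> / T + \<bar>b - a\<bar> / d)"
    using f_oscillation[OF e'(1) T(1)] by blast
  define \<delta> where "\<delta> = e * d / (6 * B + 1)"
  have \<delta>: "\<delta> > 0" "2 * B / d * \<delta> \<le> e / 3"
    using B_nonneg d e by (auto simp: \<delta>_def field_simps)
  show ?thesis
  proof (rule that[OF \<delta>(1)])
    fix w z \<psi> P :: "'a \<Rightarrow> real"
    assume w: "sqint M w" and z: "sqint M z" and \<psi>: "sqint M \<psi>" and P [measurable]: "P \<in> borel_measurable M"
      and wR: "l2norm M w \<le> R" and z\<delta>: "l2norm M z \<le> \<delta>"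
      and *: "\<And>x. \<exists>\<theta>. \<bar>\<theta> - w x\<bar> \<le> \<bar>z x\<bar> \<and> \<bar>P x\<bar> \<le> \<bar>f \<theta> - f (w x)\<bar> * \<bar>\<psi> x\<bar>"
    have one: "sqint M (\<lambda>x. 1)" by (simp add: sqint_def)
    have abs: "sqint M (\<lambda>x. \<bar>u x\<bar>)" "l2norm M (\<lambda>x. \<bar>u x\<bar>) = l2norm M u" if "sqint M u" for u :: "'a \<Rightarrow> real"
      using that by (auto simp: sqint_def l2norm_def)
    define H where "H x = e' * (1 * \<bar>\<psi> x\<bar>) + 2 * B / T * (\<bar>w x\<bar> * \<bar>\<psi> x\<bar>) + 2 * B / d * (\<bar>z x\<bar> * \<bar>\<psi> x\<bar>)" for x
    have PH: "\<bar>P x\<bar> \<le> H x" for x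
    proof -
      obtain \<theta> where \<theta>: "\<bar>\<theta> - w x\<bar> \<le> \<bar>z x\<bar>" "\<bar>P x\<bar> \<le> \<bar>f \<theta> - f (w x)\<bar> * \<bar>\<psi> x\<bar>" using * by blast
      have "\<bar>\<theta> - w x\<bar> / d \<le> \<bar>z x\<bar> / d" using \<theta> d by (simp add: divide_right_mono)
      then have "2 * B * (\<bar>w x\<bar> / T + \<bar>\<theta> - w x\<bar> / d) \<le> 2 * B * (\<bar>w x\<bar> / T + \<bar>z x\<bar> / d)"
        using B_nonneg by (intro mult_left_mono add_left_mono) auto
      with d(2)[of \<theta> "w x"] have "\<bar>f \<theta> - f (w x)\<bar> \<le> e' + 2 * B * (\<bar>w x\<bar> / T + \<bar>z x\<bar> / d)" by linarith
      then have "\<bar>f \<theta> - f (w x)\<bar> * \<bar>\<psi> x\<bar> \<le> (e' + 2 * B * (\<bar>w x\<bar> / T + \<bar>z x\<bar> / d)) * \<bar>\<psi> x\<bar>"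
        by (rule mult_right_mono) simp
      also have "\<dots> = H x" by (simp add: H_def algebra_simps)
      finally show ?thesis using \<theta> by linarith
    qed
    note ints = sqint_integrable_mult[OF one abs(1)[OF \<psi>]] sqint_integrable_mult[OF abs(1)[OF w] abs(1)[OF \<psi>]]
      sqint_integrable_mult[OF abs(1)[OF z] abs(1)[OF \<psi>]]
    have Hint: "integrable M H" unfolding H_def using ints by simp
    have Pint: "integrable M P"
      by (rule Bochner_Integration.integrable_bound[OF Hint P]) (use order_trans[OF PH abs_ge_self] in simp)
    have "\<bar>\<integral>x. P x \<partial>M\<bar> \<le> (\<integral>x. \<bar>P x\<bar> \<partial>M)" by (rule integral_abs_bound)
    also have "\<dots> \<le> (\<integral>x. H x \<partial>M)" using Pint Hint PH by (intro integral_mono) auto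
    also have "\<dots> = e' * (\<integral>x. 1 * \<bar>\<psi> x\<bar> \<partial>M) + 2 * B / T * (\<integral>x. \<bar>w x\<bar> * \<bar>\<psi> x\<bar> \<partial>M) + 2 * B / d * (\<integral>x. \<bar>z x\<bar> * \<bar>\<psi> x\<bar> \<partial>M)"
      unfolding H_def using ints by simp
    also have "\<dots> \<le> e' * (c * l2norm M \<psi>) + 2 * B / T * (R * l2norm M \<psi>) + 2 * B / d * (\<delta> * l2norm M \<psi>)"
    proof (intro add_mono mult_left_mono)
      show "(\<integral>x. 1 * \<bar>\<psi> x\<bar> \<partial>M) \<le> c * l2norm M \<psi>"
        using sqint_Cauchy_Schwarz[OF one abs(1)[OF \<psi>]] by (simp add: abs(2)[OF \<psi>] c_def)
      have "(\<integral>x. \<bar>w x\<bar> * \<bar>\<psi> x\<bar> \<partial>M) \<le> l2norm M w * l2norm M \<psi>"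
        using abs_le_D1[OF sqint_Cauchy_Schwarz[OF abs(1)[OF w] abs(1)[OF \<psi>]]] by (simp only: abs(2)[OF w] abs(2)[OF \<psi>])
      also have "\<dots> \<le> R * l2norm M \<psi>" using wR by (intro mult_right_mono) auto
      finally show "(\<integral>x. \<bar>w x\<bar> * \<bar>\<psi> x\<bar> \<partial>M) \<le> R * l2norm M \<psi>" .
      have "(\<integral>x. \<bar>z x\<bar> * \<bar>\<psi> x\<bar> \<partial>M) \<le> l2norm M z * l2norm M \<psi>"
        using abs_le_D1[OF sqint_Cauchy_Schwarz[OF abs(1)[OF z] abs(1)[OF \<psi>]]] by (simp only: abs(2)[OF z] abs(2)[OF \<psi>])
      also have "\<dots> \<le> \<delta> * l2norm M \<psi>" using z\<delta> by (intro mult_right_mono) auto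
      finally show "(\<integral>x. \<bar>z x\<bar> * \<bar>\<psi> x\<bar> \<partial>M) \<le> \<delta> * l2norm M \<psi>" .
    qed (use e' T d B_nonneg in auto)
    also have "\<dots> = (e' * c + 2 * B / T * R + 2 * B / d * \<delta>) * l2norm M \<psi>" by (simp add: algebra_simps)
    also have "\<dots> \<le> e * l2norm M \<psi>" using e' T \<delta> by (intro mult_right_mono) auto
    finally show "\<bar>\<integral>x. P x \<partial>M\<bar> \<le> e * l2norm M \<psi>" .
  qed
qed

lemma sqint_f:
  assumes "finite_measure M" "sqint M w"
  shows "sqint M (\<lambda>x. f (w x))"
proof -
  interpret finite_measure M by fact
  have [measurable]: "w \<in> borel_measurable M" using assms by (simp add: sqint_def)
  show ?thesis
    by (rule sqint_bound[of M "\<lambda>x. B"]) (use f_bound B_nonneg in \<open>auto simp: sqint_def\<close>)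
qed

lemma sqint_F:
  assumes "sqint M w"
  shows "sqint M (\<lambda>x. F (w x))"
proof -
  have [measurable]: "w \<in> borel_measurable M" using assms by (simp add: sqint_def)
  show ?thesis
    by (rule sqint_bound[OF sqint_cmult[OF assms, of B]]) (use F_abs_le B_nonneg in \<open>auto simp: abs_mult\<close>)
qed

lemma F_remainder_measurable:
  assumes "sqint M w" "sqint M \<xi>"
  shows "(\<lambda>x. F (w x + \<xi> x) - F (w x) - f (w x) * \<xi> x) \<in> borel_measurable M"
proof -
  have [measurable]: "w \<in> borel_measurable M" "\<xi> \<in> borel_measurable M" using assms by (simp_all add: sqint_def)
  show ?thesis by measurable
qed

lemma F_remainder_pointwise:
  "\<exists>\<theta>. \<bar>\<theta> - a\<bar> \<le> \<bar>b\<bar> \<and> \<bar>F (a + b) - F a - f a * b\<bar> \<le> \<bar>f \<theta> - f a\<bar> * \<bar>b\<bar>"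
proof -
  obtain \<theta> where \<theta>: "\<bar>\<theta> - a\<bar> \<le> \<bar>b\<bar>" "F (a + b) - F a = f \<theta> * b" using F_increment by blast
  then have "F (a + b) - F a - f a * b = (f \<theta> - f a) * b" by (simp add: algebra_simps)
  with \<theta>(1) show ?thesis by (intro exI[of _ \<theta>]) (simp add: abs_mult)
qed

lemma F_remainder_small:
  assumes fin: "finite_measure M" and R: "0 \<le> R" and e: "0 < e"
  obtains \<delta> where "\<delta> > 0"
    "\<And>w \<xi>. \<lbrakk>sqint M w; sqint M \<xi>; l2norm M w \<le> R; l2norm M \<xi> \<le> \<delta>\<rbrakk>
       \<Longrightarrow> \<bar>\<integral>x. F (w x + \<xi> x) - F (w x) - f (w x) * \<xi> x \<partial>M\<bar> \<le> e * l2norm M \<xi>"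
proof -
  from oscillation_integral_bound[OF fin R e] obtain \<delta> where \<delta>: "\<delta> > 0"
    "\<And>w z \<psi> P. \<lbrakk>sqint M w; sqint M z; sqint M \<psi>; P \<in> borel_measurable M; l2norm M w \<le> R; l2norm M z \<le> \<delta>;
        \<And>x. \<exists>\<theta>. \<bar>\<theta> - w x\<bar> \<le> \<bar>z x\<bar> \<and> \<bar>P x\<bar> \<le> \<bar>f \<theta> - f (w x)\<bar> * \<bar>\<psi> x\<bar>\<rbrakk>
       \<Longrightarrow> \<bar>\<integral>x. P x \<partial>M\<bar> \<le> e * l2norm M \<psi>" by metis
  show ?thesis
    by (rule that[OF \<delta>(1)], rule \<delta>(2)) (auto intro: F_remainder_measurable F_remainder_pointwise)
qed

text \<open>Crude counterpart of \<open>F_remainder_small\<close>, uniform in w and of any size in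
  \<xi>; it serves where the gradient is large.\<close>

lemma F_remainder_le:
  assumes fin: "finite_measure M" and w: "sqint M w" and \<xi>: "sqint M \<xi>"
  shows "\<bar>\<integral>x. F (w x + \<xi> x) - F (w x) - f (w x) * \<xi> x \<partial>M\<bar> \<le> 2 * B * l2norm M (\<lambda>x. 1) * l2norm M \<xi>"
proof -
  interpret finite_measure M by (rule fin)
  have one: "sqint M (\<lambda>x. 1)" by (simp add: sqint_def)
  have abs: "sqint M (\<lambda>x. \<bar>\<xi> x\<bar>)" "l2norm M (\<lambda>x. \<bar>\<xi> x\<bar>) = l2norm M \<xi>"
    using \<xi> by (auto simp: sqint_def l2norm_def)
  let ?P = "\<lambda>x. F (w x + \<xi> x) - F (w x) - f (w x) * \<xi> x"
  have int: "integrable M (\<lambda>x. 2 * B * (1 * \<bar>\<xi> x\<bar>))"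
    using sqint_integrable_mult[OF one abs(1)] by simp
  have le: "\<bar>?P x\<bar> \<le> 2 * B * (1 * \<bar>\<xi> x\<bar>)" for x
  proof -
    obtain \<theta> where "\<bar>?P x\<bar> \<le> \<bar>f \<theta> - f (w x)\<bar> * \<bar>\<xi> x\<bar>" using F_remainder_pointwise by blast
    also have "\<bar>f \<theta> - f (w x)\<bar> \<le> 2 * B" using f_bound[of \<theta>] f_bound[of "w x"] by linarith
    finally show ?thesis by (simp add: mult_right_mono)
  qed
  have Pint: "integrable M ?P"
    by (rule Bochner_Integration.integrable_bound[OF int F_remainder_measurable[OF w \<xi>]])
      (use le B_nonneg in \<open>auto simp: abs_mult\<close>)
  have "\<bar>\<integral>x. ?P x \<partial>M\<bar> \<le> (\<integral>x. \<bar>?P x\<bar> \<partial>M)" by (rule integral_abs_bound)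
  also have "\<dots> \<le> (\<integral>x. 2 * B * (1 * \<bar>\<xi> x\<bar>) \<partial>M)" using Pint int le by (intro integral_mono) auto
  also have "\<dots> = 2 * B * (\<integral>x. 1 * \<bar>\<xi> x\<bar> \<partial>M)" by simp
  also have "\<dots> \<le> 2 * B * (l2norm M (\<lambda>x. 1) * l2norm M \<xi>)"
    using sqint_Cauchy_Schwarz[OF one abs(1)] B_nonneg by (intro mult_left_mono) (auto simp: abs(2))
  finally show ?thesis by (simp add: mult.assoc)
qed

lemma f_integral_continuous:
  assumes fin: "finite_measure M" and w: "\<And>n. sqint M (w n)" and u: "sqint M u" and \<psi>: "sqint M \<psi>"
    and lim: "(\<lambda>n. l2norm M (\<lambda>x. w n x - u x)) \<longlonglongrightarrow> 0"
  shows "(\<lambda>n. \<integral>x. f (w n x) * \<psi> x \<partial>M) \<longlonglongrightarrow> (\<integral>x. f (u x) * \<psi> x \<partial>M)"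
proof (rule LIMSEQ_I)
  fix e :: real assume e: "e > 0"
  define e' where "e' = e / (l2norm M \<psi> + 1)"
  have e': "e' > 0" "e' * l2norm M \<psi> < e"
  proof -
    have "0 < l2norm M \<psi> + 1" using l2norm_nonneg[of M \<psi>] by linarith
    then show "e' > 0" "e' * l2norm M \<psi> < e" using e by (simp_all add: e'_def field_simps)
  qed
  from oscillation_integral_bound[OF fin l2norm_nonneg e'(1)] obtain \<delta> where \<delta>: "\<delta> > 0"
    "\<And>v z \<psi> P. \<lbrakk>sqint M v; sqint M z; sqint M \<psi>; P \<in> borel_measurable M; l2norm M v \<le> l2norm M u; l2norm M z \<le> \<delta>;
        \<And>x. \<exists>\<theta>. \<bar>\<theta> - v x\<bar> \<le> \<bar>z x\<bar> \<and> \<bar>P x\<bar> \<le> \<bar>f \<theta> - f (v x)\<bar> * \<bar>\<psi> x\<bar>\<rbrakk>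
       \<Longrightarrow> \<bar>\<integral>x. P x \<partial>M\<bar> \<le> e' * l2norm M \<psi>" by metis
  obtain N where N: "\<And>n. n \<ge> N \<Longrightarrow> l2norm M (\<lambda>x. w n x - u x) < \<delta>"
    using LIMSEQ_D[OF lim \<delta>(1)] by auto
  have "norm ((\<integral>x. f (w n x) * \<psi> x \<partial>M) - (\<integral>x. f (u x) * \<psi> x \<partial>M)) < e" if "n \<ge> N" for n
  proof -
    have i: "integrable M (\<lambda>x. f (w n x) * \<psi> x)" "integrable M (\<lambda>x. f (u x) * \<psi> x)"
      by (intro sqint_integrable_mult sqint_f fin w u \<psi>)+
    have "\<bar>\<integral>x. f (w n x) * \<psi> x - f (u x) * \<psi> x \<partial>M\<bar> \<le> e' * l2norm M \<psi>"
    proof (rule \<delta>(2)[of u "\<lambda>x. w n x - u x"])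
      show "\<exists>\<theta>. \<bar>\<theta> - u x\<bar> \<le> \<bar>w n x - u x\<bar> \<and> \<bar>f (w n x) * \<psi> x - f (u x) * \<psi> x\<bar> \<le> \<bar>f \<theta> - f (u x)\<bar> * \<bar>\<psi> x\<bar>" for x
        by (intro exI[of _ "w n x"]) (simp flip: abs_mult left_diff_distrib)
    qed (use i N[OF that] in \<open>auto intro: sqint_diff w u \<psi> borel_measurable_integrable\<close>)
    then show ?thesis using i e' by simp
  qed
  then show "\<exists>N. \<forall>n\<ge>N. norm ((\<integral>x. f (w n x) * \<psi> x \<partial>M) - (\<integral>x. f (u x) * \<psi> x \<partial>M)) < e" by blast
qed

end

lemma primitive_properties:
  fixes f F :: "real \<Rightarrow> real"
  assumes f: "continuous_on UNIV f" and F: "\<And>t. F t = (LBINT \<tau>=0..ereal t. f \<tau>)"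
  shows "F 0 = 0" "(F has_real_derivative f t) (at t)"
proof -
  show "F 0 = 0" by (simp add: F zero_ereal_def)
  \<comment> \<open>An interval with both 0 and t in its interior, so that the derivative at t is
    two-sided.\<close>
  let ?a = "- \<bar>t\<bar> - 1" and ?b = "\<bar>t\<bar> + 1"
  have "((\<lambda>u. LBINT y=(0::real)..u. f y) has_vector_derivative f t) (at t within {?a..?b})"
    by (rule interval_integral_FTC2) (auto intro: continuous_on_subset[OF f])
  moreover have "F = (\<lambda>u. LBINT y=(0::real)..u. f y)" by (simp add: F fun_eq_iff zero_ereal_def)
  moreover have "at t within {?a..?b} = at t" by (rule at_within_Icc_at) auto
  ultimately show "(F has_real_derivative f t) (at t)"
    by (simp add: has_real_derivative_iff_has_vector_derivative)
qed

section \<open>The Fucik functional\<close>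

definition fucik_rhs :: "real \<Rightarrow> real \<Rightarrow> real \<Rightarrow> real" where
  "fucik_rhs \<alpha> \<beta> t = \<alpha> * max t 0 - \<beta> * max (- t) 0"

definition fucik_quad :: "real \<Rightarrow> real \<Rightarrow> real \<Rightarrow> real" where
  "fucik_quad \<alpha> \<beta> t = \<alpha> * (max t 0)\<^sup>2 + \<beta> * (max (- t) 0)\<^sup>2"

text \<open>\<open>fucik_quad \<alpha> \<beta> t\<close> minus \<open>\<alpha> * t\<^sup>2\<close>
  is \<beta> - \<alpha> times the square of the negative part, hence convex; the inequality is its
  tangent line bound.\<close>

lemma fucik_quad_strongly_convex:
  assumes "\<alpha> \<le> \<beta>" "0 \<le> \<alpha>"
  shows "fucik_quad \<alpha> \<beta> t + 2 * fucik_rhs \<alpha> \<beta> t * s + \<alpha> * s\<^sup>2 \<le> fucik_quad \<alpha> \<beta> (t + s)"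
proof -
  consider "t \<ge> 0" "t + s \<ge> 0" | "t \<ge> 0" "t + s < 0" | "t < 0" "t + s < 0" | "t < 0" "t + s \<ge> 0" by linarith
  then show ?thesis
  proof cases
    case 1
    then show ?thesis by (simp add: fucik_quad_def fucik_rhs_def max_def power2_eq_square algebra_simps)
  next
    case 2
    have "\<alpha> * (t + s)\<^sup>2 \<le> \<beta> * (t + s)\<^sup>2" using assms by (intro mult_right_mono) auto
    with 2 show ?thesis by (auto simp: fucik_quad_def fucik_rhs_def max_def power2_eq_square algebra_simps)
  next
    case 3
    have "\<alpha> * s\<^sup>2 \<le> \<beta> * s\<^sup>2" using assms by (intro mult_right_mono) auto
    with 3 show ?thesis by (auto simp: fucik_quad_def fucik_rhs_def max_def power2_eq_square algebra_simps)
  next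
    case 4
    have "t * (t + 2 * s) \<le> 0" using 4 by (intro mult_nonpos_nonneg) auto
    then have "0 \<le> (\<alpha> - \<beta>) * (t * (t + 2 * s))" using assms by (intro mult_nonpos_nonpos) auto
    with 4 show ?thesis by (auto simp: fucik_quad_def fucik_rhs_def max_def power2_eq_square algebra_simps)
  qed
qed

lemma fucik_rhs_Lipschitz:
  assumes "\<alpha> \<le> \<beta>" "0 \<le> \<alpha>"
  shows "\<bar>fucik_rhs \<alpha> \<beta> a - fucik_rhs \<alpha> \<beta> b\<bar> \<le> \<beta> * \<bar>a - b\<bar>"
proof -
  have *: "0 \<le> fucik_rhs \<alpha> \<beta> a - fucik_rhs \<alpha> \<beta> b \<and> fucik_rhs \<alpha> \<beta> a - fucik_rhs \<alpha> \<beta> b \<le> \<beta> * (a - b)"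
    if "b \<le> a" for a b
  proof -
    have "0 \<le> \<alpha> * (max a 0 - max b 0)" "0 \<le> \<beta> * (max (- b) 0 - max (- a) 0)"
      "\<alpha> * (max a 0 - max b 0) \<le> \<beta> * (max a 0 - max b 0)"
      using assms that by (auto intro!: mult_nonneg_nonneg mult_right_mono)
    moreover have "\<beta> * (max a 0 - max b 0) + \<beta> * (max (- b) 0 - max (- a) 0) = \<beta> * (a - b)"
      by (auto simp: max_def algebra_simps)
    ultimately show ?thesis by (simp add: fucik_rhs_def algebra_simps)
  qed
  show ?thesis using *[of a b] *[of b a] by (cases "b \<le> a") auto
qed

lemma fucik_rhs_abs_le: "\<alpha> \<le> \<beta> \<Longrightarrow> 0 \<le> \<alpha> \<Longrightarrow> \<bar>fucik_rhs \<alpha> \<beta> a\<bar> \<le> \<beta> * \<bar>a\<bar>"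
  using fucik_rhs_Lipschitz[of \<alpha> \<beta> a 0] by (simp add: fucik_rhs_def)

lemma fucik_quad_eq: "fucik_quad \<alpha> \<beta> t = fucik_rhs \<alpha> \<beta> t * t"
  by (simp add: fucik_quad_def fucik_rhs_def max_def power2_eq_square)

lemma fucik_rhs_scale: "0 \<le> c \<Longrightarrow> fucik_rhs \<alpha> \<beta> (c * t) = c * fucik_rhs \<alpha> \<beta> t"
  by (auto simp: fucik_rhs_def max_def algebra_simps zero_le_mult_iff mult_le_0_iff)

lemma fucik_rhs_measurable [measurable]: "fucik_rhs \<alpha> \<beta> \<in> borel_measurable borel"
  unfolding fucik_rhs_def[abs_def] by measurable

lemma linear_coeff_zero:
  fixes a C :: real
  assumes "\<And>t. 0 \<le> t * a + t\<^sup>2 * C"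
  shows "a = 0"
proof (rule ccontr)
  assume a: "a \<noteq> 0"
  define D where "D = \<bar>C\<bar> + 1"
  have D: "D > 0" "C \<le> D" by (auto simp: D_def)
  have "0 \<le> (- a / (2 * D)) * a + (- a / (2 * D))\<^sup>2 * C" by (rule assms)
  \<comment> \<open>The chosen t is the minimiser of \<open>t * a + t\<^sup>2 * D\<close>.\<close>
  also have "\<dots> \<le> (- a / (2 * D)) * a + (- a / (2 * D))\<^sup>2 * D"
    using D by (intro add_left_mono mult_left_mono) auto
  also have "\<dots> = - (a\<^sup>2) / (4 * D)" using D by (simp add: power2_eq_square field_simps)
  also have "\<dots> < 0" using a D by simp
  finally show False by simp
qed

lemma square_completion:
  fixes c p d :: real
  assumes "d > 0"
  shows "c * p - d * c\<^sup>2 \<le> p\<^sup>2 / (4 * d)"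
proof -
  have "0 \<le> (2 * d * c - p)\<^sup>2" by simp
  then show ?thesis using assms by (simp add: field_simps power2_eq_square)
qed

locale fucik_point = eigen_space s K \<Omega> ev \<phi>
  for s :: real and K :: "real ^ 'n \<Rightarrow> real" and \<Omega> :: "(real ^ 'n) set"
    and ev :: "nat \<Rightarrow> real" and \<phi> :: "nat \<Rightarrow> real ^ 'n \<Rightarrow> real" +
  fixes \<alpha> \<beta> :: real and k :: nat
  assumes k: "1 \<le> k" and \<alpha>: "ev k < \<alpha>" and beta: "is_beta_of K \<Omega> \<phi> k \<alpha> \<beta>"
begin

abbreviation g where "g \<equiv> fucik_rhs \<alpha> \<beta>"
abbreviation J where "J \<equiv> J_functional K \<Omega> \<alpha> \<beta>"

text \<open>The derivative of J at w in direction v. Differentiability is not proved; the formula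
  itself, its homogeneity in w and the bound \<open>J_upper\<close> take its place.\<close>

definition dJ :: "(real ^ 'n \<Rightarrow> real) \<Rightarrow> (real ^ 'n \<Rightarrow> real) \<Rightarrow> real" where
  "dJ w v = E w v - ip (\<lambda>x. g (w x)) v"

lemma \<alpha>_pos: "0 < \<alpha>" using ev_pos[of k] k \<alpha> by linarith
lemma \<alpha>_le_\<beta>: "\<alpha> \<le> \<beta>" using beta by (simp add: is_beta_of_def)

lemma g_sqint: "sqint M w \<Longrightarrow> sqint M (\<lambda>x. g (w x))"
proof -
  assume w: "sqint M w"
  have [measurable]: "w \<in> borel_measurable M" using w by (simp add: sqint_def)
  show ?thesis
    by (rule sqint_bound[OF sqint_cmult[OF w, of \<beta>]])
      (use fucik_rhs_abs_le[of \<alpha> \<beta>] \<alpha>_pos \<alpha>_le_\<beta> in \<open>auto simp: abs_mult\<close>)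
qed

lemma g_Lipschitz_L2:
  assumes "sqint M w" "sqint M z"
  shows "nrm (\<lambda>x. g (w x) - g (z x)) \<le> \<beta> * nrm (\<lambda>x. w x - z x)"
proof -
  have "nrm (\<lambda>x. g (w x) - g (z x)) \<le> nrm (\<lambda>x. \<beta> * (w x - z x))"
    using fucik_rhs_Lipschitz[of \<alpha> \<beta>] \<alpha>_pos \<alpha>_le_\<beta>
    by (intro l2norm_mono sqint_diff g_sqint sqint_cmult assms) (auto simp: abs_mult)
  then show ?thesis using \<alpha>_pos \<alpha>_le_\<beta> by (simp add: l2norm_cmult)
qed

lemma J_eq:
  assumes w: "sqint M w"
  shows "J w = 1 / 2 * (E w w - ip (\<lambda>x. g (w x)) w)"
proof -
  have [measurable]: "w \<in> borel_measurable M" using w by (simp add: sqint_def)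
  have i: "integrable M (\<lambda>x. (max (w x) 0)\<^sup>2)" "integrable M (\<lambda>x. (max (- w x) 0)\<^sup>2)"
    by (rule Bochner_Integration.integrable_bound[OF sqint_integrable_square[OF w]];
        auto simp: max_def)+
  have "ip (\<lambda>x. g (w x)) w = (\<integral>x. \<alpha> * (max (w x) 0)\<^sup>2 + \<beta> * (max (- w x) 0)\<^sup>2 \<partial>M)"
    unfolding ip_eq by (simp flip: fucik_quad_eq) (simp add: fucik_quad_def)
  also have "\<dots> = \<alpha> * (\<integral>x. (max (w x) 0)\<^sup>2 \<partial>M) + \<beta> * (\<integral>x. (max (- w x) 0)\<^sup>2 \<partial>M)"
    using i by simp
  finally show ?thesis
    by (simp add: J_functional_def X0_norm_power2 set_lebesgue_integral_eq_restrict)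
qed

lemma J_eq_dJ: "w \<in> V \<Longrightarrow> J w = 1 / 2 * dJ w w"
  by (simp add: J_eq V_sqint dJ_def)

text \<open>In J a strongly convex integral is subtracted from the energy, which gives the last
  term. Over X_1, where the energy is at most \<open>ev k\<close> times the squared L2 norm, this
  makes J strongly concave; over the whole space it is an upper quadratic bound.\<close>

lemma J_upper:
  assumes w: "w \<in> V" and \<xi>: "\<xi> \<in> V"
  shows "J (\<lambda>x. w x + \<xi> x) \<le> J w + dJ w \<xi> + 1 / 2 * E \<xi> \<xi> - 1 / 2 * \<alpha> * (nrm \<xi>)\<^sup>2"
proof -
  have sq: "sqint M w" "sqint M \<xi>" "sqint M (\<lambda>x. w x + \<xi> x)"
    using w \<xi> by (auto intro: V_sqint V_add)
  note int = sqint_integrable_mult[OF g_sqint[OF sq(1)] sq(1)] sqint_integrable_mult[OF g_sqint[OF sq(1)] sq(2)]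
    sqint_integrable_square[OF sq(2)] sqint_integrable_mult[OF g_sqint[OF sq(3)] sq(3)]
  have "ip (\<lambda>x. g (w x)) w + 2 * ip (\<lambda>x. g (w x)) \<xi> + \<alpha> * (nrm \<xi>)\<^sup>2
      = (\<integral>x. g (w x) * w x + 2 * (g (w x) * \<xi> x) + \<alpha> * (\<xi> x)\<^sup>2 \<partial>M)"
    unfolding ip_eq l2norm_power2 using int by simp
  also have "\<dots> \<le> (\<integral>x. g (w x + \<xi> x) * (w x + \<xi> x) \<partial>M)"
  proof (rule integral_mono)
    show "g (w x) * w x + 2 * (g (w x) * \<xi> x) + \<alpha> * (\<xi> x)\<^sup>2 \<le> g (w x + \<xi> x) * (w x + \<xi> x)" for x
      using fucik_quad_strongly_convex[OF \<alpha>_le_\<beta>, of "w x" "\<xi> x"] \<alpha>_pos by (simp add: fucik_quad_eq)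
  qed (use int in simp_all)
  also have "\<dots> = ip (\<lambda>x. g (w x + \<xi> x)) (\<lambda>x. w x + \<xi> x)" by (simp add: ip_eq)
  finally have 1: "ip (\<lambda>x. g (w x)) w + 2 * ip (\<lambda>x. g (w x)) \<xi> + \<alpha> * (nrm \<xi>)\<^sup>2
    \<le> ip (\<lambda>x. g (w x + \<xi> x)) (\<lambda>x. w x + \<xi> x)" .
  have 2: "E (\<lambda>x. w x + \<xi> x) (\<lambda>x. w x + \<xi> x) = E w w + 2 * E w \<xi> + E \<xi> \<xi>"
    using w \<xi> by (simp add: E_add_left E_add_right V_add E_sym[of \<xi> w])
  show ?thesis
    unfolding J_eq[OF sq(3)] J_eq[OF sq(1)] dJ_def 2 using 1 by (simp add: field_simps)
qed

lemma dJ_cmult_right: "dJ w (\<lambda>x. c * v x) = c * dJ w v"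
  by (simp add: dJ_def E_cmult_right ip_cmult_right right_diff_distrib)

lemma dJ_diff_right: "w \<in> V \<Longrightarrow> u \<in> V \<Longrightarrow> v \<in> V \<Longrightarrow> dJ w (\<lambda>x. u x - v x) = dJ w u - dJ w v"
  by (simp add: dJ_def E_diff_right ip_diff_right g_sqint V_sqint)

lemma dJ_lc: "w \<in> V \<Longrightarrow> dJ w (lc N c) = (\<Sum>i=1..N. c i * dJ w (\<phi> i))"
proof -
  assume w: "w \<in> V"
  have "dJ w (lc N c) = (\<Sum>i=1..N. ev i * c i * ip w (\<phi> i) - c i * ip (\<lambda>x. g (w x)) (\<phi> i))"
    using w by (simp add: dJ_def E_lc ip_lc g_sqint V_sqint sum_subtractf)
  also have "\<dots> = (\<Sum>i=1..N. c i * dJ w (\<phi> i))"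
    by (rule sum.cong) (auto simp: dJ_def E_\<phi> w algebra_simps)
  finally show ?thesis .
qed

lemma dJ_\<phi>: "1 \<le> i \<Longrightarrow> w \<in> V \<Longrightarrow> dJ w (\<phi> i) = ev i * ip w (\<phi> i) - ip (\<lambda>x. g (w x)) (\<phi> i)"
  by (simp add: dJ_def E_\<phi>)

text \<open>Against an eigenfunction the energy product is \<open>ev i\<close> times an L2 product,
  so L2 distance controls the difference. Hence conditions on \<open>dJ\<close> along X_1 survive L2
  limits.\<close>

lemma dJ_\<phi>_Lipschitz:
  assumes i: "1 \<le> i" and w: "w \<in> V" and z: "z \<in> V"
  shows "\<bar>dJ w (\<phi> i) - dJ z (\<phi> i)\<bar> \<le> (ev i + \<beta>) * nrm (\<lambda>x. w x - z x)"
proof -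
  note sq = V_sqint[OF w] V_sqint[OF z] \<phi>_sqint[OF i]
  have "dJ w (\<phi> i) - dJ z (\<phi> i) = ev i * ip (\<lambda>x. w x - z x) (\<phi> i) - ip (\<lambda>x. g (w x) - g (z x)) (\<phi> i)"
    using sq i w z by (simp add: dJ_\<phi> ip_diff_left g_sqint algebra_simps)
  also have "\<bar>\<dots>\<bar> \<le> ev i * nrm (\<lambda>x. w x - z x) + \<beta> * nrm (\<lambda>x. w x - z x)"
  proof -
    have a: "\<bar>ip (\<lambda>x. w x - z x) (\<phi> i)\<bar> \<le> nrm (\<lambda>x. w x - z x)"
      using ip_Cauchy_Schwarz[OF sqint_diff[OF sq(1,2)] sq(3)] by (simp add: nrm_\<phi>[OF i])
    have "\<bar>ev i * ip (\<lambda>x. w x - z x) (\<phi> i)\<bar> \<le> ev i * nrm (\<lambda>x. w x - z x)"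
      using a ev_pos[OF i] by (simp add: abs_mult)
    moreover have "\<bar>ip (\<lambda>x. g (w x) - g (z x)) (\<phi> i)\<bar> \<le> nrm (\<lambda>x. g (w x) - g (z x))"
      using ip_Cauchy_Schwarz[OF sqint_diff[OF g_sqint[OF sq(1)] g_sqint[OF sq(2)]] sq(3)] by (simp add: nrm_\<phi>[OF i])
    ultimately show ?thesis using g_Lipschitz_L2[OF sq(1,2)] by linarith
  qed
  finally show ?thesis by (simp add: algebra_simps)
qed

lemma J_scale:
  assumes c: "0 \<le> c" and w: "w \<in> V"
  shows "J (\<lambda>x. c * w x) = c\<^sup>2 * J w"
  using c by (simp add: J_eq V_sqint[OF w] sqint_cmult fucik_rhs_scale E_cmult_left E_cmult_right
      ip_cmult_left ip_cmult_right power2_eq_square algebra_simps)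

lemma dJ_scale: "0 \<le> c \<Longrightarrow> dJ (\<lambda>x. c * w x) v = c * dJ w v"
  by (simp add: dJ_def fucik_rhs_scale E_cmult_left ip_cmult_left algebra_simps)

lemma ip_g_le: "sqint M w \<Longrightarrow> ip (\<lambda>x. g (w x)) w \<le> \<beta> * (nrm w)\<^sup>2"
proof -
  assume w: "sqint M w"
  have "ip (\<lambda>x. g (w x)) w \<le> (\<integral>x. \<beta> * (w x)\<^sup>2 \<partial>M)"
    unfolding ip_eq
  proof (rule integral_mono)
    show "integrable M (\<lambda>x. g (w x) * w x)" by (intro sqint_integrable_mult g_sqint w)
    show "integrable M (\<lambda>x. \<beta> * (w x)\<^sup>2)" using w by (simp add: sqint_def)
    show "g (w x) * w x \<le> \<beta> * (w x)\<^sup>2" for x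
    proof -
      have "g (w x) * w x \<le> \<bar>g (w x)\<bar> * \<bar>w x\<bar>" by (metis abs_ge_self abs_mult)
      also have "\<dots> \<le> \<beta> * \<bar>w x\<bar> * \<bar>w x\<bar>"
        using fucik_rhs_abs_le[OF \<alpha>_le_\<beta>] \<alpha>_pos by (intro mult_right_mono) auto
      finally show ?thesis by (simp add: power2_eq_square mult.assoc)
    qed
  qed
  then show ?thesis by (simp add: l2norm_power2)
qed

text \<open>The maximiser of \<open>J\<close> over \<open>w + X\<^sub>1\<close> has nonnegative value by homogeneity and
  \<open>m(\<alpha>,\<beta>) = 0\<close>.\<close>

lemma exists_J_nonneg:
  assumes w: "w \<in> V"
  shows "\<exists>c. 0 \<le> J (\<lambda>x. w x + lc k c x)"
proof -
  define a where "a i = ip w (\<phi> i)" for i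
  define v where "v = (\<lambda>x. w x - lc k a x)"
  have v: "v \<in> V" by (simp add: v_def V_diff w lc_V)
  have v_\<phi>: "ip v (\<phi> i) = 0" if "i \<in> {1..k}" for i
    using that by (simp add: v_def ip_diff_left V_sqint[OF w] lc_sqint \<phi>_sqint ip_lc_\<phi> a_def)
  show ?thesis
  proof (cases "nrm v = 0")
    case True
    \<comment> \<open>Here w agrees on \<Omega> almost everywhere with an element of X_1 and v
      cannot be normalised; but v itself lies in w + X_1, and \<open>J v\<close> is half its
      energy.\<close>
    have "(\<lambda>x. w x + lc k (\<lambda>i. - 1 * a i) x) = v"
      unfolding lc_cmult by (simp add: v_def)
    moreover have "0 \<le> J v"
      using ip_g_le[OF V_sqint[OF v]] True E_nonneg[of v] by (simp add: J_eq V_sqint[OF v])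
    ultimately show ?thesis by (intro exI[of _ "\<lambda>i. - 1 * a i"]) simp
  next
    case False
    define n where "n = nrm v"
    have n: "n > 0" using False l2norm_nonneg[of M v] unfolding n_def by linarith
    define v' where "v' = (\<lambda>x. 1 / n * v x)"
    have v'V: "v' \<in> V" unfolding v'_def by (intro V_cmult v)
    have "nrm v' = 1" unfolding v'_def l2norm_cmult using n by (simp add: n_def)
    moreover have "v' \<in> space_X2 K \<Omega> \<phi> k"
    proof -
      have "E u v' = 0" if u: "u \<in> space_X1 \<phi> k" for u
      proof -
        obtain c where "u = lc k c" using u by (auto simp: space_X1_def lc_def)
        then have "E u v' = 1 / n * (\<Sum>j=1..k. ev j * c j * ip v (\<phi> j))"
          by (simp only: E_sym[of "lc k c"] v'_def E_cmult_left E_lc[OF v])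
        also have "(\<Sum>j=1..k. ev j * c j * ip v (\<phi> j)) = 0"
          by (rule sum.neutral) (use v_\<phi> in auto)
        finally show ?thesis by simp
      qed
      with v'V show ?thesis by (simp add: space_X2_def)
    qed
    ultimately have v': "v' \<in> {v \<in> space_X2 K \<Omega> \<phi> k. L2_norm \<Omega> v = 1}" by (simp add: L2_norm_eq)
    obtain m where m: "\<forall>v\<in>{v \<in> space_X2 K \<Omega> \<phi> k. L2_norm \<Omega> v = 1}.
        is_maximum (space_X1 \<phi> k) (\<lambda>u. J (\<lambda>x. u x + v x)) (m v)"
      and m0: "is_minimum {v \<in> space_X2 K \<Omega> \<phi> k. L2_norm \<Omega> v = 1} m 0"
      using beta unfolding is_beta_of_def is_minimax_value_def by blast
    from m0 v' have "0 \<le> m v'" unfolding is_minimum_def by blast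
    moreover from m v' have "is_maximum (space_X1 \<phi> k) (\<lambda>u. J (\<lambda>x. u x + v' x)) (m v')" by (rule bspec)
    ultimately obtain u where "u \<in> space_X1 \<phi> k" "0 \<le> J (\<lambda>x. u x + v' x)"
      unfolding is_maximum_def by force
    then obtain c where c: "0 \<le> J (\<lambda>x. lc k c x + v' x)" by (auto simp: space_X1_def lc_def)
    have "J (\<lambda>x. n * (lc k c x + v' x)) = n\<^sup>2 * J (\<lambda>x. lc k c x + v' x)"
      using n by (intro J_scale V_add lc_V v'V) auto
    with c have "0 \<le> J (\<lambda>x. n * (lc k c x + v' x))" by simp
    moreover have "(\<lambda>x. n * (lc k c x + v' x)) = (\<lambda>x. w x + lc k (\<lambda>i. n * c i - a i) x)"
      unfolding lc_diff lc_cmult using n by (auto simp: v'_def v_def field_simps)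
    ultimately show ?thesis by (intro exI[of _ "\<lambda>i. n * c i - a i"]) simp
  qed
qed

text \<open>On X_1 the energy minus \<alpha> times the squared L2 norm is at most
  \<open>- 2 * \<kappa>\<close> times that squared norm.\<close>

definition \<kappa> :: real where "\<kappa> = (\<alpha> - ev k) / 2"

lemma \<kappa>_pos: "0 < \<kappa>" using \<alpha> by (simp add: \<kappa>_def)

text \<open>Insert the point of w + X_1 with nonnegative J into \<open>J_upper\<close> and complete
  the square in each coefficient. The sum measures how far w is from maximising J on its affine
  space.\<close>

lemma J_lower:
  assumes w: "w \<in> V"
  shows "0 \<le> J w + (\<Sum>i=1..k. (dJ w (\<phi> i))\<^sup>2) / (4 * \<kappa>)"
proof -
  obtain c where "0 \<le> J (\<lambda>x. w x + lc k c x)" using exists_J_nonneg[OF w] by blast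
  also have "\<dots> \<le> J w + dJ w (lc k c) + 1 / 2 * E (lc k c) (lc k c) - 1 / 2 * \<alpha> * (nrm (lc k c))\<^sup>2"
    by (rule J_upper[OF w lc_V])
  also have "\<dots> = J w + (\<Sum>i=1..k. c i * dJ w (\<phi> i) + 1 / 2 * (ev i * (c i)\<^sup>2) - 1 / 2 * \<alpha> * (c i)\<^sup>2)"
    by (simp add: dJ_lc[OF w] E_lc_lc nrm_lc sum.distrib sum_subtractf sum_distrib_left)
  also have "\<dots> \<le> J w + (\<Sum>i=1..k. (dJ w (\<phi> i))\<^sup>2 / (4 * \<kappa>))"
  proof (intro add_left_mono sum_mono)
    fix i assume i: "i \<in> {1..k}"
    have "ev i * (c i)\<^sup>2 \<le> ev k * (c i)\<^sup>2" using i by (intro mult_right_mono ev_mono) auto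
    then have "c i * dJ w (\<phi> i) + 1 / 2 * (ev i * (c i)\<^sup>2) - 1 / 2 * \<alpha> * (c i)\<^sup>2
        \<le> c i * dJ w (\<phi> i) - \<kappa> * (c i)\<^sup>2" by (simp add: \<kappa>_def field_simps)
    also have "\<dots> \<le> (dJ w (\<phi> i))\<^sup>2 / (4 * \<kappa>)" by (rule square_completion[OF \<kappa>_pos])
    finally show "c i * dJ w (\<phi> i) + 1 / 2 * (ev i * (c i)\<^sup>2) - 1 / 2 * \<alpha> * (c i)\<^sup>2 \<le> (dJ w (\<phi> i))\<^sup>2 / (4 * \<kappa>)" .
  qed
  finally show ?thesis by (simp add: sum_divide_distrib)
qed

text \<open>Such a \<open>w\<close> minimises the right-hand side of \<open>J_lower\<close>.\<close>

lemma critical_point: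
  assumes w: "w \<in> V" and J: "J w \<le> 0" and dJ0: "\<And>i. i \<in> {1..k} \<Longrightarrow> dJ w (\<phi> i) = 0" and z: "z \<in> V"
  shows "dJ w z = 0"
proof (rule linear_coeff_zero)
  fix t :: real
  define \<xi> where "\<xi> = (\<lambda>x. t * z x)"
  have \<xi>: "\<xi> \<in> V" by (simp add: \<xi>_def V_cmult z)
  let ?u = "\<lambda>x. w x + \<xi> x"
  have u: "?u \<in> V" by (intro V_add w \<xi>)
  have "J ?u \<le> J w + dJ w \<xi> + 1 / 2 * E \<xi> \<xi> - 1 / 2 * \<alpha> * (nrm \<xi>)\<^sup>2" by (rule J_upper[OF w \<xi>])
  moreover have "0 \<le> 1 / 2 * \<alpha> * (nrm \<xi>)\<^sup>2" using \<alpha>_pos by simp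
  moreover have "dJ w \<xi> = t * dJ w z" by (simp add: \<xi>_def dJ_cmult_right)
  moreover have "E \<xi> \<xi> = t\<^sup>2 * E z z" by (simp add: \<xi>_def E_cmult_left E_cmult_right power2_eq_square)
  ultimately have Ju: "J ?u \<le> t * dJ w z + t\<^sup>2 * (1 / 2 * E z z)" using J by simp
  \<comment> \<open>The components of \<open>dJ\<close> on X_1 vanish at w and are Lipschitz, so
    their squares are of second order in t and only \<open>dJ w z\<close> remains at first
    order.\<close>
  have "(dJ ?u (\<phi> i))\<^sup>2 \<le> t\<^sup>2 * ((ev i + \<beta>) * nrm z)\<^sup>2" if i: "i \<in> {1..k}" for i
  proof -
    have "\<bar>dJ ?u (\<phi> i)\<bar> \<le> (ev i + \<beta>) * nrm (\<lambda>x. w x + \<xi> x - w x)"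
      using dJ_\<phi>_Lipschitz[OF _ u w, of i] i dJ0[OF i] by simp
    also have "\<dots> = (ev i + \<beta>) * (\<bar>t\<bar> * nrm z)" by (simp add: \<xi>_def l2norm_cmult)
    finally have "\<bar>dJ ?u (\<phi> i)\<bar>\<^sup>2 \<le> ((ev i + \<beta>) * (\<bar>t\<bar> * nrm z))\<^sup>2" by (intro power_mono) auto
    then show ?thesis by (simp add: power_mult_distrib mult_ac)
  qed
  then have "(\<Sum>i=1..k. (dJ ?u (\<phi> i))\<^sup>2) \<le> (\<Sum>i=1..k. t\<^sup>2 * ((ev i + \<beta>) * nrm z)\<^sup>2)"
    by (rule sum_mono)
  then have "(\<Sum>i=1..k. (dJ ?u (\<phi> i))\<^sup>2) / (4 * \<kappa>) \<le> t\<^sup>2 * ((\<Sum>i=1..k. ((ev i + \<beta>) * nrm z)\<^sup>2) / (4 * \<kappa>))"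
    using \<kappa>_pos by (simp add: sum_distrib_left divide_right_mono)
  with Ju J_lower[OF u] have "0 \<le> t * dJ w z + t\<^sup>2 * (1 / 2 * E z z) + t\<^sup>2 * ((\<Sum>i=1..k. ((ev i + \<beta>) * nrm z)\<^sup>2) / (4 * \<kappa>))"
    by linarith
  then show "0 \<le> t * dJ w z + t\<^sup>2 * (1 / 2 * E z z + (\<Sum>i=1..k. ((ev i + \<beta>) * nrm z)\<^sup>2) / (4 * \<kappa>))"
    by (simp add: distrib_left)
qed

end

section \<open>The resonant problem\<close>

locale fucik_resonance =
  fucik_point s K \<Omega> ev \<phi> \<alpha> \<beta> k + bounded_nonlinearity f F B
  for s :: real and K :: "real ^ 'n \<Rightarrow> real" and \<Omega> :: "(real ^ 'n) set"
    and ev :: "nat \<Rightarrow> real" and \<phi> :: "nat \<Rightarrow> real ^ 'n \<Rightarrow> real"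
    and \<alpha> \<beta> :: real and k :: nat and f F :: "real \<Rightarrow> real" and B :: real +
  fixes h :: "real ^ 'n \<Rightarrow> real"
  assumes h: "sqint M h"
    and landesman_lazer: "\<And>u v. (\<And>j. u j \<in> V) \<Longrightarrow> filterlim (\<lambda>j. nrm (u j)) at_top sequentially \<Longrightarrow>
      nontrivial_fucik_eigenfunction K \<Omega> \<alpha> \<beta> v \<Longrightarrow>
      (\<lambda>j. nrm (\<lambda>x. u j x / nrm (u j) - v x)) \<longlonglongrightarrow> 0 \<Longrightarrow>
      filterlim (\<lambda>j. \<integral>x. F (u j x) + h x * u j x \<partial>M) at_bot sequentially"
begin

definition pert :: "(real ^ 'n \<Rightarrow> real) \<Rightarrow> real" where
  "pert w = (\<integral>x. F (w x) + h x * w x \<partial>M)"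

definition \<Phi> :: "(real ^ 'n \<Rightarrow> real) \<Rightarrow> real" where
  "\<Phi> w = J w - pert w"

definition d\<Phi> :: "(real ^ 'n \<Rightarrow> real) \<Rightarrow> (real ^ 'n \<Rightarrow> real) \<Rightarrow> real" where
  "d\<Phi> w v = dJ w v - ip (\<lambda>x. f (w x)) v - ip h v"

text \<open>The L2 norm of \<open>f (w x) + h x\<close> never exceeds H. Hence H bounds
  \<open>pert\<close> relative to the L2 norm and the difference of \<open>d\<Phi>\<close> and
  \<open>dJ\<close> on unit vectors.\<close>

definition H :: real where "H = B * nrm (\<lambda>x. 1) + nrm h"

lemma H_nonneg: "0 \<le> H"
  using B_nonneg by (simp add: H_def)

lemma sqint_one: "sqint M (\<lambda>x. 1)"
  by (simp add: sqint_def)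

lemmas f_sqint = sqint_f[OF finite_measure_axioms]

lemma nrm_f_le: "sqint M w \<Longrightarrow> nrm (\<lambda>x. f (w x)) \<le> B * nrm (\<lambda>x. 1)"
  using l2norm_mono[OF f_sqint sqint_cmult[OF sqint_one, of B], of w] f_bound B_nonneg
  by (simp add: l2norm_cmult[of M B "\<lambda>x. 1", simplified])

lemma pert_le:
  assumes w: "sqint M w"
  shows "\<bar>pert w\<bar> \<le> H * nrm w"
proof -
  have abs: "sqint M (\<lambda>x. \<bar>w x\<bar>)" "nrm (\<lambda>x. \<bar>w x\<bar>) = nrm w"
    using w by (auto simp: sqint_def l2norm_def)
  have iF: "integrable M (\<lambda>x. F (w x))" by (rule sqint_imp_integrable[OF finite_measure_axioms sqint_F[OF w]])
  have ia: "integrable M (\<lambda>x. \<bar>w x\<bar>)" by (rule sqint_imp_integrable[OF finite_measure_axioms abs(1)])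
  have "\<bar>\<integral>x. F (w x) \<partial>M\<bar> \<le> (\<integral>x. \<bar>F (w x)\<bar> \<partial>M)" by (rule integral_abs_bound)
  also have "\<dots> \<le> (\<integral>x. B * \<bar>w x\<bar> \<partial>M)" using iF ia F_abs_le by (intro integral_mono) auto
  also have "\<dots> = B * (\<integral>x. 1 * \<bar>w x\<bar> \<partial>M)" by simp
  also have "\<dots> \<le> B * (nrm (\<lambda>x. 1) * nrm w)"
    using abs_le_D1[OF sqint_Cauchy_Schwarz[OF sqint_one abs(1)]] B_nonneg
    by (intro mult_left_mono) (simp_all add: abs(2))
  finally have "\<bar>\<integral>x. F (w x) \<partial>M\<bar> \<le> B * nrm (\<lambda>x. 1) * nrm w" by simp
  moreover have "\<bar>\<integral>x. h x * w x \<partial>M\<bar> \<le> nrm h * nrm w" by (rule sqint_Cauchy_Schwarz[OF h w])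
  moreover have "pert w = (\<integral>x. F (w x) \<partial>M) + (\<integral>x. h x * w x \<partial>M)"
    unfolding pert_def using iF sqint_integrable_mult[OF h w] by simp
  ultimately show ?thesis by (simp add: H_def distrib_right)
qed

lemma d\<Phi>_dJ:
  assumes i: "1 \<le> i" and w: "w \<in> V"
  shows "\<bar>d\<Phi> w (\<phi> i) - dJ w (\<phi> i)\<bar> \<le> H"
proof -
  have "\<bar>ip (\<lambda>x. f (w x)) (\<phi> i)\<bar> \<le> B * nrm (\<lambda>x. 1)"
    using ip_Cauchy_Schwarz[OF f_sqint[OF V_sqint[OF w]] \<phi>_sqint[OF i]] nrm_f_le[OF V_sqint[OF w]]
    by (simp add: nrm_\<phi>[OF i])
  moreover have "\<bar>ip h (\<phi> i)\<bar> \<le> nrm h"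
    using ip_Cauchy_Schwarz[OF h \<phi>_sqint[OF i]] by (simp add: nrm_\<phi>[OF i])
  ultimately show ?thesis by (simp add: d\<Phi>_def H_def)
qed

lemma ip_tendsto:
  assumes a: "\<And>n. sqint M (a n)" and a': "sqint M a'" and b: "\<And>n. sqint M (b n)" and b': "sqint M b'"
    and la: "(\<lambda>n. nrm (\<lambda>x. a n x - a' x)) \<longlonglongrightarrow> 0" and lb: "(\<lambda>n. nrm (\<lambda>x. b n x - b' x)) \<longlonglongrightarrow> 0"
  shows "(\<lambda>n. ip (a n) (b n)) \<longlonglongrightarrow> ip a' b'"
proof -
  let ?A = "\<lambda>n. nrm (\<lambda>x. a n x - a' x)" and ?B = "\<lambda>n. nrm (\<lambda>x. b n x - b' x)"
  have "(\<lambda>n. ?A n * ?B n + ?A n * nrm b' + nrm a' * ?B n) \<longlonglongrightarrow> 0 * 0 + 0 * nrm b' + nrm a' * 0"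
    by (intro tendsto_intros la lb)
  then have "(\<lambda>n. ?A n * ?B n + ?A n * nrm b' + nrm a' * ?B n) \<longlonglongrightarrow> 0" by simp
  then have "(\<lambda>n. ip (a n) (b n) - ip a' b') \<longlonglongrightarrow> 0"
  proof (rule Lim_null_comparison[rotated], intro always_eventually allI)
    fix n
    have "ip (a n) (b n) - ip a' b' = ip (\<lambda>x. a n x - a' x) (\<lambda>x. b n x - b' x)
        + ip (\<lambda>x. a n x - a' x) b' + ip a' (\<lambda>x. b n x - b' x)"
      by (simp add: ip_diff_left ip_diff_right a a' b b' sqint_diff)
    moreover have "\<bar>ip (\<lambda>x. a n x - a' x) (\<lambda>x. b n x - b' x)\<bar> \<le> ?A n * ?B n"
      "\<bar>ip (\<lambda>x. a n x - a' x) b'\<bar> \<le> ?A n * nrm b'" "\<bar>ip a' (\<lambda>x. b n x - b' x)\<bar> \<le> nrm a' * ?B n"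
      by (intro ip_Cauchy_Schwarz sqint_diff a a' b b')+
    ultimately show "norm (ip (a n) (b n) - ip a' b') \<le> ?A n * ?B n + ?A n * nrm b' + nrm a' * ?B n"
      by simp
  qed
  then show ?thesis by (simp add: LIM_zero_iff)
qed

lemma g_tendsto:
  assumes a: "\<And>n. sqint M (a n)" and a': "sqint M a'" and la: "(\<lambda>n. nrm (\<lambda>x. a n x - a' x)) \<longlonglongrightarrow> 0"
  shows "(\<lambda>n. nrm (\<lambda>x. g (a n x) - g (a' x))) \<longlonglongrightarrow> 0"
proof (rule Lim_null_comparison)
  show "\<forall>\<^sub>F n in sequentially. norm (nrm (\<lambda>x. g (a n x) - g (a' x))) \<le> \<beta> * nrm (\<lambda>x. a n x - a' x)"
    by (intro always_eventually allI) (simp add: g_Lipschitz_L2 a a')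
  show "(\<lambda>n. \<beta> * nrm (\<lambda>x. a n x - a' x)) \<longlonglongrightarrow> 0"
    using tendsto_mult_left[OF la, of \<beta>] by simp
qed

lemma dJ_\<phi>_tendsto:
  assumes i: "1 \<le> i" and a: "\<And>n. a n \<in> V" and a': "a' \<in> V" and la: "(\<lambda>n. nrm (\<lambda>x. a n x - a' x)) \<longlonglongrightarrow> 0"
  shows "(\<lambda>n. dJ (a n) (\<phi> i)) \<longlonglongrightarrow> dJ a' (\<phi> i)"
proof -
  have c: "(\<lambda>n. nrm (\<lambda>x. \<phi> i x - \<phi> i x)) \<longlonglongrightarrow> 0" by (simp add: l2norm_def)
  show ?thesis
    unfolding dJ_\<phi>[OF i a] dJ_\<phi>[OF i a']
    by (intro tendsto_intros ip_tendsto[where b = "\<lambda>_. \<phi> i"] g_tendsto c la g_sqint V_sqint a a' \<phi>_sqint i)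
qed

lemma fucik_eigenfunctionI:
  assumes v: "v \<in> V" and crit: "\<And>z. z \<in> V \<Longrightarrow> dJ v z = 0" and n: "nrm v = 1"
  shows "nontrivial_fucik_eigenfunction K \<Omega> \<alpha> \<beta> v"
proof -
  have "weak_solution K \<Omega> (\<lambda>x. \<alpha> * max (v x) 0 - \<beta> * max (- v x) 0) v"
    using v crit by (auto simp: weak_solution_def dJ_def ip_eq fucik_rhs_def set_lebesgue_integral_eq_restrict)
  moreover have "\<not> (AE x in lebesgue. v x = 0)"
  proof
    assume "AE x in lebesgue. v x = 0"
    then have "AE x in M. (v x)\<^sup>2 = 0" by (auto simp: AE_restrict_space_iff elim: eventually_mono)
    then have "(\<integral>x. (v x)\<^sup>2 \<partial>M) = 0" by (rule integral_eq_zero_AE)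
    with n show False by (simp add: l2norm_def)
  qed
  ultimately show ?thesis by (simp add: nontrivial_fucik_eigenfunction_def)
qed

section \<open>A priori bound from the Landesman-Lazer condition\<close>

text \<open>Two scales are used. The normalised functions give a limit v with
  \<open>J v \<le> 0\<close> and \<open>dJ\<close> zero on X_1, thus an eigenfunction to which the
  Landesman-Lazer condition applies. For the original functions \<open>J_lower\<close> keeps J above
  a constant depending on P, while \<open>pert\<close> tends to minus infinity, so \<Phi> cannot
  stay below C.\<close>

lemma sublevel_bounded:
  assumes P: "0 \<le> P"
  shows "\<exists>R\<ge>0. \<forall>w\<in>V. \<Phi> w \<le> C \<longrightarrow> (\<forall>i\<in>{1..k}. \<bar>dJ w (\<phi> i)\<bar> \<le> P) \<longrightarrow> nrm w \<le> R"
proof (rule ccontr)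
  assume "\<not> ?thesis"
  then have "\<exists>w. w \<in> V \<and> \<Phi> w \<le> C \<and> (\<forall>i\<in>{1..k}. \<bar>dJ w (\<phi> i)\<bar> \<le> P) \<and> real n + 1 < nrm w" for n
    by (auto simp: not_le dest!: spec[of _ "real n + 1"])
  then obtain w where w: "\<And>n. w n \<in> V" and \<Phi>w: "\<And>n. \<Phi> (w n) \<le> C"
    and dJw: "\<And>n i. i \<in> {1..k} \<Longrightarrow> \<bar>dJ (w n) (\<phi> i)\<bar> \<le> P" and big: "\<And>n. real n + 1 < nrm (w n)"
    by metis
  define t where "t n = nrm (w n)" for n
  have t: "1 \<le> t n" "0 < t n" for n using big[of n] by (auto simp: t_def)
  have "real n \<le> t n" for n using big[of n] by (simp add: t_def)
  then have t_top: "filterlim t at_top sequentially"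
    by (intro filterlim_at_top_mono[OF filterlim_real_sequentially] always_eventually allI)
  define z where "z n = (\<lambda>x. 1 / t n * w n x)" for n
  have z: "z n \<in> V" for n unfolding z_def by (intro V_cmult w)
  have nz: "nrm (z n) = 1" for n unfolding z_def l2norm_cmult using t[of n] by (simp add: t_def)
  \<comment> \<open>As \<open>t n \<ge> 1\<close>, the constant C is absorbed into the linear term;
    dividing by the square of \<open>t n\<close> leaves \<open>A / t n\<close>.\<close>
  define A where "A = \<bar>C\<bar> + H"
  have A: "0 \<le> A" using H_nonneg by (simp add: A_def)
  have Jz: "J (z n) \<le> A / t n" for n
  proof -
    have "J (w n) \<le> C + H * t n"
      using \<Phi>w[of n] pert_le[OF V_sqint[OF w], of n] by (simp add: \<Phi>_def t_def)
    also have "\<dots> \<le> A * t n"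
    proof -
      have "C \<le> \<bar>C\<bar> * t n" using t[of n] mult_left_mono[of 1 "t n" "\<bar>C\<bar>"] by simp
      then show ?thesis by (simp add: A_def distrib_right)
    qed
    finally have "(1 / t n)\<^sup>2 * J (w n) \<le> (1 / t n)\<^sup>2 * (A * t n)" by (rule mult_left_mono) simp
    then show ?thesis
      using t[of n] J_scale[OF _ w, of "1 / t n" n] by (simp add: z_def power2_eq_square)
  qed
  have Ez: "E (z n) (z n) = 2 * J (z n) + ip (\<lambda>x. g (z n x)) (z n)" for n
  proof -
    have "b = 2 * a + c" if "a = 1 / 2 * (b - c)" for a b c :: real using that by simp
    then show ?thesis using J_eq[OF V_sqint[OF z], of n] by this
  qed
  have "E (z n) (z n) \<le> 2 * A + \<beta>" for n
  proof -
    have "A / t n \<le> A" using A t[of n] by (simp add: divide_le_eq mult_left_le_one_le mult_le_cancel_left1)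
    then show ?thesis using Ez[of n] Jz[of n] ip_g_le[OF V_sqint[OF z], of n] by (simp add: nz)
  qed
  from bounded_energy_subseq[where w = z, OF z this] obtain r v where r: "strict_mono r" and v: "v \<in> V"
    and lim: "(\<lambda>n. nrm (\<lambda>x. z (r n) x - v x)) \<longlonglongrightarrow> 0"
    and lsc: "\<forall>C'. (\<forall>\<^sub>F n in sequentially. E (z (r n)) (z (r n)) \<le> C') \<longrightarrow> E v v \<le> C'" by blast
  have tr: "filterlim (\<lambda>n. t (r n)) at_top sequentially"
    using filterlim_compose[OF t_top filterlim_subseq[OF r]] by simp
  have gl: "(\<lambda>n. ip (\<lambda>x. g (z (r n) x)) (z (r n))) \<longlonglongrightarrow> ip (\<lambda>x. g (v x)) v"
    by (intro ip_tendsto g_tendsto lim g_sqint V_sqint z v)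
  have "(\<lambda>n. 2 * (A / t (r n)) + ip (\<lambda>x. g (z (r n) x)) (z (r n))) \<longlonglongrightarrow> 2 * 0 + ip (\<lambda>x. g (v x)) v"
    by (intro tendsto_add tendsto_mult_left gl real_tendsto_divide_at_top[OF tendsto_const tr])
  then have up: "(\<lambda>n. 2 * (A / t (r n)) + ip (\<lambda>x. g (z (r n) x)) (z (r n))) \<longlonglongrightarrow> ip (\<lambda>x. g (v x)) v" by simp
  have "E v v \<le> ip (\<lambda>x. g (v x)) v"
  \<comment> \<open>The energies need not converge; \<open>lsc\<close> is applied to bounds that
    exceed the limit of the right-hand sides by e.\<close>
  proof (rule field_le_epsilon)
    fix e :: real assume "e > 0"
    show "E v v \<le> ip (\<lambda>x. g (v x)) v + e"
    proof (rule lsc[rule_format])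
      have "\<forall>\<^sub>F n in sequentially. 2 * (A / t (r n)) + ip (\<lambda>x. g (z (r n) x)) (z (r n)) < ip (\<lambda>x. g (v x)) v + e"
        using \<open>e > 0\<close> by (intro order_tendstoD(2)[OF up]) simp
      then show "\<forall>\<^sub>F n in sequentially. E (z (r n)) (z (r n)) \<le> ip (\<lambda>x. g (v x)) v + e"
      proof eventually_elim
        case (elim n)
        then show ?case using Ez[of "r n"] Jz[of "r n"] by linarith
      qed
    qed
  qed
  then have "J v \<le> 0" by (simp add: J_eq V_sqint[OF v])
  moreover have "dJ v (\<phi> i) = 0" if i: "i \<in> {1..k}" for i
  proof -
    have "(\<lambda>n. dJ (z (r n)) (\<phi> i)) \<longlonglongrightarrow> dJ v (\<phi> i)" using i by (intro dJ_\<phi>_tendsto z v lim) auto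
    moreover have "(\<lambda>n. dJ (z (r n)) (\<phi> i)) \<longlonglongrightarrow> 0"
    proof (rule Lim_null_comparison)
      show "(\<lambda>n. P / t (r n)) \<longlonglongrightarrow> 0" by (rule real_tendsto_divide_at_top[OF tendsto_const tr])
      have "\<bar>dJ (z n) (\<phi> i)\<bar> \<le> P / t n" for n
      proof -
        have "dJ (z n) (\<phi> i) = 1 / t n * dJ (w n) (\<phi> i)" unfolding z_def using t[of n] by (intro dJ_scale) simp
        then show ?thesis using dJw[OF i, of n] t[of n] by (simp add: divide_right_mono)
      qed
      then show "\<forall>\<^sub>F n in sequentially. norm (dJ (z (r n)) (\<phi> i)) \<le> P / t (r n)" by simp
    qed
    ultimately show ?thesis by (rule LIMSEQ_unique)
  qed
  ultimately have crit: "dJ v u = 0" if "u \<in> V" for u using critical_point[OF v] that by blast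
  have "nrm v = 1"
  proof -
    have "\<bar>1 - nrm v\<bar> \<le> nrm (\<lambda>x. z (r n) x - v x)" for n
      using l2norm_diff_ineq[OF V_sqint[OF z] V_sqint[OF v], of "r n"] by (simp add: nz)
    then have "\<bar>1 - nrm v\<bar> \<le> 0" by (intro LIMSEQ_le_const[OF lim]) auto
    then show ?thesis by simp
  qed
  with v crit have "nontrivial_fucik_eigenfunction K \<Omega> \<alpha> \<beta> v" by (intro fucik_eigenfunctionI)
  moreover have "(\<lambda>j. nrm (\<lambda>x. w (r j) x / nrm (w (r j)) - v x)) \<longlonglongrightarrow> 0"
    using lim by (simp add: z_def t_def)
  ultimately have "filterlim (\<lambda>j. pert (w (r j))) at_bot sequentially"
    unfolding pert_def using w tr by (intro landesman_lazer) (auto simp: t_def)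
  then have "\<forall>\<^sub>F j in sequentially. pert (w (r j)) < - C - (\<Sum>i=1..k. P\<^sup>2) / (4 * \<kappa>)"
    by (simp add: filterlim_at_bot_dense)
  \<comment> \<open>Below this level of \<open>pert\<close>, \<open>J_lower\<close> forces \<Phi>
    above C.\<close>
  then obtain j where j: "pert (w (r j)) < - C - (\<Sum>i=1..k. P\<^sup>2) / (4 * \<kappa>)"
    by (auto simp: eventually_sequentially)
  have "(\<Sum>i=1..k. (dJ (w (r j)) (\<phi> i))\<^sup>2) \<le> (\<Sum>i=1..k. P\<^sup>2)"
  proof (rule sum_mono)
    fix i assume "i \<in> {1..k}"
    then have "\<bar>dJ (w (r j)) (\<phi> i)\<bar>\<^sup>2 \<le> P\<^sup>2" by (intro power_mono dJw) auto
    then show "(dJ (w (r j)) (\<phi> i))\<^sup>2 \<le> P\<^sup>2" by simp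
  qed
  then have "(\<Sum>i=1..k. (dJ (w (r j)) (\<phi> i))\<^sup>2) / (4 * \<kappa>) \<le> (\<Sum>i=1..k. P\<^sup>2) / (4 * \<kappa>)"
    using \<kappa>_pos by (intro divide_right_mono) auto
  with J_lower[OF w, of "r j"] \<Phi>w[of "r j"] j show False by (simp add: \<Phi>_def)
qed

section \<open>Expansion of the perturbed functional\<close>

lemma pert_diff_le:
  assumes a: "sqint M a" and b: "sqint M b"
  shows "\<bar>pert a - pert b\<bar> \<le> 3 * H * nrm (\<lambda>x. a x - b x)"
proof -
  let ?z = "\<lambda>x. a x - b x"
  have z: "sqint M ?z" by (intro sqint_diff a b)
  note int = sqint_imp_integrable[OF finite_measure_axioms sqint_F[OF a]]
    sqint_imp_integrable[OF finite_measure_axioms sqint_F[OF b]] sqint_integrable_mult[OF h a] sqint_integrable_mult[OF h b]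
    sqint_integrable_mult[OF f_sqint[OF b] z]
  have eq: "pert a - pert b = (\<integral>x. F (b x + ?z x) - F (b x) - f (b x) * ?z x \<partial>M) + ip (\<lambda>x. f (b x)) ?z + ip h ?z"
  proof -
    have "(\<integral>x. F (b x + ?z x) - F (b x) - f (b x) * ?z x \<partial>M)
        = (\<integral>x. F (a x) - F (b x) - f (b x) * ?z x \<partial>M)"
      by (intro Bochner_Integration.integral_cong) simp_all
    also have "\<dots> = (\<integral>x. F (a x) - F (b x) \<partial>M) - (\<integral>x. f (b x) * ?z x \<partial>M)"
      by (rule Bochner_Integration.integral_diff[OF Bochner_Integration.integrable_diff[OF int(1,2)] int(5)])
    also have "\<dots> = (\<integral>x. F (a x) \<partial>M) - (\<integral>x. F (b x) \<partial>M) - ip (\<lambda>x. f (b x)) ?z"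
      unfolding ip_eq Bochner_Integration.integral_diff[OF int(1,2)] ..
    finally have "(\<integral>x. F (b x + ?z x) - F (b x) - f (b x) * ?z x \<partial>M)
        = (\<integral>x. F (a x) \<partial>M) - (\<integral>x. F (b x) \<partial>M) - ip (\<lambda>x. f (b x)) ?z" .
    moreover have "pert a = (\<integral>x. F (a x) \<partial>M) + ip h a" "pert b = (\<integral>x. F (b x) \<partial>M) + ip h b"
      using int(1-4) by (simp_all add: pert_def ip_eq)
    ultimately show ?thesis using ip_diff_right[OF a b h] by linarith
  qed
  \<comment> \<open>The contributions of the Taylor remainder of F, of its linear part and of h;
    \<open>3 * H\<close> is a common majorant.\<close>
  have "\<bar>pert a - pert b\<bar> \<le> 2 * B * nrm (\<lambda>x. 1) * nrm ?z + B * nrm (\<lambda>x. 1) * nrm ?z + nrm h * nrm ?z"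
  proof -
    have "\<bar>ip (\<lambda>x. f (b x)) ?z\<bar> \<le> nrm (\<lambda>x. f (b x)) * nrm ?z" by (intro ip_Cauchy_Schwarz f_sqint b z)
    also have "\<dots> \<le> B * nrm (\<lambda>x. 1) * nrm ?z" by (intro mult_right_mono nrm_f_le b) simp
    finally show ?thesis
      using F_remainder_le[OF finite_measure_axioms b z] ip_Cauchy_Schwarz[OF h z] eq by linarith
  qed
  also have "\<dots> \<le> 3 * H * nrm ?z"
  proof -
    have arith: "2 * B * p * z + B * p * z + q * z \<le> 3 * (B * p + q) * z" if "0 \<le> q * z" for p q z :: real
    proof -
      have "3 * (B * p + q) * z = 2 * B * p * z + B * p * z + q * z + 2 * (q * z)" by (simp add: algebra_simps)
      with that show ?thesis by linarith
    qed
    show ?thesis unfolding H_def by (rule arith) simp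
  qed
  finally show ?thesis .
qed

text \<open>The remainder of F is kept as an integral so that it can be estimated finely on bounded
  sets and crudely elsewhere; the negative quadratic term of \<open>J_upper\<close> is
  dropped.\<close>

lemma \<Phi>_expand:
  assumes w: "w \<in> V" and \<xi>: "\<xi> \<in> V"
  shows "\<Phi> (\<lambda>x. w x + \<xi> x) \<le> \<Phi> w + d\<Phi> w \<xi> + 1 / 2 * E \<xi> \<xi>
    + \<bar>\<integral>x. F (w x + \<xi> x) - F (w x) - f (w x) * \<xi> x \<partial>M\<bar>"
proof -
  note sq = V_sqint[OF w] V_sqint[OF \<xi>] V_sqint[OF V_add[OF w \<xi>]]
  note int = sqint_imp_integrable[OF finite_measure_axioms sqint_F[OF sq(1)]]
    sqint_imp_integrable[OF finite_measure_axioms sqint_F[OF sq(3)]] sqint_integrable_mult[OF h sq(1)] sqint_integrable_mult[OF h sq(2)]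
    sqint_integrable_mult[OF f_sqint[OF sq(1)] sq(2)]
  have "pert (\<lambda>x. w x + \<xi> x) - pert w = (\<integral>x. F (w x + \<xi> x) - F (w x) - f (w x) * \<xi> x \<partial>M) + ip (\<lambda>x. f (w x)) \<xi> + ip h \<xi>"
  proof -
    have "(\<integral>x. F (w x + \<xi> x) - F (w x) - f (w x) * \<xi> x \<partial>M)
        = (\<integral>x. F (w x + \<xi> x) \<partial>M) - (\<integral>x. F (w x) \<partial>M) - ip (\<lambda>x. f (w x)) \<xi>"
      using int(1,2,5) by (simp add: ip_eq)
    moreover have "pert (\<lambda>x. w x + \<xi> x) = (\<integral>x. F (w x + \<xi> x) \<partial>M) + ip h (\<lambda>x. w x + \<xi> x)"
      unfolding pert_def ip_eq by (rule Bochner_Integration.integral_add[OF int(2) sqint_integrable_mult[OF h sq(3)]])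
    moreover have "pert w = (\<integral>x. F (w x) \<partial>M) + ip h w"
      unfolding pert_def ip_eq by (rule Bochner_Integration.integral_add[OF int(1,3)])
    ultimately show ?thesis using ip_add_right[OF sq(1,2) h] by linarith
  qed
  moreover have "0 \<le> 1 / 2 * \<alpha> * (nrm \<xi>)\<^sup>2" using \<alpha>_pos by simp
  ultimately show ?thesis
    using J_upper[OF w \<xi>] unfolding \<Phi>_def d\<Phi>_def by linarith
qed

lemma d\<Phi>_lc: "w \<in> V \<Longrightarrow> d\<Phi> w (lc N c) = (\<Sum>i=1..N. c i * d\<Phi> w (\<phi> i))"
proof -
  assume w: "w \<in> V"
  have "d\<Phi> w (lc N c) = (\<Sum>i=1..N. c i * dJ w (\<phi> i)) - (\<Sum>i=1..N. c i * ip (\<lambda>x. f (w x)) (\<phi> i))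
      - (\<Sum>i=1..N. c i * ip h (\<phi> i))"
    unfolding d\<Phi>_def dJ_lc[OF w] ip_lc[OF f_sqint[OF V_sqint[OF w]]] ip_lc[OF h] ..
  also have "\<dots> = (\<Sum>i=1..N. c i * d\<Phi> w (\<phi> i))"
    unfolding d\<Phi>_def right_diff_distrib sum_subtractf ..
  finally show ?thesis .
qed

lemma d\<Phi>_\<phi>_tendsto:
  assumes i: "1 \<le> i" and a: "\<And>n. a n \<in> V" and a': "a' \<in> V" and la: "(\<lambda>n. nrm (\<lambda>x. a n x - a' x)) \<longlonglongrightarrow> 0"
  shows "(\<lambda>n. d\<Phi> (a n) (\<phi> i)) \<longlonglongrightarrow> d\<Phi> a' (\<phi> i)"
proof -
  have "(\<lambda>n. ip (\<lambda>x. f (a n x)) (\<phi> i)) \<longlonglongrightarrow> ip (\<lambda>x. f (a' x)) (\<phi> i)"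
    unfolding ip_eq by (intro f_integral_continuous finite_measure_axioms V_sqint a a' \<phi>_V i la)
  then show ?thesis
    unfolding d\<Phi>_def by (intro tendsto_intros dJ_\<phi>_tendsto i a a' la)
qed

section \<open>Continuity in Galerkin coordinates\<close>

lemma lc_tendsto:
  assumes "\<And>i. (\<lambda>n. u n i) \<longlonglongrightarrow> c i"
  shows "(\<lambda>n. nrm (\<lambda>x. lc N (u n) x - lc N c x)) \<longlonglongrightarrow> 0"
proof -
  have "(\<lambda>n. sqrt (\<Sum>i=1..N. (u n i - c i)\<^sup>2)) \<longlonglongrightarrow> sqrt (\<Sum>i=1..N. (c i - c i)\<^sup>2)"
    by (intro tendsto_intros assms)
  moreover have "nrm (\<lambda>x. lc N (u n) x - lc N c x) = sqrt (\<Sum>i=1..N. (u n i - c i)\<^sup>2)" for n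
    using nrm_lc[of N "\<lambda>i. u n i - c i"] l2norm_nonneg[of M "\<lambda>x. lc N (u n) x - lc N c x"]
    unfolding lc_diff by (simp add: real_sqrt_unique)
  ultimately show ?thesis by simp
qed

lemma continuous_d\<Phi>_lc: "1 \<le> i \<Longrightarrow> continuous_on UNIV (\<lambda>c. d\<Phi> (lc N c) (\<phi> i))"
  by (rule continuous_on_coordinates) (rule d\<Phi>_\<phi>_tendsto[where a = "\<lambda>n. lc N (_ n)", OF _ lc_V lc_V lc_tendsto])

lemma continuous_dJ_lc: "1 \<le> i \<Longrightarrow> continuous_on UNIV (\<lambda>c. dJ (lc N c) (\<phi> i))"
  by (rule continuous_on_coordinates) (rule dJ_\<phi>_tendsto[where a = "\<lambda>n. lc N (_ n)", OF _ lc_V lc_V lc_tendsto])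

lemma continuous_\<Phi>_lc: "continuous_on UNIV (\<lambda>c. \<Phi> (lc N c))"
proof (rule continuous_on_coordinates)
  fix u :: "nat \<Rightarrow> nat \<Rightarrow> real" and c
  assume u: "\<And>i. (\<lambda>n. u n i) \<longlonglongrightarrow> c i"
  note l = lc_tendsto[OF u, of N]
  have "(\<lambda>n. pert (lc N (u n)) - pert (lc N c)) \<longlonglongrightarrow> 0"
  proof (rule Lim_null_comparison)
    show "\<forall>\<^sub>F n in sequentially. norm (pert (lc N (u n)) - pert (lc N c)) \<le> 3 * H * nrm (\<lambda>x. lc N (u n) x - lc N c x)"
      by (simp add: pert_diff_le lc_sqint)
    show "(\<lambda>n. 3 * H * nrm (\<lambda>x. lc N (u n) x - lc N c x)) \<longlonglongrightarrow> 0"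
      using tendsto_mult_left[OF l, of "3 * H"] by simp
  qed
  then have p: "(\<lambda>n. pert (lc N (u n))) \<longlonglongrightarrow> pert (lc N c)" by (simp add: LIM_zero_iff)
  have gl: "(\<lambda>n. ip (\<lambda>x. g (lc N (u n) x)) (lc N (u n))) \<longlonglongrightarrow> ip (\<lambda>x. g (lc N c x)) (lc N c)"
    by (rule ip_tendsto[where a = "\<lambda>n x. g (lc N (u n) x)" and b = "\<lambda>n. lc N (u n)", OF _ _ _ _ g_tendsto[where a = "\<lambda>n. lc N (u n)"]])
      (simp_all add: g_sqint lc_sqint l)
  have "(\<lambda>n. 1 / 2 * ((\<Sum>j=1..N. ev j * (u n j)\<^sup>2) - ip (\<lambda>x. g (lc N (u n) x)) (lc N (u n))))
    \<longlonglongrightarrow> 1 / 2 * ((\<Sum>j=1..N. ev j * (c j)\<^sup>2) - ip (\<lambda>x. g (lc N c x)) (lc N c))"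
    by (intro tendsto_mult_left tendsto_diff tendsto_sum tendsto_power u gl)
  then have "(\<lambda>n. J (lc N (u n))) \<longlonglongrightarrow> J (lc N c)"
    by (simp add: J_eq[OF lc_sqint] E_lc_lc)
  then show "(\<lambda>n. \<Phi> (lc N (u n))) \<longlonglongrightarrow> \<Phi> (lc N c)"
    unfolding \<Phi>_def using p by (rule tendsto_diff)
qed

section \<open>Linking geometry\<close>

text \<open>By \<open>sublevel_bounded\<close> with \<open>P = 0\<close>, the part of this set where
  \<Phi> is nonpositive is bounded in L2; there J is nonnegative by \<open>J_lower\<close> and
  \<open>pert\<close> is bounded by its linear growth.\<close>

lemma \<Phi>_bounded_below_on_critical:
  "\<exists>c0. \<forall>w\<in>V. (\<forall>i\<in>{1..k}. dJ w (\<phi> i) = 0) \<longrightarrow> c0 \<le> \<Phi> w"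
proof -
  obtain R where R: "R \<ge> 0" "\<And>w. w \<in> V \<Longrightarrow> \<Phi> w \<le> 0 \<Longrightarrow> (\<forall>i\<in>{1..k}. \<bar>dJ w (\<phi> i)\<bar> \<le> 0) \<Longrightarrow> nrm w \<le> R"
    using sublevel_bounded[of 0 0] by blast
  have "- (H * R) \<le> \<Phi> w" if w: "w \<in> V" and 0: "\<forall>i\<in>{1..k}. dJ w (\<phi> i) = 0" for w
  proof (cases "\<Phi> w \<le> 0")
    case True
    then have "nrm w \<le> R" using R(2)[OF w] 0 by simp
    then have "H * nrm w \<le> H * R" using H_nonneg by (rule mult_left_mono)
    moreover have "0 \<le> J w" using J_lower[OF w] 0 by simp
    ultimately show ?thesis using pert_le[OF V_sqint[OF w]] by (simp add: \<Phi>_def)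
  next
    case False
    moreover have "0 \<le> H * R" using H_nonneg R by simp
    ultimately show ?thesis by linarith
  qed
  then show ?thesis by blast
qed

text \<open>This is \<open>J_upper\<close> at the origin, where J and \<open>dJ\<close>
  vanish.\<close>

lemma J_X1_le: "J (lc k c) \<le> - \<kappa> * (nrm (lc k c))\<^sup>2"
proof -
  have "J (\<lambda>x. (0::real) + lc k c x) \<le> J (\<lambda>x. 0) + dJ (\<lambda>x. 0) (lc k c) + 1 / 2 * E (lc k c) (lc k c) - 1 / 2 * \<alpha> * (nrm (lc k c))\<^sup>2"
    by (rule J_upper[OF V_zero lc_V])
  moreover have "J (\<lambda>x. 0) = 0" using J_scale[of 0, OF _ V_zero] by simp
  moreover have "dJ (\<lambda>x. 0) (lc k c) = 0" using dJ_scale[of 0 "\<lambda>x. 0" "lc k c"] by simp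
  moreover have "E (lc k c) (lc k c) \<le> ev k * (nrm (lc k c))\<^sup>2"
    unfolding E_lc_lc nrm_lc sum_distrib_left by (intro sum_mono mult_right_mono ev_mono) auto
  ultimately show ?thesis by (simp add: \<kappa>_def field_simps)
qed

text \<open>The maximum of \<open>H * t - \<kappa> * t\<^sup>2\<close> over t, and so an upper bound
  for \<Phi> on X_1.\<close>

definition C1 :: real where "C1 = H\<^sup>2 / (4 * \<kappa>)"

lemma \<Phi>_X1_le: "\<Phi> (lc k c) \<le> H * nrm (lc k c) - \<kappa> * (nrm (lc k c))\<^sup>2"
  using J_X1_le[of c] pert_le[OF lc_sqint, of k c] by (simp add: \<Phi>_def)

lemma \<Phi>_X1_le_C1: "\<Phi> (lc k c) \<le> C1"
  using \<Phi>_X1_le[of c] square_completion[OF \<kappa>_pos, of "nrm (lc k c)" H] by (simp add: C1_def mult.commute)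

lemma lc_extend:
  assumes "k \<le> N" "\<And>i. i \<notin> {1..k} \<Longrightarrow> c i = 0"
  shows "lc N c = lc k c"
proof
  fix x show "lc N c x = lc k c x"
    unfolding lc_def by (rule sum.mono_neutral_right) (use assms in auto)
qed

text \<open>One explicit Euler step along the negative Galerkin gradient replaces the gradient flow: far out
  the gradient dominates the oscillation of \<open>f\<close>, and on bounded sets \<open>f\<close> is uniformly continuous in
  \<open>L\<^sup>2\<close>.\<close>

definition grad_norm :: "nat \<Rightarrow> (nat \<Rightarrow> real) \<Rightarrow> real" where
  "grad_norm N c = sqrt (\<Sum>i=1..N. (d\<Phi> (lc N c) (\<phi> i))\<^sup>2)"

lemma Euler_step:
  assumes N: "k \<le> N" and \<epsilon>: "0 < \<epsilon>"
    and large: "\<And>c. \<Phi> (lc N c) \<le> C1 \<Longrightarrow> \<epsilon> \<le> grad_norm N c"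
  shows "\<exists>\<tau> d. 0 < d \<and> (\<forall>c \<sigma>. \<Phi> (lc N c) \<le> C1 \<longrightarrow> 0 \<le> \<sigma> \<longrightarrow> \<sigma> \<le> 1 \<longrightarrow>
       \<Phi> (lc N (\<lambda>i. c i - \<sigma> * \<tau> / (1 + grad_norm N c) * d\<Phi> (lc N c) (\<phi> i))) \<le> \<Phi> (lc N c) - \<sigma> * d)"
proof -
  let ?q = "grad_norm N"
  define C2 where "C2 = 2 * B * nrm (\<lambda>x. 1)"
  have C2: "0 \<le> C2" using B_nonneg by (simp add: C2_def)
  \<comment> \<open>Outside the radius R that belongs to this threshold some component of
    \<open>dJ\<close> on X_1 exceeds it, so some component of \<open>d\<Phi>\<close> exceeds
    \<open>4 * C2\<close>, and the crude remainder constant C2 is at most a quarter of the gradient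
    norm.\<close>
  have "0 \<le> 4 * C2 + H" using C2 H_nonneg by simp
  from sublevel_bounded[OF this, of C1] obtain R where R: "R \<ge> 0"
    "\<And>w. w \<in> V \<Longrightarrow> \<Phi> w \<le> C1 \<Longrightarrow> (\<forall>i\<in>{1..k}. \<bar>dJ w (\<phi> i)\<bar> \<le> 4 * C2 + H) \<Longrightarrow> nrm w \<le> R" by blast
  obtain \<delta> where \<delta>: "\<delta> > 0"
    "\<And>w \<xi>. \<lbrakk>sqint M w; sqint M \<xi>; nrm w \<le> R; nrm \<xi> \<le> \<delta>\<rbrakk>
       \<Longrightarrow> \<bar>\<integral>x. F (w x + \<xi> x) - F (w x) - f (w x) * \<xi> x \<partial>M\<bar> \<le> \<epsilon> / 4 * nrm \<xi>"
    using F_remainder_small[OF finite_measure_axioms R(1), of "\<epsilon> / 4"] \<epsilon> by auto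
  have evN: "0 < ev N" using N k by (intro ev_pos) auto
  \<comment> \<open>\<delta> keeps the increment within reach of the fine remainder estimate;
    \<open>1 / (2 * ev N)\<close> bounds the energy of the increment by half of
    \<open>s * Q\<^sup>2\<close>.\<close>
  define \<tau> where "\<tau> = min \<delta> (1 / (2 * ev N))"
  have \<tau>: "0 < \<tau>" "\<tau> \<le> \<delta>" "ev N * \<tau> \<le> 1 / 2"
  proof -
    have "ev N * \<tau> \<le> ev N * (1 / (2 * ev N))" unfolding \<tau>_def using evN by (intro mult_left_mono) auto
    then show "ev N * \<tau> \<le> 1 / 2" using evN by simp
  qed (use \<delta> evN in \<open>auto simp: \<tau>_def\<close>)
  \<comment> \<open>The guaranteed decrease for a full step at gradient norm \<epsilon>; larger
    gradients do at least as well, since \<open>Q\<^sup>2 / (1 + Q)\<close> increases with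
    Q.\<close>
  define d where "d = \<tau> * (\<epsilon>\<^sup>2 / (1 + \<epsilon>)) / 2"
  have d: "d > 0" using \<tau> \<epsilon> by (simp add: d_def)
  have "\<Phi> (lc N (\<lambda>i. c i - \<sigma> * \<tau> / (1 + ?q c) * d\<Phi> (lc N c) (\<phi> i))) \<le> \<Phi> (lc N c) - \<sigma> * d"
    if \<Phi>: "\<Phi> (lc N c) \<le> C1" and \<sigma>: "0 \<le> \<sigma>" "\<sigma> \<le> 1" for c \<sigma>
  proof -
    define p where "p i = d\<Phi> (lc N c) (\<phi> i)" for i
    define Q where "Q = ?q c"
    have Q\<epsilon>: "\<epsilon> \<le> Q" using large[OF \<Phi>] by (simp add: Q_def)
    then have Q: "0 < Q" using \<epsilon> by simp
    have Q2: "Q\<^sup>2 = (\<Sum>i=1..N. (p i)\<^sup>2)" by (simp add: Q_def grad_norm_def p_def sum_nonneg)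
    \<comment> \<open>Dividing by \<open>1 + Q\<close> bounds the step length \<open>s * Q\<close>
      by \<tau>; unlike division by Q it leaves the step map continuous everywhere.\<close>
    define s where "s = \<sigma> * \<tau> / (1 + Q)"
    have s: "0 \<le> s" using \<sigma> \<tau> Q by (simp add: s_def)
    have s\<tau>: "s \<le> \<tau>" "s * Q \<le> \<tau>"
    proof -
      have "\<sigma> * \<tau> \<le> 1 * \<tau>" using \<sigma> \<tau> by (intro mult_right_mono) auto
      then have st: "\<sigma> * \<tau> \<le> \<tau>" by simp
      have "s \<le> \<tau> / (1 + Q)" unfolding s_def using st Q by (intro divide_right_mono) auto
      also have "\<dots> \<le> \<tau>" using \<tau> Q by (simp add: field_simps)
      finally show "s \<le> \<tau>" .
      have "s * Q \<le> \<tau> / (1 + Q) * Q" unfolding s_def using st Q by (intro mult_right_mono divide_right_mono) auto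
      also have "\<dots> \<le> \<tau>" using \<tau> Q by (simp add: field_simps)
      finally show "s * Q \<le> \<tau>" .
    qed
    define \<xi> where "\<xi> = lc N (\<lambda>i. - s * p i)"
    have \<xi>: "\<xi> \<in> V" by (simp add: \<xi>_def lc_V)
    have "(nrm \<xi>)\<^sup>2 = (s * Q)\<^sup>2"
      unfolding \<xi>_def nrm_lc by (simp add: power_mult_distrib Q2 sum_distrib_left)
    then have n\<xi>: "nrm \<xi> = s * Q" using s Q by (simp add: power2_eq_iff_nonneg)
    have E\<xi>: "E \<xi> \<xi> \<le> ev N * (s\<^sup>2 * Q\<^sup>2)"
    proof -
      have "E \<xi> \<xi> \<le> (\<Sum>i=1..N. ev N * (- s * p i)\<^sup>2)"
        unfolding \<xi>_def E_lc_lc by (intro sum_mono mult_right_mono ev_mono) auto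
      also have "\<dots> = ev N * (s\<^sup>2 * Q\<^sup>2)" by (simp add: power_mult_distrib Q2 sum_distrib_left)
      finally show ?thesis .
    qed
    have d\<xi>: "d\<Phi> (lc N c) \<xi> = - s * Q\<^sup>2"
      unfolding \<xi>_def d\<Phi>_lc[OF lc_V] Q2 sum_distrib_left by (rule sum.cong) (auto simp: p_def power2_eq_square)
    let ?rem = "\<bar>\<integral>x. F (lc N c x + \<xi> x) - F (lc N c x) - f (lc N c x) * \<xi> x \<partial>M\<bar>"
    have rem: "?rem \<le> Q / 4 * (s * Q)"
    proof (cases "nrm (lc N c) \<le> R")
      case True
      have "?rem \<le> \<epsilon> / 4 * nrm \<xi>"
        using True s\<tau> \<tau> by (intro \<delta>(2) lc_sqint V_sqint \<xi>) (auto simp: n\<xi>)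
      also have "\<dots> \<le> Q / 4 * (s * Q)" unfolding n\<xi> using Q\<epsilon> s Q by (intro mult_right_mono) auto
      finally show ?thesis .
    next
      case False
      then obtain i where i: "i \<in> {1..k}" "4 * C2 + H < \<bar>dJ (lc N c) (\<phi> i)\<bar>"
        using R(2)[OF lc_V \<Phi>] by force
      then have "4 * C2 < \<bar>p i\<bar>" using d\<Phi>_dJ[OF _ lc_V, of i N c] by (auto simp: p_def)
      also have "\<bar>p i\<bar> \<le> Q"
      proof -
        have "(p i)\<^sup>2 \<le> Q\<^sup>2" unfolding Q2 using i N by (intro member_le_sum) auto
        then show ?thesis using Q by (simp add: abs_le_square_iff[symmetric])
      qed
      finally have "C2 \<le> Q / 4" by simp
      have "?rem \<le> C2 * nrm \<xi>"
        unfolding C2_def by (rule F_remainder_le[OF finite_measure_axioms lc_sqint V_sqint[OF \<xi>]])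
      also have "\<dots> \<le> Q / 4 * (s * Q)" unfolding n\<xi> using \<open>C2 \<le> Q / 4\<close> s Q by (intro mult_right_mono) auto
      finally show ?thesis .
    qed
    have "ev N * (s\<^sup>2 * Q\<^sup>2) \<le> 1 / 2 * (s * Q\<^sup>2)"
    proof -
      have "ev N * s \<le> ev N * \<tau>" using s\<tau> evN by (intro mult_left_mono) auto
      then have "ev N * s * (s * Q\<^sup>2) \<le> 1 / 2 * (s * Q\<^sup>2)" using \<tau> s by (intro mult_right_mono) auto
      then show ?thesis by (simp add: power2_eq_square mult_ac)
    qed
    moreover have "?rem \<le> 1 / 4 * (s * Q\<^sup>2)" using rem by (simp add: power2_eq_square mult_ac)
    \<comment> \<open>Of the first order gain \<open>s * Q\<^sup>2\<close>, half the energy takes a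
      quarter and the remainder another quarter.\<close>
    ultimately have "\<Phi> (\<lambda>x. lc N c x + \<xi> x) \<le> \<Phi> (lc N c) - s * Q\<^sup>2 / 2"
      using \<Phi>_expand[OF lc_V \<xi>, of N c] E\<xi> unfolding d\<xi> by linarith
    moreover have "\<sigma> * d \<le> s * Q\<^sup>2 / 2"
    proof -
      have "\<epsilon>\<^sup>2 / (1 + \<epsilon>) \<le> Q\<^sup>2 / (1 + Q)"
      proof -
        have "\<epsilon> * \<epsilon> \<le> Q * Q" "\<epsilon> * Q * \<epsilon> \<le> \<epsilon> * Q * Q"
          using Q\<epsilon> \<epsilon> Q by (intro mult_mono mult_left_mono; simp)+
        then have "\<epsilon>\<^sup>2 * (1 + Q) \<le> Q\<^sup>2 * (1 + \<epsilon>)" by (simp only: power2_eq_square distrib_left mult_ac)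
        then show ?thesis using Q \<epsilon> by (simp only: pos_divide_le_eq times_divide_eq_left pos_le_divide_eq add_pos_pos zero_less_one)
      qed
      then have "\<sigma> * \<tau> * (\<epsilon>\<^sup>2 / (1 + \<epsilon>)) \<le> \<sigma> * \<tau> * (Q\<^sup>2 / (1 + Q))" using \<sigma> \<tau> by (intro mult_left_mono) auto
      moreover have e1: "\<sigma> * d = \<sigma> * \<tau> * (\<epsilon>\<^sup>2 / (1 + \<epsilon>)) / 2" by (simp add: d_def)
      moreover have e2: "s * Q\<^sup>2 / 2 = \<sigma> * \<tau> * (Q\<^sup>2 / (1 + Q)) / 2" by (simp add: s_def)
      ultimately show ?thesis unfolding e1 e2 by (intro divide_right_mono) simp_all
    qed
    moreover have "(\<lambda>x. lc N c x + \<xi> x) = lc N (\<lambda>i. c i - s * p i)"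
      unfolding \<xi>_def lc_add[symmetric] by simp
    ultimately show ?thesis by (simp add: s_def p_def Q_def)
  qed
  with d show ?thesis by blast
qed

text \<open>The cut-off step map \<eta> moves nothing where \<open>\<Phi> \<le> c0 - 1\<close>, in
  particular on a large sphere of X_1, while enough iterations bring the whole ball below c0. On the
  sphere \<open>- dJ\<close> points outward, so after the deformation its k components vanish for
  some point of the ball; but there \<Phi> is at least c0 by
  \<open>\<Phi>_bounded_below_on_critical\<close>.\<close>

lemma Galerkin_almost_critical:
  assumes N: "k \<le> N" and \<epsilon>: "0 < \<epsilon>"
  shows "\<exists>c. \<Phi> (lc N c) \<le> C1 \<and> (\<forall>i\<in>{1..N}. \<bar>d\<Phi> (lc N c) (\<phi> i)\<bar> \<le> \<epsilon>)"
proof (rule ccontr)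
  assume no: "\<not> ?thesis"
  let ?q = "grad_norm N"
  have large: "\<epsilon> \<le> ?q c" if "\<Phi> (lc N c) \<le> C1" for c
  proof -
    have "\<exists>i\<in>{1..N}. \<epsilon> < \<bar>d\<Phi> (lc N c) (\<phi> i)\<bar>" using no that by (meson not_le)
    then obtain i where i: "i \<in> {1..N}" "\<epsilon> < \<bar>d\<Phi> (lc N c) (\<phi> i)\<bar>" by blast
    have "(d\<Phi> (lc N c) (\<phi> i))\<^sup>2 \<le> (\<Sum>i=1..N. (d\<Phi> (lc N c) (\<phi> i))\<^sup>2)" using i by (intro member_le_sum) auto
    then have "sqrt ((d\<Phi> (lc N c) (\<phi> i))\<^sup>2) \<le> ?q c" unfolding grad_norm_def by (rule real_sqrt_le_mono)
    with i show ?thesis by simp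
  qed
  obtain \<tau> d where d: "0 < d" and step:
    "\<And>c \<sigma>. \<lbrakk>\<Phi> (lc N c) \<le> C1; 0 \<le> \<sigma>; \<sigma> \<le> 1\<rbrakk> \<Longrightarrow>
       \<Phi> (lc N (\<lambda>i. c i - \<sigma> * \<tau> / (1 + ?q c) * d\<Phi> (lc N c) (\<phi> i))) \<le> \<Phi> (lc N c) - \<sigma> * d"
    using Euler_step[OF N \<epsilon> large] by blast
  obtain c0 where c0: "\<And>w. w \<in> V \<Longrightarrow> (\<forall>i\<in>{1..k}. dJ w (\<phi> i) = 0) \<Longrightarrow> c0 \<le> \<Phi> w"
    using \<Phi>_bounded_below_on_critical by blast
  \<comment> \<open>Full step at levels from \<open>c0 - 1 / 2\<close> on, no step up to
    \<open>c0 - 1\<close>, continuous in between.\<close>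
  define \<theta> where "\<theta> c = min 1 (max 0 (2 * (\<Phi> (lc N c) - (c0 - 1))))" for c
  \<comment> \<open>Coordinates outside \<open>{1..N}\<close> do not enter \<open>lc N\<close>. They
    are left alone because continuity is required in every coordinate and nothing is known of
    \<open>\<phi> 0\<close>.\<close>
  define \<eta> where "\<eta> c i = (if i \<in> {1..N} then c i - \<theta> c * \<tau> / (1 + ?q c) * d\<Phi> (lc N c) (\<phi> i) else c i)" for c i
  have lc_\<eta>: "lc N (\<eta> c) = lc N (\<lambda>i. c i - \<theta> c * \<tau> / (1 + ?q c) * d\<Phi> (lc N c) (\<phi> i))" for c
    unfolding lc_def \<eta>_def by (intro ext sum.cong) auto
  have \<eta>_step: "\<Phi> (lc N (\<eta> c)) \<le> \<Phi> (lc N c) - \<theta> c * d" if "\<Phi> (lc N c) \<le> C1" for c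
    unfolding lc_\<eta> by (rule step[OF that]) (auto simp: \<theta>_def)
  have \<theta>: "0 \<le> \<theta> c" for c by (simp add: \<theta>_def)
  have iter: "\<Phi> (lc N ((\<eta> ^^ m) c)) \<le> C1 \<and> \<Phi> (lc N ((\<eta> ^^ m) c)) \<le> max (c0 - 1 / 2) (C1 - real m * d)"
    if c: "\<Phi> (lc N c) \<le> C1" for m c
  proof (induction m)
    case 0
    then show ?case using c by simp
  next
    case (Suc m)
    let ?u = "(\<eta> ^^ m) c"
    have "\<Phi> (lc N (\<eta> ?u)) \<le> \<Phi> (lc N ?u) - \<theta> ?u * d" using Suc by (intro \<eta>_step) simp
    moreover have "0 \<le> \<theta> ?u * d" using \<theta> d by simp
    moreover have "\<theta> ?u = 1" if "\<not> \<Phi> (lc N ?u) \<le> c0 - 1 / 2" using that by (simp add: \<theta>_def)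
    ultimately show ?case using Suc
      by (cases "\<Phi> (lc N ?u) \<le> c0 - 1 / 2") (auto simp: algebra_simps)
  qed
  obtain m where "C1 - (c0 - 1 / 2) < real m * d" using reals_Archimedean3[OF d] by blast
  then have m: "C1 - real m * d \<le> c0 - 1 / 2" by linarith
  have \<eta>_cont: "continuous_on UNIV \<eta>"
  proof (rule continuous_on_coordinatewise_then_product)
    fix i
    have q_cont: "continuous_on UNIV ?q"
      unfolding grad_norm_def[abs_def] by (intro continuous_intros continuous_d\<Phi>_lc) auto
    have \<theta>_cont: "continuous_on UNIV \<theta>"
      unfolding \<theta>_def by (intro continuous_intros continuous_\<Phi>_lc)
    have q0: "1 + ?q c \<noteq> 0" for c
    proof -
      have "0 \<le> ?q c" by (simp add: grad_norm_def sum_nonneg)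
      then show ?thesis by linarith
    qed
    have proj: "continuous_on UNIV (\<lambda>c :: nat \<Rightarrow> real. c i)" by simp
    show "continuous_on UNIV (\<lambda>c. \<eta> c i)"
    proof (cases "i \<in> {1..N}")
      case True
      then have "continuous_on UNIV (\<lambda>c. d\<Phi> (lc N c) (\<phi> i))" by (intro continuous_d\<Phi>_lc) auto
      with True show ?thesis
        unfolding \<eta>_def using q0 by (auto intro!: continuous_intros \<theta>_cont q_cont proj)
    next
      case False
      then show ?thesis unfolding \<eta>_def by auto
    qed
  qed
  have \<eta>m_cont: "continuous_on UNIV (\<eta> ^^ m)" for m
  proof (induction m)
    case (Suc m)
    show ?case unfolding funpow.simps
      by (rule continuous_on_compose[OF Suc continuous_on_subset[OF \<eta>_cont]]) auto
  qed (simp add: id_def)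
  have \<eta>_fix: "(\<eta> ^^ m) c = c" if "\<Phi> (lc N c) \<le> c0 - 1" for m c
  proof -
    have "\<theta> c = 0" using that by (simp add: \<theta>_def)
    then have "\<eta> c = c" by (auto simp: \<eta>_def)
    then show ?thesis by (induction m) auto
  qed
  obtain r where r: "r > 0" "H * r - \<kappa> * r\<^sup>2 \<le> c0 - 1"
  proof -
    \<comment> \<open>Chosen to give \<open>\<kappa> * r \<ge> H + \<bar>c0 - 1\<bar>\<close>
      together with \<open>r \<ge> 1\<close>.\<close>
    define r where "r = (H + \<bar>c0 - 1\<bar>) / \<kappa> + 1"
    have r1: "1 \<le> r" using H_nonneg \<kappa>_pos by (simp add: r_def)
    have "H + \<bar>c0 - 1\<bar> \<le> \<kappa> * r" using \<kappa>_pos by (simp add: r_def field_simps)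
    then have "(H + \<bar>c0 - 1\<bar>) * r \<le> \<kappa> * r * r" using r1 by (intro mult_right_mono) auto
    moreover have "\<bar>c0 - 1\<bar> * 1 \<le> \<bar>c0 - 1\<bar> * r" using r1 by (intro mult_left_mono) auto
    ultimately have "H * r - \<kappa> * r\<^sup>2 \<le> c0 - 1" by (simp add: power2_eq_square algebra_simps)
    then show ?thesis using r1 by (intro that[of r]) auto
  qed
  have ball: "lc N x = lc k x" "(nrm (lc k x))\<^sup>2 = (\<Sum>i=1..k. (x i)\<^sup>2)" if "x \<in> ball_upto k r" for x
    using that by (auto intro!: lc_extend N simp: nrm_lc ball_upto_def)
  have "\<exists>x\<in>ball_upto k r. \<forall>i\<in>{1..k}. - dJ (lc N ((\<eta> ^^ m) x)) (\<phi> i) = 0"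
  proof (rule outward_field_has_zero[OF k r(1)])
    show "continuous_on (ball_upto k r) (\<lambda>x. - dJ (lc N ((\<eta> ^^ m) x)) (\<phi> i))" if "i \<in> {1..k}" for i
    proof (rule continuous_on_minus)
      have "continuous_on UNIV (\<lambda>x. dJ (lc N ((\<eta> ^^ m) x)) (\<phi> i))"
        by (rule continuous_on_compose2[OF continuous_dJ_lc \<eta>m_cont]) (use that in auto)
      then show "continuous_on (ball_upto k r) (\<lambda>x. dJ (lc N ((\<eta> ^^ m) x)) (\<phi> i))"
        by (rule continuous_on_subset) simp
    qed
    fix x assume x: "x \<in> ball_upto k r" and "(\<Sum>i=1..k. (x i)\<^sup>2) = r\<^sup>2"
    then have "(nrm (lc k x))\<^sup>2 = r\<^sup>2" using ball[OF x] by simp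
    then have nr: "nrm (lc k x) = r" using r by (simp add: power2_eq_iff_nonneg)
    have "\<Phi> (lc N x) \<le> c0 - 1" using \<Phi>_X1_le[of x] r by (simp add: ball[OF x] nr)
    then have "(\<Sum>i=1..k. - dJ (lc N ((\<eta> ^^ m) x)) (\<phi> i) * x i) = - (\<Sum>i=1..k. x i * dJ (lc k x) (\<phi> i))"
      by (simp add: \<eta>_fix ball(1)[OF x] sum_negf mult.commute)
    \<comment> \<open>The sum is \<open>dJ\<close> at \<open>lc k x\<close> in its own direction,
      which is twice J by homogeneity of degree two.\<close>
    also have "\<dots> = - 2 * J (lc k x)" by (simp add: J_eq_dJ[OF lc_V] dJ_lc[OF lc_V])
    also have "\<dots> > 0"
    proof -
      have "0 < \<kappa> * r\<^sup>2" using \<kappa>_pos r by simp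
      then show ?thesis using J_X1_le[of x] by (simp add: nr)
    qed
    finally show "0 < (\<Sum>i=1..k. - dJ (lc N ((\<eta> ^^ m) x)) (\<phi> i) * x i)" .
  qed
  then obtain x where x: "x \<in> ball_upto k r" "\<forall>i\<in>{1..k}. dJ (lc N ((\<eta> ^^ m) x)) (\<phi> i) = 0" by auto
  have "c0 \<le> \<Phi> (lc N ((\<eta> ^^ m) x))" using x by (intro c0 lc_V)
  moreover have "\<Phi> (lc N x) \<le> C1" using \<Phi>_X1_le_C1 ball(1)[OF x(1)] by simp
  ultimately show False using iter[of x m] m by simp
qed

section \<open>Passage to the limit\<close>

text \<open>The bound is in the energy norm, in which the span of the eigenfunctions is dense in
  X_0; the L2 terms are absorbed by the Poincare inequality.\<close>

lemma d\<Phi>_bound: "u \<in> V \<Longrightarrow> \<exists>C\<ge>0. \<forall>z\<in>V. \<bar>d\<Phi> u z\<bar> \<le> C * X0_norm K \<Omega> z"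
proof -
  assume u: "u \<in> V"
  note sq = g_sqint[OF V_sqint[OF u]] f_sqint[OF V_sqint[OF u]]
  define L where "L = nrm (\<lambda>x. g (u x)) + nrm (\<lambda>x. f (u x)) + nrm h"
  have L: "0 \<le> L" by (simp add: L_def)
  have "\<bar>d\<Phi> u z\<bar> \<le> (X0_norm K \<Omega> u + L / sqrt (ev 1)) * X0_norm K \<Omega> z" if z: "z \<in> V" for z
  proof -
    have "\<bar>ip (\<lambda>x. g (u x)) z\<bar> + \<bar>ip (\<lambda>x. f (u x)) z\<bar> + \<bar>ip h z\<bar> \<le> L * nrm z"
      unfolding L_def distrib_right by (intro add_mono ip_Cauchy_Schwarz sq h V_sqint z)
    also have "\<dots> \<le> L * (X0_norm K \<Omega> z / sqrt (ev 1))"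
      using L by (intro mult_left_mono Poincare_norm z)
    finally have "\<bar>ip (\<lambda>x. g (u x)) z\<bar> + \<bar>ip (\<lambda>x. f (u x)) z\<bar> + \<bar>ip h z\<bar> \<le> L / sqrt (ev 1) * X0_norm K \<Omega> z"
      by simp
    then show ?thesis
      using E_Cauchy_Schwarz[OF u z] unfolding d\<Phi>_def dJ_def distrib_right by linarith
  qed
  moreover have "0 \<le> X0_norm K \<Omega> u + L / sqrt (ev 1)"
    using L ev1_pos by (intro add_nonneg_nonneg divide_nonneg_nonneg) (auto simp: X0_norm_eq)
  ultimately show ?thesis by blast
qed

lemma d\<Phi>_zero_of_basis:
  assumes u: "u \<in> V" and 0: "\<And>i. 1 \<le> i \<Longrightarrow> d\<Phi> u (\<phi> i) = 0" and v: "v \<in> V"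
  shows "d\<Phi> u v = 0"
proof -
  obtain C where C: "C \<ge> 0" "\<And>z. z \<in> V \<Longrightarrow> \<bar>d\<Phi> u z\<bar> \<le> C * X0_norm K \<Omega> z" using d\<Phi>_bound[OF u] by blast
  have "\<forall>w\<in>V. \<forall>\<epsilon>>0. \<exists>N c. X0_norm K \<Omega> (\<lambda>x. w x - (\<Sum>j=1..N. c j * \<phi> j x)) < \<epsilon>"
    using eigensys unfolding eigensystem_def by (elim conjE) assumption
  then have dense: "\<exists>N c. X0_norm K \<Omega> (\<lambda>x. v x - lc N c x) < \<epsilon>" if "\<epsilon> > 0" for \<epsilon>
    using v that unfolding lc_def by blast
  have "\<bar>d\<Phi> u v\<bar> \<le> 0"
  proof (rule field_le_epsilon)
    fix e :: real assume e: "e > 0"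
    then obtain N c where N: "X0_norm K \<Omega> (\<lambda>x. v x - lc N c x) < e / (C + 1)"
      using dense[of "e / (C + 1)"] C by auto
    have z: "(\<lambda>x. v x - lc N c x) \<in> V" by (intro V_diff v lc_V)
    have "d\<Phi> u (lc N c) = 0" unfolding d\<Phi>_lc[OF u] using 0 by simp
    moreover have "d\<Phi> u (\<lambda>x. v x - lc N c x) = d\<Phi> u v - d\<Phi> u (lc N c)"
      unfolding d\<Phi>_def dJ_diff_right[OF u v lc_V] ip_diff_right[OF V_sqint[OF v] lc_sqint f_sqint[OF V_sqint[OF u]]]
        ip_diff_right[OF V_sqint[OF v] lc_sqint h] by simp
    ultimately have "\<bar>d\<Phi> u v\<bar> \<le> C * X0_norm K \<Omega> (\<lambda>x. v x - lc N c x)" using C(2)[OF z] by simp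
    also have "\<dots> \<le> C * (e / (C + 1))" using N C by (intro mult_left_mono) auto
    also have "\<dots> \<le> e" using C e by (simp add: field_simps)
    finally show "\<bar>d\<Phi> u v\<bar> \<le> 0 + e" by simp
  qed
  then show ?thesis by simp
qed

text \<open>Almost critical points of growing Galerkin spaces are bounded, so a subsequence
  converges in L2. That mode of convergence suffices, because \<open>d\<Phi>\<close> tested with an
  eigenfunction is continuous in L2.\<close>

lemma exists_critical_point: "\<exists>u\<in>V. \<forall>v\<in>V. d\<Phi> u v = 0"
proof -
  have "\<exists>c. \<Phi> (lc (k + n) c) \<le> C1 \<and> (\<forall>i\<in>{1..k + n}. \<bar>d\<Phi> (lc (k + n) c) (\<phi> i)\<bar> \<le> 1 / (real n + 1))" for n
    by (rule Galerkin_almost_critical) auto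
  then obtain c where c: "\<And>n. \<Phi> (lc (k + n) (c n)) \<le> C1"
    "\<And>n i. i \<in> {1..k + n} \<Longrightarrow> \<bar>d\<Phi> (lc (k + n) (c n)) (\<phi> i)\<bar> \<le> 1 / (real n + 1)" by metis
  define w where "w n = lc (k + n) (c n)" for n
  have w: "w n \<in> V" for n by (simp add: w_def lc_V)
  have \<Phi>w: "\<Phi> (w n) \<le> C1" for n using c(1) by (simp add: w_def)
  have d\<Phi>w: "\<bar>d\<Phi> (w n) (\<phi> i)\<bar> \<le> 1 / (real n + 1)" if "i \<in> {1..k + n}" for n i
    using c(2)[OF that] by (simp add: w_def)
  \<comment> \<open>1 for the largest tolerance, H for the passage from \<open>d\<Phi>\<close> to
    \<open>dJ\<close>.\<close>
  have "0 \<le> 1 + H" using H_nonneg by simp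
  from sublevel_bounded[OF this, of C1] obtain R where R: "R \<ge> 0"
    "\<And>w. w \<in> V \<Longrightarrow> \<Phi> w \<le> C1 \<Longrightarrow> (\<forall>i\<in>{1..k}. \<bar>dJ w (\<phi> i)\<bar> \<le> 1 + H) \<Longrightarrow> nrm w \<le> R" by blast
  have nw: "nrm (w n) \<le> R" for n
  proof (rule R(2)[OF w \<Phi>w], rule ballI)
    fix i assume i: "i \<in> {1..k}"
    have "\<bar>d\<Phi> (w n) (\<phi> i)\<bar> \<le> 1 / (real n + 1)" using i by (intro d\<Phi>w) auto
    also have "\<dots> \<le> 1" by simp
    finally show "\<bar>dJ (w n) (\<phi> i)\<bar> \<le> 1 + H" using d\<Phi>_dJ[OF _ w, of i n] i by simp
  qed
  have "E (w n) (w n) \<le> 2 * (C1 + H * R) + \<beta> * R\<^sup>2" for n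
  proof -
    have "H * nrm (w n) \<le> H * R" using nw H_nonneg by (intro mult_left_mono)
    then have "J (w n) \<le> C1 + H * R"
      using \<Phi>w[of n] pert_le[OF V_sqint[OF w], of n] by (simp add: \<Phi>_def)
    moreover have "\<beta> * (nrm (w n))\<^sup>2 \<le> \<beta> * R\<^sup>2"
      using nw[of n] \<alpha>_pos \<alpha>_le_\<beta> by (intro mult_left_mono power_mono) auto
    ultimately show ?thesis
      using J_eq[OF V_sqint[OF w], of n] ip_g_le[OF V_sqint[OF w], of n] by (simp add: field_simps)
  qed
  from bounded_energy_subseq[where w = w, OF w this] obtain r u where r: "strict_mono r" and u: "u \<in> V"
    and lim: "(\<lambda>n. nrm (\<lambda>x. w (r n) x - u x)) \<longlonglongrightarrow> 0" by blast
  have "d\<Phi> u (\<phi> i) = 0" if i: "1 \<le> i" for i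
  proof -
    have "(\<lambda>n. d\<Phi> (w (r n)) (\<phi> i)) \<longlonglongrightarrow> d\<Phi> u (\<phi> i)"
      by (rule d\<Phi>_\<phi>_tendsto[where a = "\<lambda>n. w (r n)", OF i w u lim])
    moreover have "(\<lambda>n. d\<Phi> (w (r n)) (\<phi> i)) \<longlonglongrightarrow> 0"
    proof (rule Lim_null_comparison)
      have "(\<lambda>n. 1 / (real n + 1)) \<longlonglongrightarrow> 0" using LIMSEQ_inverse_real_of_nat by (simp add: inverse_eq_divide add.commute)
      from LIMSEQ_subseq_LIMSEQ[OF this r] show "(\<lambda>n. 1 / (real (r n) + 1)) \<longlonglongrightarrow> 0" by (simp add: comp_def)
      show "\<forall>\<^sub>F n in sequentially. norm (d\<Phi> (w (r n)) (\<phi> i)) \<le> 1 / (real (r n) + 1)"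
      \<comment> \<open>A fixed i is an admissible test index as soon as
        \<open>i \<le> k + r n\<close>.\<close>
      proof (rule eventually_sequentiallyI)
        fix n assume "i \<le> n"
        then have "i \<le> k + r n" using seq_suble[OF r, of n] by simp
        with i show "norm (d\<Phi> (w (r n)) (\<phi> i)) \<le> 1 / (real (r n) + 1)" using d\<Phi>w[of i "r n"] by simp
      qed
    qed
    ultimately show ?thesis by (rule LIMSEQ_unique)
  qed
  with u d\<Phi>_zero_of_basis[OF u] show ?thesis by blast
qed

end

theorem theorem1p2:
  fixes s :: real
    and \<Omega> :: "(real ^ 'n) set"
    and K :: "real ^ 'n \<Rightarrow> real"
    and ev :: "nat \<Rightarrow> real"
    and \<phi> :: "nat \<Rightarrow> real ^ 'n \<Rightarrow> real"
    and k :: nat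
    and \<alpha> \<beta> :: real
    and f F :: "real \<Rightarrow> real"
    and h :: "real ^ 'n \<Rightarrow> real"
  assumes "0 < s" and "s < 1" and "real CARD('n) > 2 * s"
    and "bounded_lipschitz_domain \<Omega>"
    and "admissible_kernel s K"
    and "eigensystem K \<Omega> ev \<phi>"
    and "k \<ge> 1" and "ev k < ev (k + 1)"
    and "ev k < \<alpha>" and "\<alpha> < ev (k + 1)"
    and "is_beta_of K \<Omega> \<phi> k \<alpha> \<beta>"
    and "continuous_on UNIV f" and "bounded (range f)"
    and "L2_on \<Omega> h"
    and "\<And>t. F t = (LBINT \<tau>=0..ereal t. f \<tau>)"
    and landesman_lazer:
      "\<And>(u :: nat \<Rightarrow> real ^ 'n \<Rightarrow> real) v.
         (\<And>j. u j \<in> space_X0 K \<Omega>) \<Longrightarrow>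
         filterlim (\<lambda>j. L2_norm \<Omega> (u j)) at_top sequentially \<Longrightarrow>
         nontrivial_fucik_eigenfunction K \<Omega> \<alpha> \<beta> v \<Longrightarrow>
         (\<lambda>j. L2_norm \<Omega> (\<lambda>x. u j x / L2_norm \<Omega> (u j) - v x)) \<longlonglongrightarrow> 0 \<Longrightarrow>
         filterlim (\<lambda>j. LINT x:\<Omega>|lebesgue. F (u j x) + h x * u j x) at_bot sequentially"
  shows "\<exists>u. weak_solution K \<Omega>
               (\<lambda>x. \<alpha> * max (u x) 0 - \<beta> * max (- u x) 0 + f (u x) + h x) u"
proof -
  interpret fucik_point s K \<Omega> ev \<phi> \<alpha> \<beta> k
    by unfold_locales (use assms in \<open>auto simp: bounded_lipschitz_domain_def\<close>)
  obtain B where B: "\<And>t. \<bar>f t\<bar> \<le> B"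
    using \<open>bounded (range f)\<close> by (auto simp: bounded_iff)
  interpret bounded_nonlinearity f F B
    by unfold_locales (use assms B primitive_properties[of f F] in auto)
  interpret fucik_resonance s K \<Omega> ev \<phi> \<alpha> \<beta> k f F B h
  proof unfold_locales
    show "sqint M h" using \<open>L2_on \<Omega> h\<close> by (simp add: L2_on_iff_sqint)
  next
    fix u :: "nat \<Rightarrow> real ^ 'n \<Rightarrow> real" and v
    assume "\<And>j. u j \<in> V" "filterlim (\<lambda>j. nrm (u j)) at_top sequentially"
      "nontrivial_fucik_eigenfunction K \<Omega> \<alpha> \<beta> v"
      "(\<lambda>j. nrm (\<lambda>x. u j x / nrm (u j) - v x)) \<longlonglongrightarrow> 0"
    then show "filterlim (\<lambda>j. \<integral>x. F (u j x) + h x * u j x \<partial>M) at_bot sequentially"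
      using landesman_lazer[of u v] unfolding L2_norm_eq set_lebesgue_integral_eq_restrict[OF \<Omega>_sets] by blast
  qed
  obtain u where u: "u \<in> V" and crit: "\<And>v. v \<in> V \<Longrightarrow> d\<Phi> u v = 0"
    using exists_critical_point by blast
  have "E u v = (LINT x:\<Omega>|lebesgue. (\<alpha> * max (u x) 0 - \<beta> * max (- u x) 0 + f (u x) + h x) * v x)" if v: "v \<in> V" for v
  proof -
    note sq = g_sqint[OF V_sqint[OF u]] f_sqint[OF V_sqint[OF u]] V_sqint[OF v]
    have "(LINT x:\<Omega>|lebesgue. (\<alpha> * max (u x) 0 - \<beta> * max (- u x) 0 + f (u x) + h x) * v x)
        = ip (\<lambda>x. g (u x) + f (u x) + h x) v"
      by (simp add: ip_eq set_lebesgue_integral_eq_restrict fucik_rhs_def)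
    also have "\<dots> = ip (\<lambda>x. g (u x)) v + ip (\<lambda>x. f (u x)) v + ip h v"
      by (simp only: ip_add_left[OF sqint_add[OF sq(1,2)] h sq(3)] ip_add_left[OF sq])
    also have "\<dots> = E u v" using crit[OF v] by (simp add: d\<Phi>_def dJ_def)
    finally show ?thesis ..
  qed
  with u show ?thesis unfolding weak_solution_def by blast
qed

end
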